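(* Let $\boldsymbol{\gamma}$ be a multi-index with $|\boldsymbol{\gamma}|\le2$ and let $\hat\Pi$ denote the full $C^1$-$Q_2$ interpolation operator on the reference macro-element over $\Lambda=[-1,1]^2$. There is a constant $C$ such that for every $u\in H^4(\Lambda)$ $$\big\|\boldsymbol{D}^{\boldsymbol{\gamma}}(u-\hat\Pi u)\big\|_0\le C\left(\left|\boldsymbol{D}^{\boldsymbol{\gamma}}u\right|_{4-|\boldsymbol{\gamma}|}+\sum_{|\boldsymbol{\alpha}|=3-|\boldsymbol{\gamma}|}\left|\int_\Lambda\boldsymbol{D}^{\boldsymbol{\alpha}}\boldsymbol{D}^{\boldsymbol{\gamma}}u(x,y)\,dx\,dy\right|\right).$$
   Context: $\boldsymbol{D}^{\boldsymbol{\alpha}}=\partial_x^{\alpha_1}\partial_y^{\alpha_2}$; $\|\cdot\|_0$ is the $L_2(\Lambda)$ norm and $|\cdot|_k$ the $H^k(\Lambda)$ semi-norm. For $i\in\{-1,1\}$ let $\hat\varphi_i,\hat\psi_i\in C^1[-1,1]$ be the functions that are quadratic polynomials on each of $[-1,0]$ and $[0,1]$ and are uniquely determined by $\hat\varphi_i(k)=\delta_{ik}$, $\hat\varphi_i'(k)=0$, $\hat\psi_i(k)=0$, $\hat\psi_i'(k)=\delta_{ik}$ for $k\in\{-1,1\}$. The full $C^1$-$Q_2$ interpolation operator on $\Lambda$ is defined for $v\in C^2(\Lambda)$ by $$\hat\Pi v(x,y)=\sum_{i,j\in\{-1,1\}}\Big(v(i,j)\hat\varphi_i(x)\hat\varphi_j(y)+v_x(i,j)\hat\psi_i(x)\hat\varphi_j(y)+v_y(i,j)\hat\varphi_i(x)\hat\psi_j(y)+v_{xy}(i,j)\hat\psi_i(x)\hat\psi_j(y)\Big).$$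 It takes values in the $C^1(\Lambda)$ functions that are biquadratic on each of the four squares into which the coordinate axes divide $\Lambda$. *)

theory Defs
  imports "HOL-Analysis.Analysis" "HOL-Computational_Algebra.Polynomial"
begin

definition Lam :: "(real \<times> real) set" where
  "Lam = {-1..1} \<times> {-1..1}"

text \<open>Derivatives are taken within \<open>[-1, 1]\<close>, hence they are one-sided at the boundary
  and depend only on the values of the function on \<open>Lam\<close>.\<close>

definition Dx :: "(real \<times> real \<Rightarrow> real) \<Rightarrow> real \<times> real \<Rightarrow> real" where
  "Dx f = (\<lambda>(x, y). vector_derivative (\<lambda>t. f (t, y)) (at x within {-1..1}))"

definition Dy :: "(real \<times> real \<Rightarrow> real) \<Rightarrow> real \<times> real \<Rightarrow> real" where
  "Dy f = (\<lambda>(x, y). vector_derivative (\<lambda>t. f (x, t)) (at y within {-1..1}))"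

definition mi_order :: "nat \<times> nat \<Rightarrow> nat" where
  "mi_order \<alpha> = fst \<alpha> + snd \<alpha>"

definition D_classical :: "nat \<times> nat \<Rightarrow> (real \<times> real \<Rightarrow> real) \<Rightarrow> real \<times> real \<Rightarrow> real" where
  "D_classical \<alpha> f = (Dx ^^ fst \<alpha>) ((Dy ^^ snd \<alpha>) f)"

primrec C_Lam :: "nat \<Rightarrow> (real \<times> real \<Rightarrow> real) set" where
  "C_Lam 0 = {f. continuous_on Lam f}"
| "C_Lam (Suc k) = {f. continuous_on Lam f
     \<and> (\<forall>x\<in>{-1..1}. \<forall>y\<in>{-1..1}.
          (\<lambda>t. f (t, y)) differentiable (at x within {-1..1})
        \<and> (\<lambda>t. f (x, t)) differentiable (at y within {-1..1}))
     \<and> Dx f \<in> C_Lam k \<and> Dy f \<in> C_Lam k}"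

text \<open>Elements of \<open>L_2\<close> and of the Sobolev spaces are represented by functions; the definitions
  of norms and weak derivatives are invariant under changes on null sets and outside \<open>Lam\<close>.\<close>

definition L2_Lam :: "(real \<times> real \<Rightarrow> real) set" where
  "L2_Lam = {f \<in> borel_measurable (lebesgue_on Lam). integrable (lebesgue_on Lam) (\<lambda>z. (f z)\<^sup>2)}"

definition L2_norm_Lam :: "(real \<times> real \<Rightarrow> real) \<Rightarrow> real" where
  "L2_norm_Lam f = sqrt (LINT z|lebesgue_on Lam. (f z)\<^sup>2)"

definition test_fun :: "(real \<times> real \<Rightarrow> real) \<Rightarrow> bool" where
  "test_fun \<phi> \<longleftrightarrow> (\<forall>k. \<phi> \<in> C_Lam k) \<and>
     (\<exists>K. compact K \<and> K \<subseteq> interior Lam \<and> (\<forall>z\<in>Lam - K. \<phi> z = 0))"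

definition has_weak_deriv ::
  "nat \<times> nat \<Rightarrow> (real \<times> real \<Rightarrow> real) \<Rightarrow> (real \<times> real \<Rightarrow> real) \<Rightarrow> bool" where
  "has_weak_deriv \<alpha> u w \<longleftrightarrow> (\<forall>\<phi>. test_fun \<phi> \<longrightarrow>
     (LINT z|lebesgue_on Lam. u z * D_classical \<alpha> \<phi> z)
       = (-1) ^ mi_order \<alpha> * (LINT z|lebesgue_on Lam. w z * \<phi> z))"

definition H_Lam :: "nat \<Rightarrow> (real \<times> real \<Rightarrow> real) set" where
  "H_Lam k = {u \<in> L2_Lam. \<forall>\<alpha>. mi_order \<alpha> \<le> k \<longrightarrow> (\<exists>w\<in>L2_Lam. has_weak_deriv \<alpha> u w)}"

text \<open>The weak derivative is determined only almost everywhere, so a representative is chosen.\<close>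

definition D_weak :: "nat \<times> nat \<Rightarrow> (real \<times> real \<Rightarrow> real) \<Rightarrow> real \<times> real \<Rightarrow> real" where
  "D_weak \<alpha> u = (SOME w. w \<in> L2_Lam \<and> has_weak_deriv \<alpha> u w)"

definition H_seminorm_Lam :: "nat \<Rightarrow> (real \<times> real \<Rightarrow> real) \<Rightarrow> real" where
  "H_seminorm_Lam k u = sqrt (\<Sum>\<alpha>\<in>{\<alpha>. mi_order \<alpha> = k}. (L2_norm_Lam (D_weak \<alpha> u))\<^sup>2)"

definition C1_quad_spline :: "(real \<Rightarrow> real) \<Rightarrow> bool" where
  "C1_quad_spline f \<longleftrightarrow>
     (\<forall>x\<in>{-1..1}. f differentiable (at x within {-1..1}))
   \<and> continuous_on {-1..1} (\<lambda>x. vector_derivative f (at x within {-1..1}))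
   \<and> (\<exists>p. degree p \<le> 2 \<and> (\<forall>x\<in>{-1..0}. f x = poly p x))
   \<and> (\<exists>q. degree q \<le> 2 \<and> (\<forall>x\<in>{0..1}. f x = poly q x))"

text \<open>The nodal conditions determine the values on \<open>[-1, 1]\<close>; see the lemmas that follow.\<close>

definition phi_hat :: "real \<Rightarrow> real \<Rightarrow> real" where
  "phi_hat i = (SOME f. C1_quad_spline f \<and>
     (\<forall>k\<in>{-1, 1}. f k = of_bool (i = k) \<and> vector_derivative f (at k within {-1..1}) = 0))"

definition psi_hat :: "real \<Rightarrow> real \<Rightarrow> real" where
  "psi_hat i = (SOME f. C1_quad_spline f \<and>
     (\<forall>k\<in>{-1, 1}. f k = 0 \<and> vector_derivative f (at k within {-1..1}) = of_bool (i = k)))"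

lemma C1_quad_spline_exists:
  fixes a b c d :: real
  shows "\<exists>f. C1_quad_spline f \<and> f (-1) = a \<and> f 1 = b
    \<and> vector_derivative f (at (-1) within {-1..1}) = c
    \<and> vector_derivative f (at 1 within {-1..1}) = d"
proof -
  define A where "A = ((d - c) / 2 + (b - a - d - c)) / 2"
  define K where "K = (d - c) / 2 - 2 * A"
  define f where "f = (\<lambda>x::real. a + c * (x + 1) + A * (x + 1)\<^sup>2 + K * (max 0 x)\<^sup>2)"
  define f' where "f' = (\<lambda>x::real. c + 2 * A * (x + 1) + 2 * K * max 0 x)"
  have m: "((\<lambda>x::real. (max 0 x)\<^sup>2) has_real_derivative 2 * max 0 x) (at x)" for x
  proof -
    consider "x < 0" | "x = 0" | "x > 0" by linarith
    then show ?thesis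
    proof cases
      case 1
      have "((\<lambda>x::real. 0) has_real_derivative 0) (at x)" by simp
      then have "((\<lambda>x::real. (max 0 x)\<^sup>2) has_real_derivative 0) (at x)"
        by (rule has_field_derivative_transform_within_open[where S = "{..<0}"]) (use 1 in auto)
      then show ?thesis using 1 by simp
    next
      case 2
      have "((\<lambda>h::real. (max 0 h)\<^sup>2 / h) \<longlongrightarrow> 0) (at 0)"
      proof (rule Lim_null_comparison)
        show "\<forall>\<^sub>F h in at 0. norm ((max 0 h)\<^sup>2 / h) \<le> \<bar>h::real\<bar>"
          by (rule always_eventually) (auto simp: max_def power2_eq_square)
        show "((\<lambda>h::real. \<bar>h\<bar>) \<longlongrightarrow> 0) (at 0)"
          by (rule tendsto_eq_intros | simp)+
      qed
      then show ?thesis using 2 by (simp add: DERIV_def)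
    next
      case 3
      have "((\<lambda>x::real. x\<^sup>2) has_real_derivative 2 * x) (at x)"
        by (auto intro!: derivative_eq_intros)
      then have "((\<lambda>x::real. (max 0 x)\<^sup>2) has_real_derivative 2 * x) (at x)"
        by (rule has_field_derivative_transform_within_open[where S = "{0<..}"]) (use 3 in auto)
      then show ?thesis using 3 by simp
    qed
  qed
  have der: "(f has_real_derivative f' x) (at x)" for x
  proof -
    have "((\<lambda>x. a + c * (x + 1) + A * (x + 1)\<^sup>2) has_real_derivative c + 2 * A * (x + 1)) (at x)"
      by (auto intro!: derivative_eq_intros)
    from DERIV_add[OF this DERIV_cmult[OF m, of K]] show ?thesis
      by (simp add: f_def f'_def algebra_simps)
  qed
  have vd: "vector_derivative f (at x within {-1..1}) = f' x" if "x \<in> {-1..1}" for x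
    using that der[of x]
    by (intro vector_derivative_within_cbox[where a="-1" and b=1, simplified])
       (auto simp: has_real_derivative_iff_has_vector_derivative intro: has_vector_derivative_at_within)
  have "f differentiable (at x within {-1..1})" for x
    using der[of x] real_differentiable_def differentiable_at_withinI by blast
  moreover have "continuous_on {-1..1} (\<lambda>x. vector_derivative f (at x within {-1..1}))"
  proof -
    have "continuous_on {-1..1} f'" unfolding f'_def by (intro continuous_intros)
    then show ?thesis by (rule continuous_on_eq) (simp add: vd)
  qed
  moreover have "\<exists>p. degree p \<le> 2 \<and> (\<forall>x\<in>{-1..0}. f x = poly p x)"
    by (intro exI[of _ "[:a + c + A, c + 2 * A, A:]"])
       (auto simp: f_def algebra_simps power2_eq_square)
  moreover have "\<exists>p. degree p \<le> 2 \<and> (\<forall>x\<in>{0..1}. f x = poly p x)"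
    by (intro exI[of _ "[:a + c + A, c + 2 * A, A + K:]"])
       (auto simp: f_def algebra_simps power2_eq_square)
  ultimately have "C1_quad_spline f" by (simp add: C1_quad_spline_def)
  moreover have "f (-1) = a" "f 1 = b" "f' (-1) = c" "f' 1 = d"
    by (simp_all add: f_def f'_def A_def K_def field_simps)
  ultimately show ?thesis using vd by (intro exI[of _ f]) simp
qed

lemma C1_quad_spline_unique:
  assumes "C1_quad_spline f" "C1_quad_spline g" "f (-1) = g (-1)" "f 1 = g 1"
    and "vector_derivative f (at (-1) within {-1..1}) = vector_derivative g (at (-1) within {-1..1})"
    and "vector_derivative f (at 1 within {-1..1}) = vector_derivative g (at 1 within {-1..1})"
    and "x \<in> {-1..1}"
  shows "f x = g x"
proof -
  have deg2: "\<exists>a b c. p = [:a, b, c:]" if "degree p \<le> 2" for p :: "real poly"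
  proof (intro exI poly_eqI)
    fix n
    have "coeff p n = 0" if "n > 2" using that \<open>degree p \<le> 2\<close> by (intro coeff_eq_0) simp
    then consider "n = 0" | "n = 1" | "n = 2" | "n > 2" "coeff p n = 0" by linarith
    then show "coeff p n = coeff [:coeff p 0, coeff p 1, coeff p 2:] n"
      by cases (simp_all add: coeff_pCons numeral_2_eq_2 split: nat.split)
  qed
  have piece: "vector_derivative h (at x within {-1..1}) = poly (pderiv p) x"
    if h: "C1_quad_spline h" "\<forall>x\<in>{l..r}. h x = poly p x"
      and lr: "-1 \<le> l" "l < r" "r \<le> 1" "x \<in> {l..r}" for h p l r x
  proof -
    have "(h has_vector_derivative vector_derivative h (at x within {-1..1})) (at x within {-1..1})"
      using h lr unfolding C1_quad_spline_def by (subst vector_derivative_works[symmetric]) auto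
    then have 1: "(h has_vector_derivative vector_derivative h (at x within {-1..1})) (at x within {l..r})"
      by (rule has_vector_derivative_within_subset) (use lr in auto)
    have "(poly p has_vector_derivative poly (pderiv p) x) (at x within {l..r})"
      using poly_DERIV[of p x]
      by (simp add: has_real_derivative_iff_has_vector_derivative has_vector_derivative_at_within)
    then have 2: "(h has_vector_derivative poly (pderiv p) x) (at x within {l..r})"
      by (rule has_vector_derivative_transform[rotated 2]) (use h lr in auto)
    show ?thesis
      using vector_derivative_within_cbox[OF _ _ 1[folded cbox_interval]]
        vector_derivative_within_cbox[OF _ _ 2[folded cbox_interval]] lr
      by (simp add: cbox_interval)
  qed
  have key: "\<exists>p0 p1 p2 q2. (\<forall>x\<in>{-1..0}. h x = p0 + p1 * x + p2 * x\<^sup>2)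
      \<and> (\<forall>x\<in>{0..1}. h x = p0 + p1 * x + q2 * x\<^sup>2)
      \<and> vector_derivative h (at (-1) within {-1..1}) = p1 - 2 * p2
      \<and> vector_derivative h (at 1 within {-1..1}) = p1 + 2 * q2"
    if h: "C1_quad_spline h" for h
  proof -
    from h obtain p q where p: "degree p \<le> 2" "\<forall>x\<in>{-1..0}. h x = poly p x"
      and q: "degree q \<le> 2" "\<forall>x\<in>{0..1}. h x = poly q x"
      unfolding C1_quad_spline_def by blast
    obtain p0 p1 p2 q0 q1 q2 where pq: "p = [:p0, p1, p2:]" "q = [:q0, q1, q2:]"
      using deg2[OF p(1)] deg2[OF q(1)] by blast
    have "p0 = q0" using p(2)[rule_format, of 0] q(2)[rule_format, of 0] pq by simp
    moreover have "p1 = q1"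
      using piece[OF h p(2), of 0] piece[OF h q(2), of 0] pq by (simp add: pderiv_pCons)
    moreover have "vector_derivative h (at (-1) within {-1..1}) = p1 - 2 * p2"
      using piece[OF h p(2), of "-1"] pq by (simp add: pderiv_pCons)
    moreover have "vector_derivative h (at 1 within {-1..1}) = q1 + 2 * q2"
      using piece[OF h q(2), of 1] pq by (simp add: pderiv_pCons)
    moreover have "\<forall>x\<in>{-1..0}. h x = p0 + p1 * x + p2 * x\<^sup>2"
      using p(2) by (simp add: pq algebra_simps power2_eq_square)
    moreover have "\<forall>x\<in>{0..1}. h x = q0 + q1 * x + q2 * x\<^sup>2"
      using q(2) by (simp add: pq algebra_simps power2_eq_square)
    ultimately show ?thesis by blast
  qed
  obtain p0 p1 p2 q2 where F: "\<forall>x\<in>{-1..0}. f x = p0 + p1 * x + p2 * x\<^sup>2"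
      "\<forall>x\<in>{0..1}. f x = p0 + p1 * x + q2 * x\<^sup>2"
      "vector_derivative f (at (-1) within {-1..1}) = p1 - 2 * p2"
      "vector_derivative f (at 1 within {-1..1}) = p1 + 2 * q2"
    using key[OF assms(1)] by blast
  obtain r0 r1 r2 s2 where G: "\<forall>x\<in>{-1..0}. g x = r0 + r1 * x + r2 * x\<^sup>2"
      "\<forall>x\<in>{0..1}. g x = r0 + r1 * x + s2 * x\<^sup>2"
      "vector_derivative g (at (-1) within {-1..1}) = r1 - 2 * r2"
      "vector_derivative g (at 1 within {-1..1}) = r1 + 2 * s2"
    using key[OF assms(2)] by blast
  have e: "p0 - p1 + p2 = r0 - r1 + r2" "p0 + p1 + q2 = r0 + r1 + s2"
    "p1 - 2 * p2 = r1 - 2 * r2" "p1 + 2 * q2 = r1 + 2 * s2"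
    using F(1)[rule_format, of "-1"] G(1)[rule_format, of "-1"]
      F(2)[rule_format, of 1] G(2)[rule_format, of 1] F(3,4) G(3,4) assms(3-6) by simp_all
  then have "p0 = r0" "p1 = r1" "p2 = r2" "q2 = s2" by linarith+
  then show ?thesis using F(1,2) G(1,2) assms(7) by (cases "x \<le> 0") simp_all
qed

lemma phi_hat_spec:
  "C1_quad_spline (phi_hat i) \<and> (\<forall>k\<in>{-1, 1}. phi_hat i k = of_bool (i = k)
     \<and> vector_derivative (phi_hat i) (at k within {-1..1}) = 0)"
proof -
  have "\<exists>f. C1_quad_spline f \<and> (\<forall>k\<in>{-1, 1}. f k = of_bool (i = k)
     \<and> vector_derivative f (at k within {-1..1}) = 0)"
    using C1_quad_spline_exists[of "of_bool (i = -1)" "of_bool (i = 1)" 0 0] by blast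
  from someI_ex[OF this] show ?thesis unfolding phi_hat_def .
qed

lemma psi_hat_spec:
  "C1_quad_spline (psi_hat i) \<and> (\<forall>k\<in>{-1, 1}. psi_hat i k = 0
     \<and> vector_derivative (psi_hat i) (at k within {-1..1}) = of_bool (i = k))"
proof -
  have "\<exists>f. C1_quad_spline f \<and> (\<forall>k\<in>{-1, 1}. f k = 0
     \<and> vector_derivative f (at k within {-1..1}) = of_bool (i = k))"
    using C1_quad_spline_exists[of 0 0 "of_bool (i = -1)" "of_bool (i = 1)"] by blast
  from someI_ex[OF this] show ?thesis unfolding psi_hat_def .
qed

definition interp_C2 :: "(real \<times> real \<Rightarrow> real) \<Rightarrow> real \<times> real \<Rightarrow> real" where
  "interp_C2 v = (\<lambda>(x, y). \<Sum>i\<in>{-1, 1}. \<Sum>j\<in>{-1, 1}.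
       v (i, j) * phi_hat i x * phi_hat j y
     + Dx v (i, j) * psi_hat i x * phi_hat j y
     + Dy v (i, j) * phi_hat i x * psi_hat j y
     + Dy (Dx v) (i, j) * psi_hat i x * psi_hat j y)"

text \<open>A function in \<open>H\<^sup>4\<close> is almost everywhere equal to a function in \<open>C\<^sup>2\<close>,
  which is unique on \<open>Lam\<close>; nodal values and derivatives are those of this function.\<close>

definition C2_rep :: "(real \<times> real \<Rightarrow> real) \<Rightarrow> real \<times> real \<Rightarrow> real" where
  "C2_rep u = (SOME v. v \<in> C_Lam 2 \<and> (AE z in lebesgue_on Lam. v z = u z))"

definition interp :: "(real \<times> real \<Rightarrow> real) \<Rightarrow> real \<times> real \<Rightarrow> real" where
  "interp u = interp_C2 (C2_rep u)"

end

theory Submission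
  imports Defs
begin

text \<open>Let \<open>v\<close> be the \<open>C\<^sup>2\<close> representative of \<open>u\<close> and \<open>e = v - p\<close>, where \<open>p\<close> is the polynomial of degree at
  most 2 for which all derivatives of \<open>e\<close> of order at most 2 have mean zero. Interpolation reproduces
  \<open>p\<close>, so the error is that of \<open>e\<close>. In the basis \<open>1, x + 1, (x + 1)\<^sup>2, max(0, x)\<^sup>2\<close> of the \<open>C\<^sup>1\<close> quadratic
  splines the first \<open>k\<close> coordinates vanish after \<open>k\<close> differentiations, and by the mean value theorem
  the remaining coordinates of an interpolant are controlled by the derivative alone (\<open>k = 1\<close>), or by
  its oscillation (\<open>k = 2\<close>). Hence \<open>D\<^sup>\<gamma>\<close> of the interpolant of \<open>e\<close> is bounded by suprema and oscillations that
  only involve derivatives \<open>D\<^sup>\<alpha> e\<close> with \<open>\<alpha> \<ge> \<gamma>\<close>.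

  For these, write \<open>f = A f + T f'\<close> with \<open>A\<close> a mean with a smooth compactly supported weight and \<open>T\<close> an
  integral operator with bounded kernel. In both variables this represents \<open>f\<close> by integrals of
  \<open>f, f\<^sub>x, f\<^sub>y, f\<^sub>x\<^sub>y\<close>, which yields the continuous representatives and bounds their suprema and oscillations
  by \<open>L\<^sub>1\<close> norms of weak derivatives. A Poincare inequality in \<open>L\<^sub>1\<close>, applied repeatedly, reduces
  these norms to the derivatives of order 4 and the means of those of order 3.\<close>

section \<open>Compactly supported smooth functions on the line\<close>

text \<open>The right-hand side contains \<open>D\<^sup>\<alpha> u\<close> only for
  \<open>\<alpha> \<ge> \<gamma>\<close>, whereas the interpolant is built from nodal data of orders
  that may lie below \<open>\<gamma>\<close>; bounding these data directly would bring in lower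
  derivatives. So every estimate has to stay in the cone of multi-indices above
  \<open>\<gamma>\<close>. Two observations beyond the choice of basis make this possible. An
  oscillation in x kills all terms that are averaged in x, so it is bounded by x-derivatives alone,
  and likewise in y. A Poincare step bounds the entry (a, b) by (a+1, b) and (a, b+1), which lie in
  the cone if (a, b) does. Order 4 is exactly enough: the representation of a function costs one
  more derivative in each variable, so the derivatives of order up to 2 become continuous. The means
  of order 3 remain on the right because x^3 is not reproduced by the interpolation, so that
  \<open>p\<close> is kept quadratic and cannot remove them.\<close>

primrec cont_diff :: "nat \<Rightarrow> (real \<Rightarrow> real) \<Rightarrow> bool" where
  "cont_diff 0 a \<longleftrightarrow> continuous_on UNIV a"
| "cont_diff (Suc n) a \<longleftrightarrow> (\<exists>a'. (\<forall>x. (a has_real_derivative a' x) (at x)) \<and> cont_diff n a')"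

lemma cont_diff_continuous: "cont_diff n a \<Longrightarrow> continuous_on UNIV a"
  by (cases n) (auto intro!: continuous_at_imp_continuous_on intro: DERIV_isCont)

lemma cont_diff_Suc: "cont_diff (Suc n) a \<Longrightarrow> cont_diff n a"
proof (induction n arbitrary: a)
  case 0 then show ?case using cont_diff_continuous[of "Suc 0" a] by simp
next
  case (Suc n)
  from Suc.prems obtain a' where a': "\<forall>x. (a has_real_derivative a' x) (at x)" "cont_diff (Suc n) a'"
    unfolding cont_diff.simps(2)[of "Suc n"] by blast
  with Suc.IH[of a'] show ?case by auto
qed

lemma cont_diff_add: "cont_diff n a \<Longrightarrow> cont_diff n b \<Longrightarrow> cont_diff n (\<lambda>x. a x + b x)"
proof (induction n arbitrary: a b)
  case 0 then show ?case by (auto intro: continuous_intros)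
next
  case (Suc n)
  then obtain a' b' where *: "\<forall>x. (a has_real_derivative a' x) (at x)" "cont_diff n a'"
     "\<forall>x. (b has_real_derivative b' x) (at x)" "cont_diff n b'" by auto
  show ?case unfolding cont_diff.simps
    by (rule exI[of _ "\<lambda>x. a' x + b' x"]) (use * Suc.IH in \<open>auto intro!: derivative_eq_intros\<close>)
qed

lemma cont_diff_mult: "cont_diff n a \<Longrightarrow> cont_diff n b \<Longrightarrow> cont_diff n (\<lambda>x. a x * b x)"
proof (induction n arbitrary: a b)
  case 0 then show ?case by (auto intro: continuous_intros)
next
  case (Suc n)
  then obtain a' b' where *: "\<forall>x. (a has_real_derivative a' x) (at x)" "cont_diff n a'"
     "\<forall>x. (b has_real_derivative b' x) (at x)" "cont_diff n b'" by auto
  have "cont_diff n a" "cont_diff n b" using Suc.prems cont_diff_Suc by blast+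
  then have "cont_diff n (\<lambda>x. a' x * b x + b' x * a x)"
    by (intro cont_diff_add Suc.IH) (use * in auto)
  then show ?case unfolding cont_diff.simps
    by (intro exI[of _ "\<lambda>x. a' x * b x + b' x * a x"]) (use * in \<open>auto intro!: derivative_eq_intros\<close>)
qed

lemma cont_diff_const: "cont_diff n (\<lambda>x. c)"
proof (induction n arbitrary: c)
  case (Suc n) then show ?case unfolding cont_diff.simps by (intro exI[of _ "\<lambda>x. 0"]) auto
qed simp

lemma cont_diff_affine: "cont_diff n a \<Longrightarrow> cont_diff n (\<lambda>x. a (c * x + d))"
proof (induction n arbitrary: a)
  case 0 then have "continuous_on UNIV a" by simp
  then have "continuous_on UNIV (\<lambda>x. a (c * x + d))"
    by (rule continuous_on_compose2[of UNIV a]) (auto intro: continuous_intros)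
  then show ?case by simp
next
  case (Suc n)
  then obtain a' where *: "\<forall>x. (a has_real_derivative a' x) (at x)" "cont_diff n a'" by auto
  have "((\<lambda>x. a (c * x + d)) has_real_derivative c * a' (c * x + d)) (at x)" for x
  proof -
    have "((\<lambda>x. c * x + d) has_real_derivative c) (at x)" by (auto intro!: derivative_eq_intros)
    from DERIV_chain2[OF spec[OF *(1)] this] show ?thesis by (simp only: mult.commute)
  qed
  moreover have "cont_diff n (\<lambda>x. c * a' (c * x + d))" using Suc.IH[of a'] * by (intro cont_diff_mult cont_diff_const) auto
  ultimately show ?case unfolding cont_diff.simps by (intro exI[of _ "\<lambda>x. c * a' (c * x + d)"]) blast
qed

text \<open>The functions \<open>p(1/x) exp(-1/x)\<close> with \<open>p\<close> a polynomial are closed under differentiation,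
  hence smooth.\<close>

definition flat :: "real poly \<Rightarrow> real \<Rightarrow> real" where
  "flat p x = (if x > 0 then poly p (1 / x) * exp (- (1 / x)) else 0)"

lemma poly_exp_tendsto_0: "((\<lambda>t::real. poly p t * exp (- t)) \<longlongrightarrow> 0) at_top"
proof -
  have "((\<lambda>t::real. \<Sum>i\<le>degree p. coeff p i * (t ^ i / exp t)) \<longlongrightarrow> (\<Sum>i\<le>degree p. coeff p i * 0)) at_top"
    by (intro tendsto_sum tendsto_mult tendsto_const tendsto_power_div_exp_0)
  then show ?thesis
    by (simp add: poly_altdef exp_minus sum_distrib_left sum_distrib_right divide_inverse mult_ac)
qed

text \<open>Substitute t = 1/x: since dt/dx = -t^2, the derivative of p(t) exp(-t) is t^2 (p(t) -
  p'(t)) exp(-t), again of the same shape. At 0 the right difference quotient is t p(t) exp(-t),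
  which tends to 0 as t grows; the left one is 0.\<close>

lemma flat_deriv:
  "(flat p has_real_derivative flat ([:0,0,1:] * (p - pderiv p)) x) (at x)"
proof -
  consider "x < 0" | "x = 0" | "x > 0" by linarith
  then show ?thesis
  proof cases
    case 1
    have "((\<lambda>x. 0::real) has_real_derivative 0) (at x)" by simp
    then have "(flat p has_real_derivative 0) (at x)"
      by (rule has_field_derivative_transform_within_open[where S = "{..<0}"])
         (use 1 in \<open>auto simp: flat_def\<close>)
    then show ?thesis using 1 by (simp add: flat_def)
  next
    case 2
    have "((\<lambda>h. flat p h / h) \<longlongrightarrow> 0) (at_right 0)"
    proof -
      have "((\<lambda>h. poly (pCons 0 p) (inverse h) * exp (- inverse h)) \<longlongrightarrow> 0) (at_right (0::real))"
        by (rule filterlim_compose[OF poly_exp_tendsto_0 filterlim_inverse_at_top_right])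
      then show ?thesis
        by (rule Lim_transform_eventually)
           (auto simp: flat_def eventually_at_right_less field_simps intro!: eventually_at_rightI[of 0 1])
    qed
    moreover have "((\<lambda>h. flat p h / h) \<longlongrightarrow> 0) (at_left 0)"
      by (rule Lim_transform_eventually[OF tendsto_const])
         (auto simp: flat_def intro!: eventually_at_leftI[of "-1" 0])
    ultimately have "((\<lambda>h. flat p h / h) \<longlongrightarrow> 0) (at 0)"
      by (simp add: filterlim_split_at)
    then show ?thesis using 2 by (simp add: DERIV_def flat_def)
  next
    case 3
    have "((\<lambda>x. poly p (1 / x) * exp (- (1 / x))) has_real_derivative
        poly ([:0,0,1:] * (p - pderiv p)) (1 / x) * exp (- (1 / x))) (at x)"
      using 3 by (auto intro!: derivative_eq_intros DERIV_chain2[OF poly_DERIV] simp: field_simps power2_eq_square)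
    then have "(flat p has_real_derivative poly ([:0,0,1:] * (p - pderiv p)) (1 / x) * exp (- (1 / x))) (at x)"
      by (rule has_field_derivative_transform_within_open[where S = "{0<..}"])
         (use 3 in \<open>auto simp: flat_def\<close>)
    then show ?thesis using 3 by (simp add: flat_def)
  qed
qed

lemma cont_diff_flat: "cont_diff n (flat p)"
proof (induction n arbitrary: p)
  case 0 show ?case using flat_deriv by (auto intro!: continuous_at_imp_continuous_on DERIV_isCont)
next
  case (Suc n) then show ?case unfolding cont_diff.simps using flat_deriv by blast
qed

text \<open>The smooth functions with compact support in the open interval (-1, 1). The gap between
  c and 1 keeps the support of a product of two bumps inside a compact subset of the interior of
  \<open>Lam\<close>, as \<open>test_fun\<close> demands.\<close>

definition bump :: "(real \<Rightarrow> real) \<Rightarrow> bool" where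
  "bump a \<longleftrightarrow> (\<forall>n. cont_diff n a) \<and> (\<exists>c<1. \<forall>x. \<bar>x\<bar> > c \<longrightarrow> a x = 0)"

lemma bump_cont_diff: "bump a \<Longrightarrow> cont_diff n a" by (simp add: bump_def)

lemma bump_continuous: "bump a \<Longrightarrow> continuous_on UNIV a"
  using bump_cont_diff cont_diff_continuous by blast

lemma bump_DERIV: "bump a \<Longrightarrow> (a has_real_derivative deriv a x) (at x)"
  using bump_cont_diff[of a "Suc 0"] by (auto simp del: cont_diff.simps(1)) (metis DERIV_imp_deriv)

lemma bump_deriv: assumes "bump a" shows "bump (deriv a)"
proof -
  have "cont_diff n (deriv a)" for n
  proof -
    obtain a' where "\<forall>x. (a has_real_derivative a' x) (at x)" "cont_diff n a'"
      using bump_cont_diff[OF assms, of "Suc n"] by auto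
    moreover from this have "deriv a = a'" by (auto simp: DERIV_imp_deriv)
    ultimately show ?thesis by simp
  qed
  moreover obtain c where c: "c < 1" "\<And>x. \<bar>x\<bar> > c \<Longrightarrow> a x = 0" using assms by (auto simp: bump_def)
  have "deriv a x = 0" if "\<bar>x\<bar> > c" for x
  proof -
    have "(a has_real_derivative 0) (at x)"
      by (rule has_field_derivative_transform_within_open[where S = "{x. c < \<bar>x\<bar>}" and f = "\<lambda>x. 0"])
         (use c that in \<open>auto intro!: open_Collect_less continuous_intros\<close>)
    then show ?thesis by (rule DERIV_imp_deriv)
  qed
  ultimately show ?thesis using c(1) unfolding bump_def by blast
qed

lemma bump_funpow_deriv: "bump a \<Longrightarrow> bump ((deriv ^^ n) a)"
  by (induction n) (auto intro: bump_deriv)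

lemma bump_lincomb: assumes "bump a" "bump b" shows "bump (\<lambda>x. r * a x + s * b x)"
proof -
  obtain c where c: "c < 1" "\<And>x. \<bar>x\<bar> > c \<Longrightarrow> a x = 0" using assms by (auto simp: bump_def)
  obtain d where d: "d < 1" "\<And>x. \<bar>x\<bar> > d \<Longrightarrow> b x = 0" using assms by (auto simp: bump_def)
  have "\<forall>x. \<bar>x\<bar> > max c d \<longrightarrow> r * a x + s * b x = 0" using c d by auto
  moreover have "max c d < 1" using c d by simp
  moreover have "cont_diff n (\<lambda>x. r * a x + s * b x)" for n
    using assms by (intro cont_diff_add cont_diff_mult cont_diff_const) (auto simp: bump_def)
  ultimately show ?thesis unfolding bump_def by blast
qed

lemma bump_zero: assumes "bump a" "\<bar>x\<bar> \<ge> 1" shows "a x = 0"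
  using assms unfolding bump_def by (smt (verit))

lemma bump_bounded: assumes "bump a" obtains B where "B > 0" "\<And>x. \<bar>a x\<bar> \<le> B"
proof -
  have "compact (a ` {-1..1})"
    using bump_continuous[OF assms] by (intro compact_continuous_image) (auto intro: continuous_on_subset)
  then obtain B where B: "\<And>x. x \<in> {-1..1} \<Longrightarrow> \<bar>a x\<bar> \<le> B"
    using compact_imp_bounded bounded_iff by (metis (no_types, lifting) imageI real_norm_def)
  have "\<bar>a x\<bar> \<le> max B 1" for x
    using B[of x] bump_zero[OF assms, of x] by (cases "x \<in> {-1..1}") auto
  then show ?thesis using that[of "max B 1"] by simp
qed

lemma bump_borel: "bump a \<Longrightarrow> a \<in> borel_measurable borel"
  using bump_continuous borel_measurable_continuous_onI by blast

text \<open>For t > 0 the factor \<open>flat 1 (real n * t)\<close> tends to 1 as n grows, and for t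
  \<le> 0 it is 0. So these bumps approximate the indicator of the open interval (p, q) from
  below.\<close>

definition plateau :: "real \<Rightarrow> real \<Rightarrow> nat \<Rightarrow> real \<Rightarrow> real" where
  "plateau p q n x = flat 1 (real n * (x - p)) * flat 1 (real n * (q - x))"

lemma flat_one_bounds: "0 \<le> flat 1 x" "flat 1 x \<le> 1"
  by (auto simp: flat_def)

lemma bump_plateau:
  assumes "-1 < p" "q < 1" shows "bump (plateau p q n)"
proof -
  have "cont_diff k (\<lambda>x. flat 1 (real n * x + - real n * p) * flat 1 (- real n * x + real n * q))" for k
    by (intro cont_diff_mult cont_diff_affine cont_diff_flat)
  then have "cont_diff k (plateau p q n)" for k
    by (simp add: plateau_def[abs_def] algebra_simps)
  moreover have "plateau p q n x = 0" if "\<bar>x\<bar> > max (-p) q" for x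
  proof -
    have "x - p \<le> 0 \<or> q - x \<le> 0" using that by linarith
    then have "real n * (x - p) \<le> 0 \<or> real n * (q - x) \<le> 0" by (auto simp: mult_le_0_iff)
    then show ?thesis by (auto simp: plateau_def flat_def)
  qed
  moreover have "max (-p) q < 1" using assms by simp
  ultimately show ?thesis unfolding bump_def by blast
qed

lemma plateau_bounds: "0 \<le> plateau p q n x" "plateau p q n x \<le> 1"
  by (auto simp: plateau_def intro!: mult_nonneg_nonneg mult_le_one flat_one_bounds)

lemma flat_one_tendsto: assumes "x > 0" shows "(\<lambda>n. flat 1 (real n * x)) \<longlonglongrightarrow> 1"
proof -
  have "(\<lambda>n. exp (- ((1 / x) * (1 / real n)))) \<longlonglongrightarrow> exp (- ((1 / x) * 0))"
    by (intro tendsto_intros lim_1_over_n)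
  then have "(\<lambda>n. exp (- (1 / (real n * x)))) \<longlonglongrightarrow> 1" by (simp add: mult.commute)
  then show ?thesis
    by (rule Lim_transform_eventually) (use assms in \<open>auto simp: flat_def eventually_sequentially intro!: exI[of _ 1]\<close>)
qed

lemma plateau_tendsto: "(\<lambda>n. plateau p q n x) \<longlonglongrightarrow> indicator {p<..<q} x"
proof (cases "p < x \<and> x < q")
  case True
  then have "(\<lambda>n. plateau p q n x) \<longlonglongrightarrow> 1 * 1"
    unfolding plateau_def by (intro tendsto_mult flat_one_tendsto) auto
  then show ?thesis using True by simp
next
  case False
  then have "x - p \<le> 0 \<or> q - x \<le> 0" by linarith
  then have "plateau p q n x = 0" for n
    by (auto simp: plateau_def flat_def zero_less_mult_iff)
  then show ?thesis using False by (auto simp: indicator_def)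
qed

section \<open>The fundamental lemma on the square\<close>

text \<open>Integrals over \<open>Lam\<close> are moved to \<open>SM\<close>, a product measure to which Fubini applies directly;
  \<open>lebesgue_on Lam\<close> is its completion.\<close>

definition IM :: "real measure" where "IM = restrict_space lborel {-1..1}"

abbreviation SM :: "(real \<times> real) measure" where "SM \<equiv> IM \<Otimes>\<^sub>M IM"

lemma space_IM [simp]: "space IM = {-1..1}"
  by (simp add: IM_def space_restrict_space)

lemma space_SM: "space SM = Lam"
  by (simp add: space_pair_measure Lam_def)

lemma emeasure_IM: "emeasure IM {-1..1} = 2"
  by (simp add: IM_def emeasure_restrict_space)

interpretation IM: finite_measure IM
  by (rule finite_measureI) (simp add: emeasure_IM)

interpretation SM: pair_sigma_finite IM IM ..

interpretation SMf: finite_measure SM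
  by (rule finite_measure_pair_measure) unfold_locales

lemma measure_IM: "measure IM (space IM) = 2"
  by (simp add: measure_def emeasure_IM)

lemma measure_SM: "measure SM (space SM) = 4"
  using sets.top[of IM]
  by (simp add: measure_def space_pair_measure IM.emeasure_pair_measure_Times emeasure_IM enn2real_mult)

lemma borel_IM: "f \<in> borel_measurable borel \<Longrightarrow> f \<in> borel_measurable IM"
  unfolding IM_def by (intro measurable_restrict_space1) simp

lemma id_IM [measurable]: "(\<lambda>x. x) \<in> borel_measurable IM"
  by (rule borel_IM) simp

lemma fst_snd_SM [measurable]: "fst \<in> borel_measurable SM" "snd \<in> borel_measurable SM"
  using measurable_compose[OF measurable_fst id_IM] measurable_compose[OF measurable_snd id_IM]
  by auto

text \<open>Product measures are determined by rectangles. The sigma-algebras coincide because the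
  identity map is measurable in both directions, and on a rectangle both measures are the product of
  the two lengths.\<close>

lemma SM_eq: "SM = restrict_space lborel Lam"
proof (rule pair_measure_eqI)
  show "sigma_finite_measure IM" by unfold_locales
  show "sigma_finite_measure IM" by unfold_locales
  have LL: "Lam \<in> sets borel" unfolding Lam_def by (intro borel_closed closed_Times) auto
  have 1: "(\<lambda>x. x) \<in> restrict_space lborel Lam \<rightarrow>\<^sub>M SM"
  proof -
    have "(\<lambda>x. (fst x, snd x)) \<in> restrict_space lborel Lam \<rightarrow>\<^sub>M SM"
    proof (intro measurable_Pair)
      show "fst \<in> restrict_space lborel Lam \<rightarrow>\<^sub>M IM" unfolding IM_def
        by (intro measurable_restrict_space3) (auto simp: Lam_def borel_prod[symmetric])
      show "snd \<in> restrict_space lborel Lam \<rightarrow>\<^sub>M IM" unfolding IM_def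
        by (intro measurable_restrict_space3) (auto simp: Lam_def borel_prod[symmetric])
    qed
    then show ?thesis by simp
  qed
  have 2: "(\<lambda>x. x) \<in> SM \<rightarrow>\<^sub>M restrict_space lborel Lam"
  proof (rule measurable_restrict_space2)
    show "(\<lambda>x. x) \<in> space SM \<rightarrow> Lam" by (simp add: space_SM)
    have "(\<lambda>x. (fst x, snd x)) \<in> SM \<rightarrow>\<^sub>M borel \<Otimes>\<^sub>M borel" by (intro measurable_Pair) simp_all
    then show "(\<lambda>x. x) \<in> SM \<rightarrow>\<^sub>M lborel" by (simp add: borel_prod)
  qed
  show eq: "sets SM = sets (restrict_space lborel Lam)"
  proof (intro equalityI subsetI)
    fix A assume A: "A \<in> sets SM"
    then have "A \<subseteq> Lam" using sets.sets_into_space[OF A] by (simp add: space_SM)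
    then show "A \<in> sets (restrict_space lborel Lam)"
      using measurable_sets[OF 1 A] by (simp add: space_restrict_space Int_absorb2)
  next
    fix A assume A: "A \<in> sets (restrict_space lborel Lam)"
    then have "A \<subseteq> Lam" using sets.sets_into_space[OF A] by (simp add: space_restrict_space)
    then show "A \<in> sets SM"
      using measurable_sets[OF 2 A] by (simp add: space_SM Int_absorb2)
  qed
  fix A B assume AB: "A \<in> sets IM" "B \<in> sets IM"
  then have sub: "A \<subseteq> {-1..1}" "B \<subseteq> {-1..1}" and bor: "A \<in> sets borel" "B \<in> sets borel"
    using sets.sets_into_space unfolding IM_def
    by (auto simp: sets_restrict_space_iff space_restrict_space)
  have "emeasure (restrict_space lborel Lam) (A \<times> B) = emeasure lborel (A \<times> B)"
    using sub LL by (intro emeasure_restrict_space) (auto simp: Lam_def)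
  also have "\<dots> = emeasure lborel A * emeasure lborel B"
    using bor by (simp add: lborel_prod[symmetric] lborel.emeasure_pair_measure_Times)
  finally show "emeasure IM A * emeasure IM B = emeasure (restrict_space lborel Lam) (A \<times> B)"
    using sub by (simp add: IM_def emeasure_restrict_space)
qed

section \<open>Transfer between \<open>lebesgue_on Lam\<close> and the product measure\<close>

lemma Lam_sets: "Lam \<in> sets borel" "Lam \<in> sets lborel" "Lam \<in> sets lebesgue"
proof -
  show "Lam \<in> sets borel" unfolding Lam_def by (intro borel_closed closed_Times) auto
  then show "Lam \<in> sets lborel" "Lam \<in> sets lebesgue" by auto
qed

lemma AE_lebesgue_on_Lam: "(AE z in lebesgue_on Lam. P z) \<longleftrightarrow> (AE z in SM. P z)"
  unfolding SM_eq using Lam_sets by (simp add: AE_restrict_space_iff AE_completion_iff)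

lemma SM_measurable_lebesgue:
  fixes f :: "real \<times> real \<Rightarrow> real"
  assumes "f \<in> borel_measurable SM" shows "f \<in> borel_measurable (lebesgue_on Lam)"
proof -
  have "(\<lambda>x. indicator Lam x *\<^sub>R f x) \<in> borel_measurable lborel"
    using assms Lam_sets unfolding SM_eq by (simp add: borel_measurable_restrict_space_iff)
  from measurable_completion[OF this] show ?thesis
    using Lam_sets by (simp add: borel_measurable_restrict_space_iff)
qed

lemma integral_lebesgue_SM:
  fixes f :: "real \<times> real \<Rightarrow> real"
  assumes "f \<in> borel_measurable SM"
  shows "integral\<^sup>L (lebesgue_on Lam) f = integral\<^sup>L SM f"
    and "integrable (lebesgue_on Lam) f \<longleftrightarrow> integrable SM f"
proof -
  have *: "(\<lambda>x. indicator Lam x *\<^sub>R f x) \<in> borel_measurable lborel"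
    using assms Lam_sets unfolding SM_eq by (simp add: borel_measurable_restrict_space_iff)
  show "integral\<^sup>L (lebesgue_on Lam) f = integral\<^sup>L SM f"
    using Lam_sets integral_completion[OF *] by (simp add: SM_eq integral_restrict_space)
  show "integrable (lebesgue_on Lam) f \<longleftrightarrow> integrable SM f"
    using Lam_sets integrable_completion[OF *] by (simp add: SM_eq integrable_restrict_space)
qed

text \<open>Elements of \<open>H_Lam\<close> are only Lebesgue measurable, which does not pass to
  sections. A Borel version, equal almost everywhere, makes Fubini available.\<close>

lemma ex_SM_measurable:
  fixes f :: "real \<times> real \<Rightarrow> real"
  assumes "f \<in> borel_measurable (lebesgue_on Lam)"
  obtains g where "g \<in> borel_measurable SM" "AE z in SM. f z = g z"
proof -
  have "(\<lambda>x. indicator Lam x *\<^sub>R f x) \<in> borel_measurable lebesgue"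
    using assms Lam_sets by (simp add: borel_measurable_restrict_space_iff)
  then obtain g where g: "g \<in> borel_measurable lborel" "AE x in lborel. indicator Lam x *\<^sub>R f x = g x"
    using completion_ex_borel_measurable_real by blast
  from g(2) have "AE z in SM. f z = g z"
    unfolding SM_eq using Lam_sets by (subst AE_restrict_space_iff) auto
  moreover have "g \<in> borel_measurable SM" unfolding SM_eq using g(1) by (rule measurable_restrict_space1)
  ultimately show ?thesis using that by blast
qed

lemma integral_lebesgue_SM_AE:
  fixes f g :: "real \<times> real \<Rightarrow> real"
  assumes "f \<in> borel_measurable (lebesgue_on Lam)" "g \<in> borel_measurable SM" "AE z in SM. f z = g z"
  shows "integral\<^sup>L (lebesgue_on Lam) f = integral\<^sup>L SM g"
    and "integrable (lebesgue_on Lam) f \<longleftrightarrow> integrable SM g"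
proof -
  have ae: "AE z in lebesgue_on Lam. f z = g z" using assms(3) by (simp add: AE_lebesgue_on_Lam)
  note g = SM_measurable_lebesgue[OF assms(2)]
  show "integral\<^sup>L (lebesgue_on Lam) f = integral\<^sup>L SM g"
    using integral_cong_AE[OF assms(1) g ae] integral_lebesgue_SM[OF assms(2)] by simp
  show "integrable (lebesgue_on Lam) f \<longleftrightarrow> integrable SM g"
    using integrable_cong_AE[OF assms(1) g ae] integral_lebesgue_SM[OF assms(2)] by simp
qed

lemma AE_IM_neq: "AE x in IM. x \<noteq> c"
  unfolding IM_def by (subst AE_restrict_space_iff) (use AE_lborel_singleton[of c] in auto)

lemma AE_SM_neq: "AE z in SM. fst z \<noteq> c \<and> snd z \<noteq> d"
proof (rule SM.AE_pair_measure)
  show "{z \<in> space SM. fst z \<noteq> c \<and> snd z \<noteq> d} \<in> sets SM" by measurable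
  show "AE x in IM. AE y in IM. fst (x, y) \<noteq> c \<and> snd (x, y) \<noteq> d"
    using AE_IM_neq[of c]
  proof eventually_elim
    case (elim x) then show ?case using AE_IM_neq[of d] by auto
  qed
qed

lemma bounded_integrable_SM:
  fixes f :: "real \<times> real \<Rightarrow> real"
  assumes "f \<in> borel_measurable SM" "\<And>z. z \<in> Lam \<Longrightarrow> \<bar>f z\<bar> \<le> B"
  shows "integrable SM f"
  by (rule SMf.integrable_const_bound[of _ B]) (use assms in \<open>auto simp: space_SM\<close>)

lemma bounded_integrable_IM:
  fixes f :: "real \<Rightarrow> real"
  assumes "f \<in> borel_measurable IM" "\<And>z. z \<in> {-1..1} \<Longrightarrow> \<bar>f z\<bar> \<le> B"
  shows "integrable IM f"
  by (rule IM.integrable_const_bound[of _ B]) (use assms in auto)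

lemma integrable_bounded_mult:
  fixes f g :: "'a \<Rightarrow> real"
  assumes "integrable M f" "g \<in> borel_measurable M" "\<And>z. z \<in> space M \<Longrightarrow> \<bar>g z\<bar> \<le> B"
  shows "integrable M (\<lambda>z. f z * g z)"
proof (rule Bochner_Integration.integrable_bound)
  show "integrable M (\<lambda>z. \<bar>f z\<bar> * B)" using assms(1) by (intro integrable_mult_left) auto
  show "(\<lambda>z. f z * g z) \<in> borel_measurable M" using assms by measurable
  show "AE z in M. norm (f z * g z) \<le> norm (\<bar>f z\<bar> * B)"
    using assms(3) by (intro AE_I2) (force simp: abs_mult intro!: mult_mono)
qed

section \<open>Testing with products of functions of one variable\<close>

lemma bump_IM [measurable]: "bump a \<Longrightarrow> a \<in> borel_measurable IM"
  using bump_borel borel_IM by blast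

abbreviation tens :: "('a \<Rightarrow> 'c::times) \<Rightarrow> ('b \<Rightarrow> 'c) \<Rightarrow> 'a \<times> 'b \<Rightarrow> 'c" where
  "tens a b z \<equiv> a (fst z) * b (snd z)"

abbreviation tint :: "(real \<times> real \<Rightarrow> real) \<Rightarrow> (real \<Rightarrow> real) \<Rightarrow> (real \<Rightarrow> real) \<Rightarrow> real" where
  "tint f a b \<equiv> (LINT z|SM. f z * tens a b z)"

lemma tensor_measurable [measurable]:
  fixes a b :: "real \<Rightarrow> real"
  shows "a \<in> borel_measurable IM \<Longrightarrow> b \<in> borel_measurable IM \<Longrightarrow> tens a b \<in> borel_measurable SM"
  using measurable_compose[OF measurable_fst, of a IM borel IM] measurable_compose[OF measurable_snd, of b IM borel IM]
  by (intro borel_measurable_times) auto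

lemma integrable_tensor:
  fixes a b :: "real \<Rightarrow> real"
  assumes "integrable SM f" "a \<in> borel_measurable IM" "b \<in> borel_measurable IM"
    "\<And>x. x \<in> {-1..1} \<Longrightarrow> \<bar>a x\<bar> \<le> A" "\<And>x. x \<in> {-1..1} \<Longrightarrow> \<bar>b x\<bar> \<le> B"
  shows "integrable SM (\<lambda>z. f z * tens a b z)"
proof (rule integrable_bounded_mult[OF assms(1)])
  show "tens a b \<in> borel_measurable SM" using assms(2,3) by measurable
  fix z assume "z \<in> space SM"
  then have *: "fst z \<in> {-1..1}" "snd z \<in> {-1..1}" by (auto simp: space_SM Lam_def)
  then have "A \<ge> 0" using assms(4)[OF *(1)] by linarith
  then show "\<bar>a (fst z) * b (snd z)\<bar> \<le> A * B"
    unfolding abs_mult using assms(4)[OF *(1)] assms(5)[OF *(2)] by (intro mult_mono) auto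
qed

lemma integrable_bump_tensor:
  assumes "integrable SM f" "bump a" "bump b"
  shows "integrable SM (\<lambda>z. f z * tens a b z)"
proof -
  obtain A where "\<And>x. \<bar>a x\<bar> \<le> A" using bump_bounded[OF assms(2)] by blast
  moreover obtain B where "\<And>x. \<bar>b x\<bar> \<le> B" using bump_bounded[OF assms(3)] by blast
  ultimately show ?thesis using assms by (intro integrable_tensor[of f a b A B] bump_IM) auto
qed

text \<open>Pi-lambda argument: open boxes are closed under intersection and generate the Borel
  sets, and the sets over which F integrates to 0 are closed under complements and disjoint unions;
  the integral over the whole plane enters the complement step. A function with vanishing integral
  over every Borel set is 0 almost everywhere.\<close>

lemma AE_zero_of_boxes:
  fixes F :: "real \<times> real \<Rightarrow> real"
  assumes F: "integrable lborel F"
    and box: "\<And>a b. (LINT z:box a b|lborel. F z) = 0"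
    and all: "(LINT z|lborel. F z) = 0"
  shows "AE z in lborel. F z = 0"
proof (rule sigma_finite_measure.density_zero[OF lborel.sigma_finite_measure_axioms F])
  have si: "set_integrable lborel A F" if "A \<in> sets borel" for A
    using F that unfolding set_integrable_def by (intro integrable_mult_indicator) auto
  fix A :: "(real \<times> real) set" assume "A \<in> sets lborel"
  then have A: "A \<in> sigma_sets UNIV (range (\<lambda>(a, b). box a b))"
    unfolding sets_lborel by (subst (asm) borel_eq_box) simp
  have sub: "range (\<lambda>(a, b). box a b :: (real \<times> real) set) \<subseteq> Pow UNIV" by auto
  have "Int_stable (range (\<lambda>(a, b). box a b :: (real \<times> real) set))"
    unfolding Int_stable_def by (auto simp: box_Int_box)
  then show "(LINT z:A|lborel. F z) = 0" using sub A
  proof (induction rule: sigma_sets_induct_disjoint)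
    case (basic A) then show ?case using box by auto
  next
    case empty show ?case by (simp add: set_lebesgue_integral_def)
  next
    case (compl A)
    then have A: "A \<in> sets borel" by (subst borel_eq_box) simp
    have "(LINT z:UNIV|lborel. F z) = (LINT z:A \<union> (UNIV - A)|lborel. F z)" by simp
    also have "\<dots> = (LINT z:A|lborel. F z) + (LINT z:UNIV - A|lborel. F z)"
      using A by (intro set_integral_Un si) auto
    finally show ?case using compl all by (simp add: set_lebesgue_integral_def)
  next
    case (union A)
    then have A: "A i \<in> sets borel" for i by (subst borel_eq_box) auto
    have "(LINT z:\<Union>(range A)|lborel. F z) = (\<Sum>i. LINT z:A i|lborel. F z)"
      using union(1) A by (intro lebesgue_integral_countable_add si) (auto simp: disjoint_family_on_def)
    then show ?case using union by simp
  qed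
qed

text \<open>Carries the vanishing of all tests from a family of factors to its pointwise limit; the
  bound 1 makes |f| an integrable majorant. It is applied twice below, to plateaus and then to
  indicators.\<close>

lemma tensor_dominated:
  fixes f :: "real \<times> real \<Rightarrow> real" and a b :: "nat \<Rightarrow> real \<Rightarrow> real"
  assumes f: "integrable SM f"
    and m: "\<And>n. a n \<in> borel_measurable IM" "\<And>n. b n \<in> borel_measurable IM"
      "a' \<in> borel_measurable IM" "b' \<in> borel_measurable IM"
    and bd: "\<And>n x. \<bar>a n x\<bar> \<le> 1" "\<And>n x. \<bar>b n x\<bar> \<le> 1"
    and lim: "\<And>x. (\<lambda>n. a n x) \<longlonglongrightarrow> a' x" "\<And>x. (\<lambda>n. b n x) \<longlonglongrightarrow> b' x"
    and zero: "\<And>n. tint f (a n) (b n) = 0"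
  shows "tint f a' b' = 0"
proof -
  have "(\<lambda>n. LINT z|SM. f z * tens (a n) (b n) z) \<longlonglongrightarrow> tint f a' b'"
  proof (rule integral_dominated_convergence[where w = "\<lambda>z. \<bar>f z\<bar>"])
    show "integrable SM (\<lambda>z. \<bar>f z\<bar>)" using f by auto
    show "(\<lambda>z. f z * tens a' b' z) \<in> borel_measurable SM"
      "(\<lambda>z. f z * tens (a n) (b n) z) \<in> borel_measurable SM" for n
      by (intro borel_measurable_times borel_measurable_integrable[OF f] tensor_measurable m)+
    show "AE z in SM. (\<lambda>n. f z * tens (a n) (b n) z) \<longlonglongrightarrow> f z * tens a' b' z"
      by (intro AE_I2 tendsto_mult tendsto_const lim)
    show "AE z in SM. norm (f z * tens (a n) (b n) z) \<le> \<bar>f z\<bar>" for n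
    proof (rule AE_I2)
      fix z
      have "\<bar>a n (fst z) * b n (snd z)\<bar> \<le> 1" using bd by (simp add: abs_mult mult_le_one)
      then show "norm (f z * tens (a n) (b n) z) \<le> \<bar>f z\<bar>"
        using mult_left_mono[of _ 1 "\<bar>f z\<bar>"] by (simp add: abs_mult)
    qed
  qed
  then show ?thesis by (simp add: zero LIMSEQ_const_iff)
qed

text \<open>Plateaus first reach indicators of rectangles whose closure lies in the open square. A
  shrinking margin then gives all open rectangles cut with the open square, and the extension of f
  by zero to the plane satisfies the hypotheses of the box argument.\<close>

lemma fundamental_lemma:
  fixes f :: "real \<times> real \<Rightarrow> real"
  assumes f: "integrable SM f"
    and z: "\<And>a b. bump a \<Longrightarrow> bump b \<Longrightarrow> tint f a b = 0"
  shows "AE z in SM. f z = 0"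
proof -
  have im: "indicator A \<in> borel_measurable IM" if "A \<in> sets borel" for A :: "real set"
    using that by (auto intro: borel_IM)
  have 1: "tint f (indicator {p<..<q}) (indicator {r<..<s}) = 0"
    if "-1 < p" "q < 1" "-1 < r" "s < 1" for p q r s
    by (rule tensor_dominated[OF f, where a = "plateau p q" and b = "plateau r s"])
       (use that plateau_bounds in \<open>auto intro!: bump_IM bump_plateau plateau_tendsto im z simp: abs_le_iff\<close>)
  define U where "U = {-1<..<1::real}"
  define e where "e n = 1 / real (Suc (Suc n))" for n
  have e: "e n > 0" for n by (simp add: e_def)
  have elim: "e \<longlonglongrightarrow> 0" unfolding e_def using LIMSEQ_Suc[OF LIMSEQ_Suc[OF lim_1_over_n]] by simp
  have ind: "(\<lambda>n. indicator {max p (-1 + e n)<..<min q (1 - e n)} x) \<longlonglongrightarrow> (indicator ({p<..<q} \<inter> U) x :: real)" for p q x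
  proof (cases "x \<in> {p<..<q} \<inter> U")
    case True
    then have "0 < min (x + 1) (1 - x)" by (auto simp: U_def)
    then have "\<forall>\<^sub>F n in sequentially. e n < min (x + 1) (1 - x)"
      using elim order_tendstoD(2) by blast
    then have "\<forall>\<^sub>F n in sequentially. indicator {max p (-1 + e n)<..<min q (1 - e n)} x = (1::real)"
      by eventually_elim (use True in \<open>auto simp: indicator_def\<close>)
    then show ?thesis using True by (simp add: tendsto_eventually)
  next
    case False
    then have "indicator {max p (-1 + e n)<..<min q (1 - e n)} x = (0::real)" for n
      using e[of n] by (auto simp: indicator_def U_def)
    then show ?thesis using False by simp
  qed
  have 2: "(LINT z|SM. f z * tens (indicator ({p<..<q} \<inter> U)) (indicator ({r<..<s} \<inter> U)) z) = 0" for p q r s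
  proof (rule tensor_dominated[OF f, where a = "\<lambda>n. indicator {max p (-1 + e n)<..<min q (1 - e n)}"
        and b = "\<lambda>n. indicator {max r (-1 + e n)<..<min s (1 - e n)}"])
    show "(LINT z|SM. f z * (indicator {max p (-1 + e n)<..<min q (1 - e n)} (fst z)
        * indicator {max r (-1 + e n)<..<min s (1 - e n)} (snd z))) = 0" for n
      by (rule 1) (use e[of n] in auto)
    show "(\<lambda>n. indicator {max p (-1 + e n)<..<min q (1 - e n)} x) \<longlonglongrightarrow> (indicator ({p<..<q} \<inter> U) x :: real)"
      "(\<lambda>n. indicator {max r (-1 + e n)<..<min s (1 - e n)} x) \<longlonglongrightarrow> (indicator ({r<..<s} \<inter> U) x :: real)" for x
      by (rule ind)+
  qed (auto simp: U_def indicator_def intro!: im)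
  define F where "F = (\<lambda>z. indicator (U \<times> U) z * f z)"
  have UL: "U \<times> U \<subseteq> Lam" by (auto simp: U_def Lam_def)
  have Um: "U \<times> U \<in> sets borel" unfolding U_def by (intro borel_open open_Times) auto
  have fL: "integrable lborel (\<lambda>z. indicator Lam z *\<^sub>R f z)"
    using f Lam_sets by (simp add: SM_eq integrable_restrict_space)
  have "integrable lborel (\<lambda>z. indicator (U \<times> U) z *\<^sub>R (indicator Lam z *\<^sub>R f z))"
    using Um by (intro integrable_mult_indicator fL) auto
  moreover have "indicator (U \<times> U) z *\<^sub>R (indicator Lam z *\<^sub>R f z) = F z" for z
    using UL by (auto simp: F_def indicator_def)
  ultimately have Fi: "integrable lborel F" by simp
  have key: "(LINT z:{p<..<q} \<times> {r<..<s}|lborel. F z) = 0" for p q r s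
  proof -
    have "(LINT z:{p<..<q} \<times> {r<..<s}|lborel. F z) = (LINT z|lborel. indicator Lam z *\<^sub>R
        (f z * tens (indicator ({p<..<q} \<inter> U)) (indicator ({r<..<s} \<inter> U)) z))"
      unfolding set_lebesgue_integral_def F_def using UL
      by (intro Bochner_Integration.integral_cong) (auto simp: indicator_def)
    also have "\<dots> = 0" using 2[of p q r s] Lam_sets by (simp add: SM_eq integral_restrict_space)
    finally show ?thesis .
  qed
  have "AE z in lborel. F z = 0"
  proof (rule AE_zero_of_boxes[OF Fi])
    fix a b :: "real \<times> real"
    have "box a b = {fst a<..<fst b} \<times> {snd a<..<snd b}"
      by (cases a; cases b) (simp add: box_prod box_real)
    then show "(LINT z:box a b|lborel. F z) = 0" using key by simp
  next
    have "(LINT z|lborel. F z) = (LINT z:{-1<..<1}\<times>{-1<..<1}|lborel. F z)"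
      unfolding set_lebesgue_integral_def F_def U_def
      by (intro Bochner_Integration.integral_cong) (auto simp: indicator_def)
    then show "(LINT z|lborel. F z) = 0" using key by simp
  qed
  then have "AE z in SM. F z = 0"
    unfolding SM_eq using Lam_sets by (subst AE_restrict_space_iff) auto
  \<comment> \<open>On the square, \<open>F\<close> differs from \<open>f\<close> only where a
    coordinate is 1 or -1, which is a null set.\<close>
  with AE_SM_neq[of 1 1] AE_SM_neq[of "-1" "-1"] AE_space
  show ?thesis
    by eventually_elim (auto simp: F_def U_def space_SM Lam_def indicator_def)
qed

section \<open>Integral representations\<close>

lemma integral_IM_lborel:
  fixes f :: "real \<Rightarrow> real"
  assumes "\<And>x. \<bar>x\<bar> > 1 \<Longrightarrow> f x = 0"
  shows "(LINT x|IM. f x) = (LINT x|lborel. f x)"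
  unfolding IM_def using assms
  by (subst integral_restrict_space) (force intro!: Bochner_Integration.integral_cong simp: indicator_def)+

lemma integral_IM_HK:
  fixes f :: "real \<Rightarrow> real"
  assumes "integrable IM f"
  shows "(LINT x|IM. f x) = integral {-1..1} f" "f integrable_on {-1..1}"
proof -
  have "set_integrable lborel {-1..1} f"
    using assms unfolding IM_def set_integrable_def by (simp add: integrable_restrict_space)
  from set_borel_integral_eq_integral[OF this] show "(LINT x|IM. f x) = integral {-1..1} f" "f integrable_on {-1..1}"
    unfolding IM_def set_lebesgue_integral_def by (simp_all add: integral_restrict_space)
qed

section \<open>A normalized smooth weight, primitives and the averaging kernel\<close>

definition weight0 :: "real \<Rightarrow> real" where "weight0 = plateau (-1/2) (1/2) 1"

lemma bump_weight0: "bump weight0" unfolding weight0_def by (rule bump_plateau) auto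

lemma weight0_nonneg: "weight0 x \<ge> 0" by (simp add: weight0_def plateau_bounds)

lemma integrable_bump_IM: "bump a \<Longrightarrow> integrable IM a"
  by (metis bump_bounded bounded_integrable_IM bump_IM)

text \<open>A nonnegative function with integral 0 vanishes almost everywhere, but
  \<open>weight0\<close> is positive on (-1/2, 1/2).\<close>

lemma weight0_integral: "(LINT x|IM. weight0 x) > 0"
proof -
  have "(LINT x|IM. weight0 x) \<noteq> 0"
  proof
    assume "(LINT x|IM. weight0 x) = 0"
    then have "AE x in IM. weight0 x = 0"
      using integral_nonneg_eq_0_iff_AE[of IM weight0] integrable_bump_IM[OF bump_weight0] weight0_nonneg by auto
    then have "AE x in lborel. x \<in> {-1..1} \<longrightarrow> weight0 x = 0"
      unfolding IM_def by (subst (asm) AE_restrict_space_iff) auto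
    then have "AE x in lborel. x \<notin> {-1/2<..<1/2::real}"
      by eventually_elim (auto simp: weight0_def plateau_def flat_def)
    then have "{-1/2<..<1/2::real} \<in> null_sets lborel"
      by (subst (asm) AE_iff_null_sets[symmetric]) auto
    then show False by (simp add: null_sets_def)
  qed
  moreover have "(LINT x|IM. weight0 x) \<ge> 0" using weight0_nonneg by (intro integral_nonneg_AE) auto
  ultimately show ?thesis by linarith
qed

definition weight :: "real \<Rightarrow> real" where "weight x = weight0 x / (LINT x|IM. weight0 x)"

lemma bump_weight: "bump weight"
  using bump_lincomb[OF bump_weight0 bump_weight0, of "1 / (LINT x|IM. weight0 x)" 0]
  by (simp add: weight_def[abs_def])

lemma weight_nonneg: "weight x \<ge> 0"
  using weight0_nonneg weight0_integral by (simp add: weight_def)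

lemma weight_integral: "(LINT x|IM. weight x) = 1"
  using weight0_integral by (simp add: weight_def)

text \<open>The primitive that vanishes at -1, written with a cut-off factor over the fixed
  interval: this is the form in which it appears when \<open>avgk\<close> is integrated against
  a.\<close>

definition prim :: "(real \<Rightarrow> real) \<Rightarrow> real \<Rightarrow> real" where
  "prim a s = (LINT x|IM. a x * of_bool (x < s))"

lemma integrable_prim: "bump a \<Longrightarrow> integrable IM (\<lambda>x. a x * of_bool (x < s))"
  by (rule integrable_bounded_mult[OF integrable_bump_IM, of _ _ 1]) auto

lemma prim_DERIV: assumes "bump a" shows "(prim a has_real_derivative a s) (at s)"
proof -
  \<comment> \<open>The point s is any real number. The larger interval contains s in its interior
    and the whole support of a, so the fundamental theorem gives a two-sided derivative at
    s.\<close>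
  define N where "N = \<bar>s\<bar> + 2"
  have ac: "continuous_on S a" for S using bump_continuous[OF assms] continuous_on_subset by blast
  have eq: "prim a t = integral {-N..t} a" if "t \<in> {-N<..<N}" for t
  proof -
    have "prim a t = (LINT x|lborel. a x * of_bool (x < t))"
      unfolding prim_def by (rule integral_IM_lborel) (use bump_zero[OF assms] in auto)
    also have "\<dots> = (LINT x:{-N..t}|lborel. a x)"
      unfolding set_lebesgue_integral_def
    proof (rule integral_cong_AE)
      have am: "a \<in> borel_measurable lborel" using bump_borel[OF assms] by simp
      have "(\<lambda>x. indicator {..<t} x :: real) \<in> borel_measurable lborel" by simp
      moreover have "(\<lambda>x. of_bool (x < t) :: real) = indicator {..<t}" by (auto simp: indicator_def)
      ultimately show "(\<lambda>x. a x * of_bool (x < t)) \<in> borel_measurable lborel"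
        using am by (intro borel_measurable_times) auto
      show "(\<lambda>x. indicat_real {- N..t} x *\<^sub>R a x) \<in> borel_measurable lborel"
        using am by (intro borel_measurable_scaleR) auto
      show "AE x in lborel. a x * of_bool (x < t) = indicat_real {- N..t} x *\<^sub>R a x"
        using AE_lborel_singleton[of t]
      proof eventually_elim
        case (elim x)
        have "a x = 0" if "x < - N" by (rule bump_zero[OF assms]) (use that in \<open>auto simp: N_def\<close>)
        then show ?case using elim by (cases "x < - N") (auto simp: indicator_def)
      qed
    qed
    also have "\<dots> = integral {-N..t} a"
      by (intro set_borel_integral_eq_integral borel_integrable_atLeastAtMost' ac)
    finally show ?thesis .
  qed
  have "((\<lambda>t. integral {-N..t} a) has_real_derivative a s) (at s within {-N..N})"
    by (rule integral_has_real_derivative[OF ac]) (auto simp: N_def)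
  then have "((\<lambda>t. integral {-N..t} a) has_real_derivative a s) (at s)"
    by (subst (asm) at_within_interior) (auto simp: N_def interior_atLeastAtMost_real)
  then show ?thesis
    by (rule has_field_derivative_transform_within_open[where S = "{-N<..<N}"])
       (use eq in \<open>auto simp: N_def\<close>)
qed

definition weight_prim :: "real \<Rightarrow> real" where "weight_prim = prim weight"

text \<open>By the fundamental theorem f(x) - f(t) is the integral of ([t < s] - [x < s]) f'(s) over
  s. Averaging over t with density \<open>weight\<close> turns the first bracket into
  \<open>weight_prim s\<close>, so this is the kernel of T in f = A f + T f'.\<close>

definition avgk :: "real \<Rightarrow> real \<Rightarrow> real" where "avgk x s = weight_prim s - of_bool (x < s)"

lemma weight_prim_bounds: "0 \<le> weight_prim s" "weight_prim s \<le> 1"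
proof -
  show "0 \<le> weight_prim s" unfolding weight_prim_def prim_def using weight_nonneg by (intro integral_nonneg_AE) auto
  have "weight_prim s \<le> (LINT x|IM. weight x)" unfolding weight_prim_def prim_def using weight_nonneg
    by (intro integral_mono integrable_prim integrable_bump_IM bump_weight) auto
  then show "weight_prim s \<le> 1" by (simp add: weight_integral)
qed

lemma avgk_bound: "\<bar>avgk x s\<bar> \<le> 1"
  using weight_prim_bounds[of s] by (auto simp: avgk_def)

lemma weight_prim_continuous: "continuous_on UNIV weight_prim"
  unfolding weight_prim_def using prim_DERIV[OF bump_weight] by (auto intro: DERIV_isCont continuous_at_imp_continuous_on)

lemma weight_prim_IM [measurable]: "weight_prim \<in> borel_measurable IM"
  using weight_prim_continuous borel_IM borel_measurable_continuous_onI by blast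

lemma avgk_SM [measurable]: "(\<lambda>z. avgk (fst z) (snd z)) \<in> borel_measurable SM"
proof -
  have "(\<lambda>z. weight_prim (snd z)) \<in> borel_measurable SM" by (rule measurable_compose[OF measurable_snd weight_prim_IM])
  then show ?thesis unfolding avgk_def by measurable
qed

text \<open>For a bump \<open>a\<close> the function \<open>a - (\<integral>a) weight\<close> has integral zero, so it is the derivative of a bump,
  namely of \<open>- adjk a\<close>. Testing with it turns a weak derivative into an integral representation.\<close>

definition adjk :: "(real \<Rightarrow> real) \<Rightarrow> real \<Rightarrow> real" where
  "adjk a s = (LINT x|IM. avgk x s * a x)"

lemma adjk_eq: assumes "bump a" shows "adjk a s = (LINT x|IM. a x) * weight_prim s - prim a s"
proof -
  have "adjk a s = (LINT x|IM. weight_prim s * a x - a x * of_bool (x < s))"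
    unfolding adjk_def avgk_def by (simp add: algebra_simps)
  also have "\<dots> = (LINT x|IM. weight_prim s * a x) - prim a s" unfolding prim_def
    by (intro Bochner_Integration.integral_diff integrable_prim assms integrable_mult_right integrable_bump_IM)
  finally show ?thesis by simp
qed

lemma adjk_DERIV: assumes "bump a"
  shows "(adjk a has_real_derivative (LINT x|IM. a x) * weight s - a s) (at s)"
proof -
  have "adjk a = (\<lambda>s. (LINT x|IM. a x) * weight_prim s - prim a s)" using adjk_eq[OF assms] by auto
  then show ?thesis unfolding weight_prim_def
    using prim_DERIV[OF assms] prim_DERIV[OF bump_weight] by (auto intro!: derivative_eq_intros)
qed

lemma bump_adjk: assumes "bump a" shows "bump (adjk a)"
proof -
  let ?\<alpha> = "LINT x|IM. a x"
  have b: "bump (\<lambda>s. ?\<alpha> * weight s + (-1) * a s)" by (rule bump_lincomb[OF bump_weight assms])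
  have "cont_diff n (adjk a)" for n
  proof (cases n)
    case 0 then show ?thesis
      using adjk_DERIV[OF assms] by (auto intro!: continuous_at_imp_continuous_on intro: DERIV_isCont)
  next
    case (Suc m) then show ?thesis
      using adjk_DERIV[OF assms] bump_cont_diff[OF b, of m]
      by (auto intro!: exI[of _ "\<lambda>s. ?\<alpha> * weight s - a s"])
  qed
  moreover obtain c where c: "c < 1" "\<And>x. \<bar>x\<bar> > c \<Longrightarrow> a x = 0" using assms by (auto simp: bump_def)
  obtain d where d: "d < 1" "\<And>x. \<bar>x\<bar> > d \<Longrightarrow> weight x = 0" using bump_weight by (auto simp: bump_def)
  \<comment> \<open>Beyond e both supports are exhausted. On the left both primitives are 0; on the
    right they are the integral of a and 1, so the two terms of \<open>adjk_eq\<close>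
    cancel.\<close>
  define e where "e = max 0 (max c d)"
  have "adjk a s = 0" if "\<bar>s\<bar> > e" for s
  proof (cases "s < 0")
    case True
    have "prim b s = 0" if "\<And>x. \<bar>x\<bar> > e \<Longrightarrow> b x = 0" for b
    proof -
      have "(\<lambda>x. b x * of_bool (x < s)) = (\<lambda>x. 0)" using that \<open>\<bar>s\<bar> > e\<close> True by fastforce
      then show ?thesis by (simp add: prim_def)
    qed
    then have "prim a s = 0" "prim weight s = 0" using c d by (auto simp: e_def)
    then show ?thesis using adjk_eq[OF assms] by (simp add: weight_prim_def)
  next
    case False
    have "prim b s = (LINT x|IM. b x)" if "\<And>x. \<bar>x\<bar> > e \<Longrightarrow> b x = 0" for b
    proof -
      have "(\<lambda>x. b x * of_bool (x < s)) = b"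
      proof
        fix x show "b x * of_bool (x < s) = b x" using that[of x] \<open>\<bar>s\<bar> > e\<close> False by (cases "x < s") auto
      qed
      then show ?thesis by (simp add: prim_def)
    qed
    then have "prim a s = ?\<alpha>" "prim weight s = 1" using c d weight_integral by (auto simp: e_def)
    then show ?thesis using adjk_eq[OF assms] by (simp add: weight_prim_def)
  qed
  moreover have "e < 1" using c d by (simp add: e_def)
  ultimately show ?thesis unfolding bump_def by blast
qed

lemma deriv_adjk: "bump a \<Longrightarrow> deriv (adjk a) = (\<lambda>s. (LINT x|IM. a x) * weight s - a s)"
  using adjk_DERIV DERIV_imp_deriv by blast

definition xker :: "(real \<Rightarrow> real \<Rightarrow> real) \<Rightarrow> (real \<times> real \<Rightarrow> real) \<Rightarrow> real \<times> real \<Rightarrow> real" where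
  "xker k f z = (LINT s|IM. k (fst z) s * f (s, snd z))"

lemma xker_measurable:
  assumes k: "(\<lambda>z. k (fst z) (snd z)) \<in> borel_measurable SM" and f: "f \<in> borel_measurable SM"
  shows "xker k f \<in> borel_measurable SM"
    and "(\<lambda>w. k (fst (fst w)) (snd w) * f (snd w, snd (fst w))) \<in> borel_measurable (SM \<Otimes>\<^sub>M IM)"
proof -
  have 1: "(\<lambda>w. (fst (fst w), snd w)) \<in> SM \<Otimes>\<^sub>M IM \<rightarrow>\<^sub>M SM"
    by (intro measurable_Pair measurable_compose[OF measurable_fst measurable_fst] measurable_snd)
  have 2: "(\<lambda>w. (snd w, snd (fst w))) \<in> SM \<Otimes>\<^sub>M IM \<rightarrow>\<^sub>M SM"
    by (intro measurable_Pair measurable_compose[OF measurable_fst measurable_snd] measurable_snd)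
  show *: "(\<lambda>w. k (fst (fst w)) (snd w) * f (snd w, snd (fst w))) \<in> borel_measurable (SM \<Otimes>\<^sub>M IM)"
    using measurable_compose[OF 1 k] measurable_compose[OF 2 f] by (intro borel_measurable_times) auto
  show "xker k f \<in> borel_measurable SM"
    unfolding xker_def[abs_def]
    using IM.borel_measurable_lebesgue_integral[of "\<lambda>z s. k (fst z) s * f (s, snd z)" SM] *
    by (simp add: case_prod_beta')
qed

text \<open>Sections of f are integrable only for almost every y, so the estimate runs in
  nonnegative integrals; where the integrand is not integrable, the Bochner integral is 0 and the
  pointwise bound is trivial. That bound does not depend on x, and integrating it over x gives the
  factor 2.\<close>

lemma xker_bound:
  assumes k: "(\<lambda>z. k (fst z) (snd z)) \<in> borel_measurable SM"
    and B: "\<And>x s. x \<in> {-1..1} \<Longrightarrow> s \<in> {-1..1} \<Longrightarrow> \<bar>k x s\<bar> \<le> B"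
    and f: "integrable SM f"
  shows "integrable SM (xker k f)" "(LINT z|SM. \<bar>xker k f z\<bar>) \<le> 2 * B * (LINT z|SM. \<bar>f z\<bar>)"
proof -
  have fm: "f \<in> borel_measurable SM" using f by auto
  note Pm = xker_measurable(1)[OF k fm]
  have B0: "B \<ge> 0" using B[of 0 0] by auto
  have "f \<in> borel_measurable SM" using f by auto
  have sw: "(\<lambda>z. ennreal \<bar>f z\<bar>) \<in> borel_measurable SM" using fm by measurable
  have fs: "(\<lambda>s. \<bar>f (s, y)\<bar>) \<in> borel_measurable IM" if "y \<in> space IM" for y
    using measurable_compose[OF measurable_Pair2'[OF that] fm] by measurable
  have pt: "ennreal \<bar>xker k f (x, y)\<bar> \<le> ennreal B * (\<integral>\<^sup>+ s. ennreal \<bar>f (s, y)\<bar> \<partial>IM)"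
    if "x \<in> space IM" "y \<in> space IM" for x y
  proof -
    have "ennreal \<bar>xker k f (x, y)\<bar> \<le> (\<integral>\<^sup>+ s. ennreal \<bar>k x s * f (s, y)\<bar> \<partial>IM)"
      unfolding xker_def using integral_norm_bound_ennreal[of IM "\<lambda>s. k x s * f (s, y)"]
      by (cases "integrable IM (\<lambda>s. k x s * f (s, y))") (auto simp: not_integrable_integral_eq)
    also have "\<dots> \<le> (\<integral>\<^sup>+ s. ennreal B * ennreal \<bar>f (s, y)\<bar> \<partial>IM)"
      using B that B0
      by (intro nn_integral_mono) (auto simp: abs_mult ennreal_mult[symmetric] intro!: ennreal_leI mult_right_mono)
    also have "\<dots> = ennreal B * (\<integral>\<^sup>+ s. ennreal \<bar>f (s, y)\<bar> \<partial>IM)"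
      using fs[OF that(2)] by (intro nn_integral_cmult) auto
    finally show ?thesis .
  qed
  have mm: "(\<lambda>y. \<integral>\<^sup>+ s. ennreal \<bar>f (s, y)\<bar> \<partial>IM) \<in> borel_measurable IM"
    using IM.borel_measurable_nn_integral[of "\<lambda>y s. ennreal \<bar>f (s, y)\<bar>" IM]
      measurable_compose[OF measurable_pair_swap' sw] by (simp add: case_prod_beta')
  have "(\<integral>\<^sup>+ z. ennreal \<bar>xker k f z\<bar> \<partial>SM) = (\<integral>\<^sup>+ x. \<integral>\<^sup>+ y. ennreal \<bar>xker k f (x, y)\<bar> \<partial>IM \<partial>IM)"
    using Pm by (intro IM.nn_integral_fst[symmetric] measurable_compose[OF _ measurable_ennreal] borel_measurable_abs)
  also have "\<dots> \<le> (\<integral>\<^sup>+ x. \<integral>\<^sup>+ y. ennreal B * (\<integral>\<^sup>+ s. ennreal \<bar>f (s, y)\<bar> \<partial>IM) \<partial>IM \<partial>IM)"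
    using pt by (intro nn_integral_mono) auto
  also have "\<dots> = 2 * (ennreal B * (\<integral>\<^sup>+ y. \<integral>\<^sup>+ s. ennreal \<bar>f (s, y)\<bar> \<partial>IM \<partial>IM))"
    using mm by (simp add: nn_integral_cmult emeasure_IM mult.commute)
  also have "(\<integral>\<^sup>+ y. \<integral>\<^sup>+ s. ennreal \<bar>f (s, y)\<bar> \<partial>IM \<partial>IM) = (\<integral>\<^sup>+ z. ennreal \<bar>f z\<bar> \<partial>SM)"
    using sw SM.nn_integral_snd[of "\<lambda>z. ennreal \<bar>f z\<bar>"] by simp
  also have "\<dots> = ennreal (LINT z|SM. \<bar>f z\<bar>)"
    using f by (intro nn_integral_eq_integral) auto
  also have "2 * (ennreal B * \<dots>) = ennreal (2 * B * (LINT z|SM. \<bar>f z\<bar>))"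
    using B0 by (simp add: ennreal_mult' ennreal_mult'' mult.assoc flip: ennreal_numeral)
  finally have le: "(\<integral>\<^sup>+ z. ennreal \<bar>xker k f z\<bar> \<partial>SM) \<le> ennreal (2 * B * (LINT z|SM. \<bar>f z\<bar>))" .
  show int: "integrable SM (xker k f)"
    using le Pm by (intro integrableI_bounded) (auto simp: le_less_trans[OF le] )
  have "(\<integral>\<^sup>+ z. ennreal \<bar>xker k f z\<bar> \<partial>SM) = ennreal (LINT z|SM. \<bar>xker k f z\<bar>)"
    using int by (intro nn_integral_eq_integral) auto
  then show "(LINT z|SM. \<bar>xker k f z\<bar>) \<le> 2 * B * (LINT z|SM. \<bar>f z\<bar>)"
    using le B0 by (simp add: ennreal_le_iff)
qed

text \<open>Fubini in x and s, on almost every line of constant y, moves the kernel from f to the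
  test factor a. The factor b is constant on such a line.\<close>

lemma xker_adjoint:
  assumes k: "(\<lambda>z. k (fst z) (snd z)) \<in> borel_measurable SM"
    and B: "\<And>x s. x \<in> {-1..1} \<Longrightarrow> s \<in> {-1..1} \<Longrightarrow> \<bar>k x s\<bar> \<le> B"
    and f: "integrable SM f" and a: "bump a" and b: "bump b"
  shows "tint (xker k f) a b
    = (LINT z|SM. f z * ((LINT x|IM. k x (fst z) * a x) * b (snd z)))"
proof -
  have fm: "f \<in> borel_measurable SM" using f by auto
  have B0: "B \<ge> 0" using B[of 0 0] by auto
  obtain A where A: "A > 0" "\<And>x. \<bar>a x\<bar> \<le> A" using bump_bounded[OF a] by blast
  obtain C where C: "C > 0" "\<And>x. \<bar>b x\<bar> \<le> C" using bump_bounded[OF b] by blast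
  let ?k = "\<lambda>s. LINT x|IM. k x s * a x"
  have kx: "(\<lambda>x. k x s) \<in> borel_measurable IM" if "s \<in> {-1..1}" for s
    using measurable_compose[OF measurable_Pair2'[of s IM IM] k] that by simp
  have am: "a \<in> borel_measurable IM" "b \<in> borel_measurable IM" using a b by auto
  have kmeas: "?k \<in> borel_measurable IM"
  proof -
    have "(\<lambda>z. k (snd z) (fst z) * a (snd z)) \<in> borel_measurable SM"
      using measurable_compose[OF measurable_pair_swap' k] measurable_compose[OF measurable_snd am(1)]
      by (intro borel_measurable_times) (simp_all add: case_prod_beta')
    then show ?thesis
      using IM.borel_measurable_lebesgue_integral[of "\<lambda>s x. k x s * a x" IM] by (simp add: case_prod_beta')
  qed
  have kb: "\<bar>?k s\<bar> \<le> 2 * B * A" if "s \<in> {-1..1}" for s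
  proof -
    have "\<bar>?k s\<bar> \<le> (LINT x|IM. \<bar>k x s * a x\<bar>)" by (rule integral_abs_bound)
    also have "\<dots> \<le> (LINT x|IM. B * A)"
      using B that A B0 kx[OF that] am
      by (intro integral_mono bounded_integrable_IM[of _ "B * A"])
         (auto simp: abs_mult intro!: mult_mono)
    finally show ?thesis using measure_IM by simp
  qed
  have i1: "integrable SM (\<lambda>z. xker k f z * tens a b z)"
    by (rule integrable_bump_tensor[OF xker_bound(1)[OF k B f] a b])
  have i2: "integrable SM (\<lambda>z. f z * tens ?k b z)"
    by (rule integrable_tensor[OF f kmeas am(2) kb C(2)])
  have "tint (xker k f) a b
     = (LINT y|IM. LINT x|IM. xker k f (x, y) * (a x * b y))"
    using SM.integral_snd[of "\<lambda>x y. xker k f (x, y) * (a x * b y)"] i1 by (simp add: case_prod_beta')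
  also have "\<dots> = (LINT y|IM. LINT s|IM. f (s, y) * (?k s * b y))"
  proof (rule integral_cong_AE)
    show "(\<lambda>y. LINT x|IM. xker k f (x, y) * (a x * b y)) \<in> borel_measurable IM"
      using SM.integrable_snd[of "\<lambda>x y. xker k f (x, y) * (a x * b y)"] i1 by (simp add: case_prod_beta')
    show "(\<lambda>y. LINT s|IM. f (s, y) * (?k s * b y)) \<in> borel_measurable IM"
      using SM.integrable_snd[of "\<lambda>x y. f (x, y) * (?k x * b y)"] i2 by (simp add: case_prod_beta')
    have "AE y in IM. integrable IM (\<lambda>s. f (s, y))"
      using SM.AE_integrable_snd[of "\<lambda>x y. f (x, y)"] f by simp
    then show "AE y in IM. (LINT x|IM. xker k f (x, y) * (a x * b y)) = (LINT s|IM. f (s, y) * (?k s * b y))"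
    proof eventually_elim
      case (elim y)
      have fsy: "(\<lambda>s. f (s, y)) \<in> borel_measurable IM" using elim by auto
      have F2: "integrable SM (\<lambda>z. f (snd z, y))"
      proof -
        show ?thesis
          by (rule SM.Fubini_integrable) (use elim measurable_compose[OF measurable_snd fsy] in auto)
      qed
      have g: "integrable SM (\<lambda>z. f (snd z, y) * (k (fst z) (snd z) * a (fst z)))"
      proof (rule integrable_bounded_mult[OF F2])
        show "(\<lambda>z. k (fst z) (snd z) * a (fst z)) \<in> borel_measurable SM"
          using k measurable_compose[OF measurable_fst am(1)] by (intro borel_measurable_times) auto
        show "\<bar>k (fst z) (snd z) * a (fst z)\<bar> \<le> B * A" if "z \<in> space SM" for z
          using that B[of "fst z" "snd z"] A(2)[of "fst z"] B0 unfolding abs_mult space_SM Lam_def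
          by (intro mult_mono) auto
      qed
      have "(LINT x|IM. xker k f (x, y) * (a x * b y))
         = (LINT x|IM. b y * (LINT s|IM. f (s, y) * (k x s * a x)))"
        by (simp add: xker_def mult_ac flip: integral_mult_right_zero integral_mult_left_zero)
      also have "\<dots> = b y * (LINT x|IM. LINT s|IM. f (s, y) * (k x s * a x))" by simp
      also have "(LINT x|IM. LINT s|IM. f (s, y) * (k x s * a x)) = (LINT s|IM. LINT x|IM. f (s, y) * (k x s * a x))"
        using SM.Fubini_integral[of "\<lambda>x s. f (s, y) * (k x s * a x)"] g by (simp add: case_prod_beta')
      also have "b y * \<dots> = (LINT s|IM. f (s, y) * (?k s * b y))"
        by (simp add: mult_ac flip: integral_mult_right_zero integral_mult_left_zero)
      finally show ?case .
    qed
  qed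
  also have "\<dots> = tint f ?k b"
    using SM.integral_snd[of "\<lambda>x y. f (x, y) * (?k x * b y)"] i2 by (simp add: case_prod_beta')
  finally show ?thesis .
qed

text \<open>Weak first derivatives, tested with products \<open>a(x) b(y)\<close> only; these suffice by the
  fundamental lemma above.\<close>

definition wdx :: "(real \<times> real \<Rightarrow> real) \<Rightarrow> (real \<times> real \<Rightarrow> real) \<Rightarrow> bool" where
  "wdx f h \<longleftrightarrow> (\<forall>a b. bump a \<longrightarrow> bump b \<longrightarrow>
     tint f (deriv a) b = - tint h a b)"

definition wdy :: "(real \<times> real \<Rightarrow> real) \<Rightarrow> (real \<times> real \<Rightarrow> real) \<Rightarrow> bool" where
  "wdy f h \<longleftrightarrow> (\<forall>a b. bump a \<longrightarrow> bump b \<longrightarrow>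
     tint f a (deriv b) = - tint h a b)"

lemma weight_kernel_SM: "(\<lambda>z. weight (snd z)) \<in> borel_measurable SM"
  by (rule measurable_compose[OF measurable_snd bump_IM[OF bump_weight]])

text \<open>It suffices to test the difference of both sides. By adjointness the \<open>avgk\<close>
  term becomes h tested with \<open>adjk a\<close>, hence minus f tested with the derivative of
  \<open>adjk a\<close>. That derivative is \<open>weight\<close> times the integral of a, minus a,
  so the result is f tested with a, short of exactly the \<open>weight\<close> term.\<close>

lemma wdx_representation:
  assumes f: "integrable SM f" and h: "integrable SM h" and w: "wdx f h"
  shows "AE z in SM. f z = xker (\<lambda>x. weight) f z + xker avgk h z"
proof -
  obtain A where A: "\<And>x. \<bar>weight x\<bar> \<le> A" using bump_bounded[OF bump_weight] by blast
  have p1: "integrable SM (xker (\<lambda>x. weight) f)"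
    by (rule xker_bound(1)[where B = A]) (use f A weight_kernel_SM in auto)
  have p2: "integrable SM (xker avgk h)"
    by (rule xker_bound(1)[where B = 1]) (use h avgk_bound avgk_SM in auto)
  have "AE z in SM. f z - xker (\<lambda>x. weight) f z - xker avgk h z = 0"
  proof (rule fundamental_lemma)
    show "integrable SM (\<lambda>z. f z - xker (\<lambda>x. weight) f z - xker avgk h z)"
      using f p1 p2 by auto
    fix a b assume a: "bump a" and b: "bump b"
    let ?\<alpha> = "LINT x|IM. a x"
    have 1: "tint (xker (\<lambda>x. weight) f) a b = (LINT z|SM. ?\<alpha> * (f z * tens weight b z))"
      using xker_adjoint[OF weight_kernel_SM A f a b] by (simp add: mult_ac)
    have "tint (xker avgk h) a b = tint h (adjk a) b"
      using xker_adjoint[OF avgk_SM avgk_bound h a b] by (simp add: adjk_def)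
    also have "\<dots> = - (LINT z|SM. f z * tens (deriv (adjk a)) b z)"
      using w bump_adjk[OF a] b by (simp add: wdx_def)
    also have "(LINT z|SM. f z * tens (deriv (adjk a)) b z)
      = (LINT z|SM. ?\<alpha> * (f z * tens weight b z) - f z * tens a b z)"
      by (simp add: deriv_adjk[OF a] algebra_simps)
    also have "\<dots> = (LINT z|SM. ?\<alpha> * (f z * tens weight b z)) - tint f a b"
      by (intro Bochner_Integration.integral_diff integrable_mult_right integrable_bump_tensor f a b bump_weight)
    finally have 2: "tint (xker avgk h) a b
      = tint f a b - (LINT z|SM. ?\<alpha> * (f z * tens weight b z))" by simp
    have "(LINT z|SM. (f z - xker (\<lambda>x. weight) f z - xker avgk h z) * tens a b z)
       = tint f a b - tint (xker (\<lambda>x. weight) f) a b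
         - tint (xker avgk h) a b"
      using integrable_bump_tensor[OF f a b] integrable_bump_tensor[OF p1 a b] integrable_bump_tensor[OF p2 a b]
      by (simp add: left_diff_distrib Bochner_Integration.integral_diff)
    then show "(LINT z|SM. (f z - xker (\<lambda>x. weight) f z - xker avgk h z) * tens a b z) = 0"
      using 1 2 by simp
  qed
  then show ?thesis by eventually_elim simp
qed

section \<open>Reflection in the diagonal, which carries results in x over to y\<close>

lemma swap_SM: "prod.swap \<in> SM \<rightarrow>\<^sub>M SM"
  using measurable_pair_swap'[of IM IM] by (simp add: prod.swap_def[abs_def] case_prod_beta')

lemma distr_swap: "distr SM SM prod.swap = SM"
  using SM.distr_pair_swap by (simp add: prod.swap_def[abs_def] case_prod_beta')

lemma AE_swap: "AE z in SM. P z \<Longrightarrow> AE z in SM. P (prod.swap z)"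
  by (rule AE_distrD[OF swap_SM, of P, unfolded distr_swap])

lemma integral_swap:
  fixes f :: "real \<times> real \<Rightarrow> real"
  assumes "f \<in> borel_measurable SM"
  shows "(LINT z|SM. f (prod.swap z)) = (LINT z|SM. f z)"
  using integral_distr[OF swap_SM assms] by (simp add: distr_swap)

lemma integrable_swap:
  fixes f :: "real \<times> real \<Rightarrow> real"
  assumes "integrable SM f"
  shows "integrable SM (\<lambda>z. f (prod.swap z))"
  using integrable_distr[OF swap_SM, of f] assms by (simp add: distr_swap)

lemma wdx_swap:
  assumes "f \<in> borel_measurable SM" "h \<in> borel_measurable SM" "wdy f h"
  shows "wdx (\<lambda>z. f (prod.swap z)) (\<lambda>z. h (prod.swap z))"
  unfolding wdx_def
proof (intro allI impI)
  fix a b assume a: "bump a" and b: "bump b"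
  note [measurable] = bump_IM[OF bump_deriv[OF a]] bump_IM[OF a] bump_IM[OF b]
  have "(LINT z|SM. f (prod.swap z) * tens (deriv a) b z)
      = tint f b (deriv a)"
    using assms by (subst integral_swap[symmetric]) (auto simp: mult_ac)
  also have "\<dots> = - tint h b a"
    using assms a b by (simp add: wdy_def)
  also have "tint h b a = (LINT z|SM. h (prod.swap z) * tens a b z)"
    using assms by (subst integral_swap[symmetric]) (auto simp: mult_ac)
  finally show "(LINT z|SM. f (prod.swap z) * tens (deriv a) b z)
    = - (LINT z|SM. h (prod.swap z) * tens a b z)" .
qed

definition yker :: "(real \<Rightarrow> real \<Rightarrow> real) \<Rightarrow> (real \<times> real \<Rightarrow> real) \<Rightarrow> real \<times> real \<Rightarrow> real" where
  "yker k f z = (LINT t|IM. k (snd z) t * f (fst z, t))"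

lemma wdy_representation:
  assumes f: "integrable SM f" and h: "integrable SM h" and w: "wdy f h"
  shows "AE z in SM. f z = yker (\<lambda>x. weight) f z + yker avgk h z"
proof -
  have "AE z in SM. f (prod.swap z) = xker (\<lambda>x. weight) (\<lambda>z. f (prod.swap z)) z + xker avgk (\<lambda>z. h (prod.swap z)) z"
    using assms by (intro wdx_representation integrable_swap wdx_swap) auto
  from AE_swap[OF this] show ?thesis by (simp add: xker_def yker_def)
qed

lemma AE_snd: assumes "AE y in IM. P y" shows "AE z in SM. P (snd z)"
proof -
  obtain N where N: "{y \<in> space IM. \<not> P y} \<subseteq> N" "emeasure IM N = 0" "N \<in> sets IM"
    using AE_E[OF assms] by blast
  have "emeasure SM (space IM \<times> N) = 0"
    using N by (subst IM.emeasure_pair_measure_Times) (auto simp del: space_IM)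
  moreover have "space IM \<times> N \<in> sets SM" using N(3) by (rule pair_measureI[OF sets.top])
  moreover have "{z \<in> space SM. \<not> P (snd z)} \<subseteq> space IM \<times> N"
    using N(1) by (auto simp: space_pair_measure)
  ultimately show ?thesis by (intro AE_I[of _ _ "space IM \<times> N"])
qed

text \<open>Continuity in x is asked only off the diagonal, because \<open>avgk x s\<close> jumps at
  x = s; for fixed x this concerns a single s, a null set in the integrals below.\<close>

definition kernel :: "real \<Rightarrow> (real \<Rightarrow> real \<Rightarrow> real) \<Rightarrow> bool" where
  "kernel B k \<longleftrightarrow> (\<lambda>z. k (fst z) (snd z)) \<in> borel_measurable SM \<and> (\<forall>x s. \<bar>k x s\<bar> \<le> B)
    \<and> (\<forall>x s. s \<noteq> x \<longrightarrow> isCont (\<lambda>x. k x s) x)"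

lemma kernelD: assumes "kernel B k"
  shows "(\<lambda>z. k (fst z) (snd z)) \<in> borel_measurable SM" "\<bar>k x s\<bar> \<le> B" "s \<noteq> x \<Longrightarrow> isCont (\<lambda>x. k x s) x"
    "B \<ge> 0" "x \<in> {-1..1} \<Longrightarrow> (\<lambda>s. k x s) \<in> borel_measurable IM"
proof -
  show *: "(\<lambda>z. k (fst z) (snd z)) \<in> borel_measurable SM" "\<bar>k x s\<bar> \<le> B" "s \<noteq> x \<Longrightarrow> isCont (\<lambda>x. k x s) x"
    using assms by (auto simp: kernel_def)
  show "B \<ge> 0" using *(2) by linarith
  show "(\<lambda>s. k x s) \<in> borel_measurable IM" if "x \<in> {-1..1}"
    using measurable_compose[OF measurable_Pair1'[of x IM IM] *(1)] that by simp
qed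

text \<open>The reciprocal bounds \<open>weight\<close> and 1 bounds \<open>avgk\<close>; a value of
  at least 1 lets powers of \<open>wmax\<close> absorb the smaller constants.\<close>

definition wmax :: real where "wmax = max 1 (1 / (LINT x|IM. weight0 x))"

lemma wmax_ge: "wmax \<ge> 1" by (simp add: wmax_def)

lemma weight_le: "\<bar>weight x\<bar> \<le> wmax"
proof -
  have "weight0 x \<le> 1" by (simp add: weight0_def plateau_bounds)
  then have "weight x \<le> 1 / (LINT x|IM. weight0 x)" using weight0_integral by (simp add: weight_def divide_right_mono)
  then show ?thesis using weight_nonneg[of x] by (simp add: wmax_def)
qed

lemma kernel_weight: "kernel wmax (\<lambda>x. weight)" using weight_kernel_SM weight_le by (auto simp: kernel_def)

lemma kernel_avgk: "kernel 1 avgk"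
  unfolding kernel_def
proof (intro conjI allI impI avgk_SM avgk_bound)
  fix x s :: real assume "s \<noteq> x"
  have "isCont (\<lambda>x. of_bool (x < s) :: real) x"
  proof (cases "x < s")
    case True
    then have "\<forall>\<^sub>F x in nhds x. of_bool (x < s) = (1::real)"
      by (auto simp: eventually_nhds intro!: exI[of _ "{..<s}"])
    then show ?thesis by (subst isCont_cong[of _ "\<lambda>x. 1"]) auto
  next
    case False
    then have "\<forall>\<^sub>F x in nhds x. of_bool (x < s) = (0::real)"
      using \<open>s \<noteq> x\<close> by (auto simp: eventually_nhds intro!: exI[of _ "{s<..}"])
    then show ?thesis by (subst isCont_cong[of _ "\<lambda>x. 0"]) auto
  qed
  then show "isCont (\<lambda>x. avgk x s) x" unfolding avgk_def by (intro continuous_intros)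
qed

section \<open>Product kernels and the representation in both variables\<close>

definition tker :: "(real \<Rightarrow> real \<Rightarrow> real) \<Rightarrow> (real \<Rightarrow> real \<Rightarrow> real) \<Rightarrow> (real \<times> real \<Rightarrow> real) \<Rightarrow> real \<times> real \<Rightarrow> real" where
  "tker p q g z = (LINT w|SM. g w * (p (fst z) (fst w) * q (snd z) (snd w)))"

abbreviation norm1 :: "(real \<times> real \<Rightarrow> real) \<Rightarrow> real" where
  "norm1 g \<equiv> (LINT w|SM. \<bar>g w\<bar>)"

lemma tker_integrable:
  assumes "kernel A p" "kernel B q" "integrable SM g" "z \<in> Lam"
  shows "integrable SM (\<lambda>w. g w * (p (fst z) (fst w) * q (snd z) (snd w)))"
  using assms kernelD by (intro integrable_tensor[where A = A and B = B]) (auto simp: Lam_def)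

lemma tker_bound:
  assumes "kernel A p" "kernel B q" "integrable SM g" "z \<in> Lam"
  shows "\<bar>tker p q g z\<bar> \<le> A * B * norm1 g"
proof -
  have "\<bar>tker p q g z\<bar> \<le> (LINT w|SM. \<bar>g w * (p (fst z) (fst w) * q (snd z) (snd w))\<bar>)"
    unfolding tker_def by (rule integral_abs_bound)
  also have "\<dots> \<le> (LINT w|SM. A * B * \<bar>g w\<bar>)"
  proof (rule integral_mono)
    show "integrable SM (\<lambda>w. \<bar>g w * (p (fst z) (fst w) * q (snd z) (snd w))\<bar>)"
      using tker_integrable[OF assms] by simp
    show "integrable SM (\<lambda>w. A * B * \<bar>g w\<bar>)" using assms(3) by simp
    show "\<bar>g w * (p (fst z) (fst w) * q (snd z) (snd w))\<bar> \<le> A * B * \<bar>g w\<bar>" for w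
    proof -
      have *: "\<bar>p (fst z) (fst w) * q (snd z) (snd w)\<bar> \<le> A * B"
        unfolding abs_mult using assms kernelD by (intro mult_mono) auto
      then show ?thesis using mult_left_mono[OF * abs_ge_zero[of "g w"]] by (simp add: abs_mult mult_ac)
    qed
  qed
  finally show ?thesis by simp
qed

text \<open>Dominated convergence: the kernels converge at every w off the two lines through z where
  a jump is possible, and a multiple of |g| is a majorant. This is how mere integrability of weak
  derivatives yields continuity.\<close>

lemma tker_continuous:
  assumes p: "kernel A p" and q: "kernel B q" and g: "integrable SM g"
  shows "continuous_on Lam (tker p q g)"
  unfolding continuous_on_sequentially
proof (intro allI ballI impI, elim conjE)
  fix X z assume z: "z \<in> Lam" and X: "\<forall>n. X n \<in> Lam" "X \<longlonglongrightarrow> z"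
  show "(tker p q g \<circ> X) \<longlonglongrightarrow> tker p q g z"
    unfolding tker_def o_def
  proof (rule integral_dominated_convergence[where w = "\<lambda>w. A * B * \<bar>g w\<bar>"])
    show "integrable SM (\<lambda>w. A * B * \<bar>g w\<bar>)" using g by simp
    show "(\<lambda>w. g w * (p (fst z) (fst w) * q (snd z) (snd w))) \<in> borel_measurable SM"
      using tker_integrable[OF p q g z] by auto
    show "(\<lambda>w. g w * (p (fst (X n)) (fst w) * q (snd (X n)) (snd w))) \<in> borel_measurable SM" for n
      using tker_integrable[OF p q g] X by auto
    show "AE w in SM. norm (g w * (p (fst (X n)) (fst w) * q (snd (X n)) (snd w))) \<le> A * B * \<bar>g w\<bar>" for n
    proof (rule AE_I2)
      fix w
      have *: "\<bar>p (fst (X n)) (fst w) * q (snd (X n)) (snd w)\<bar> \<le> A * B"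
        unfolding abs_mult using assms kernelD by (intro mult_mono) auto
      then show "norm (g w * (p (fst (X n)) (fst w) * q (snd (X n)) (snd w))) \<le> A * B * \<bar>g w\<bar>"
        using mult_left_mono[OF * abs_ge_zero[of "g w"]] by (simp add: abs_mult mult_ac)
    qed
    show "AE w in SM. (\<lambda>n. g w * (p (fst (X n)) (fst w) * q (snd (X n)) (snd w)))
        \<longlonglongrightarrow> g w * (p (fst z) (fst w) * q (snd z) (snd w))"
      using AE_SM_neq[of "fst z" "snd z"]
    proof eventually_elim
      case (elim w)
      have "(\<lambda>n. p (fst (X n)) (fst w)) \<longlonglongrightarrow> p (fst z) (fst w)"
        using isCont_tendsto_compose[OF kernelD(3)[OF p] tendsto_fst[OF X(2)]] elim by auto
      moreover have "(\<lambda>n. q (snd (X n)) (snd w)) \<longlonglongrightarrow> q (snd z) (snd w)"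
        using isCont_tendsto_compose[OF kernelD(3)[OF q] tendsto_snd[OF X(2)]] elim by auto
      ultimately show ?case by (intro tendsto_intros)
    qed
  qed
qed

lemma tker_osc_fst:
  assumes p: "kernel A p" and q: "kernel B q" and g: "integrable SM g" and z: "(x, y) \<in> Lam" "(x', y) \<in> Lam"
  shows "\<bar>tker p q g (x, y) - tker p q g (x', y)\<bar> \<le> 2 * A * B * norm1 g"
  using tker_bound[OF p q g z(1)] tker_bound[OF p q g z(2)] by linarith

lemma tker_osc_snd:
  assumes p: "kernel A p" and q: "kernel B q" and g: "integrable SM g" and z: "(x, y) \<in> Lam" "(x, y') \<in> Lam"
  shows "\<bar>tker p q g (x, y) - tker p q g (x, y')\<bar> \<le> 2 * A * B * norm1 g"
  using tker_bound[OF p q g z(1)] tker_bound[OF p q g z(2)] by linarith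

text \<open>The y-representation of f holds only almost everywhere. For almost every y it holds for
  almost every s on the line, which is enough under the integral in s; Fubini then merges the two
  integrations into one over the square.\<close>

lemma xker_subst:
  assumes f: "f \<in> borel_measurable SM" and k: "kernel A k" and k1: "kernel B k1" and k2: "kernel C k2"
    and g1: "integrable SM g1" and g2: "integrable SM g2"
    and ae: "AE z in SM. f z = yker k1 g1 z + yker k2 g2 z"
  shows "AE z in SM. xker k f z = tker k k1 g1 z + tker k k2 g2 z"
proof -
  have "AE y in IM. AE s in IM. f (s, y) = yker k1 g1 (s, y) + yker k2 g2 (s, y)"
    using SM.AE_pair[OF AE_swap[OF ae]] by simp
  then have "AE z in SM. AE s in IM. f (s, snd z) = yker k1 g1 (s, snd z) + yker k2 g2 (s, snd z)"
    by (rule AE_snd)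
  then show ?thesis using AE_space[of SM]
  proof eventually_elim
    case (elim z)
    then have z: "z \<in> Lam" by (simp add: space_SM)
    obtain x y where xy: "z = (x, y)" by (cases z)
    have y: "y \<in> space IM" "x \<in> {-1..1}" "y \<in> {-1..1}" using z xy by (auto simp: Lam_def)
    have i1: "integrable SM (\<lambda>(s, t). g1 (s, t) * (k x s * k1 y t))"
      using tker_integrable[OF k k1 g1 z] by (simp add: xy case_prod_beta')
    have i2: "integrable SM (\<lambda>(s, t). g2 (s, t) * (k x s * k2 y t))"
      using tker_integrable[OF k k2 g2 z] by (simp add: xy case_prod_beta')
    have e: "(LINT t|IM. g (s, t) * (k x s * l y t)) = k x s * yker l g (s, y)" for g l s
      by (simp add: yker_def mult_ac flip: integral_mult_right_zero)
    have "xker k f z = (LINT s|IM. (LINT t|IM. g1 (s, t) * (k x s * k1 y t)) + (LINT t|IM. g2 (s, t) * (k x s * k2 y t)))"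
      unfolding xker_def
    proof (rule integral_cong_AE)
      show "(\<lambda>s. k (fst z) s * f (s, snd z)) \<in> borel_measurable IM"
        using kernelD(5)[OF k y(2)] measurable_compose[OF measurable_Pair2'[OF y(1)] f]
        by (auto simp: xy intro!: borel_measurable_times)
      show "(\<lambda>s. (LINT t|IM. g1 (s, t) * (k x s * k1 y t)) + (LINT t|IM. g2 (s, t) * (k x s * k2 y t))) \<in> borel_measurable IM"
        using SM.integrable_fst[OF i1] SM.integrable_fst[OF i2] by (intro borel_measurable_add) auto
      show "AE s in IM. k (fst z) s * f (s, snd z) = (LINT t|IM. g1 (s, t) * (k x s * k1 y t)) + (LINT t|IM. g2 (s, t) * (k x s * k2 y t))"
        using elim(1) unfolding e by eventually_elim (simp add: xy algebra_simps)
    qed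
    also have "\<dots> = (LINT s|IM. LINT t|IM. g1 (s, t) * (k x s * k1 y t)) + (LINT s|IM. LINT t|IM. g2 (s, t) * (k x s * k2 y t))"
      by (intro Bochner_Integration.integral_add SM.integrable_fst i1 i2)
    also have "\<dots> = tker k k1 g1 z + tker k k2 g2 z"
      using SM.integral_fst[OF i1] SM.integral_fst[OF i2] by (simp add: tker_def xy case_prod_beta')
    finally show ?case .
  qed
qed

text \<open>With \<open>A\<close> the mean weighted by \<open>weight\<close> and \<open>T\<close> the integral operator with kernel \<open>avgk\<close>, the identity
  \<open>f = A f + T f'\<close> in both variables gives \<open>f = A A f + A T f\<^sub>y + T A f\<^sub>x + T T f\<^sub>x\<^sub>y\<close>.\<close>

definition sobolev_rep where
  "sobolev_rep f fx fy fxy z = tker (\<lambda>x. weight) (\<lambda>x. weight) f z + tker (\<lambda>x. weight) avgk fy z + tker avgk (\<lambda>x. weight) fx z + tker avgk avgk fxy z"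

lemma sobolev_rep_representation:
  assumes "integrable SM f" "integrable SM fx" "integrable SM fy" "integrable SM fxy"
    and "wdx f fx" "wdy f fy" "wdy fx fxy"
  shows "AE z in SM. f z = sobolev_rep f fx fy fxy z"
proof -
  have 1: "AE z in SM. xker (\<lambda>x. weight) f z = tker (\<lambda>x. weight) (\<lambda>x. weight) f z + tker (\<lambda>x. weight) avgk fy z"
    by (rule xker_subst[OF _ kernel_weight kernel_weight kernel_avgk assms(1,3) wdy_representation[OF assms(1,3,6)]]) (use assms in auto)
  have 2: "AE z in SM. xker avgk fx z = tker avgk (\<lambda>x. weight) fx z + tker avgk avgk fxy z"
    by (rule xker_subst[OF _ kernel_avgk kernel_weight kernel_avgk assms(2,4) wdy_representation[OF assms(2,4,7)]]) (use assms in auto)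
  from 1 2 wdx_representation[OF assms(1,2,5)] show ?thesis
    unfolding sobolev_rep_def by eventually_elim simp
qed

lemma sobolev_rep_continuous:
  assumes "integrable SM f" "integrable SM fx" "integrable SM fy" "integrable SM fxy"
  shows "continuous_on Lam (sobolev_rep f fx fy fxy)"
  unfolding sobolev_rep_def[abs_def]
  by (intro continuous_intros tker_continuous[OF kernel_weight kernel_weight] tker_continuous[OF kernel_weight kernel_avgk]
      tker_continuous[OF kernel_avgk kernel_weight] tker_continuous[OF kernel_avgk kernel_avgk] assms)

lemma norm1_nonneg: "norm1 g \<ge> 0" by (intro integral_nonneg_AE) auto

lemma wmax_sq: "1 \<le> wmax * wmax" "wmax \<le> wmax * wmax"
  using wmax_ge mult_mono[of 1 wmax 1 wmax] mult_mono[of 1 wmax wmax wmax] by auto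

lemma sobolev_rep_bound:
  assumes f: "integrable SM f" "integrable SM fx" "integrable SM fy" "integrable SM fxy" and z: "z \<in> Lam"
  shows "\<bar>sobolev_rep f fx fy fxy z\<bar> \<le> wmax * wmax * (norm1 f + norm1 fx + norm1 fy + norm1 fxy)"
proof -
  have "wmax * norm1 fx \<le> wmax * wmax * norm1 fx" "wmax * norm1 fy \<le> wmax * wmax * norm1 fy" "norm1 fxy \<le> wmax * wmax * norm1 fxy"
    using mult_right_mono[OF wmax_sq(2) norm1_nonneg] mult_right_mono[OF wmax_sq(1) norm1_nonneg] by auto
  then show ?thesis
    using tker_bound[OF kernel_weight kernel_weight f(1) z] tker_bound[OF kernel_weight kernel_avgk f(3) z] tker_bound[OF kernel_avgk kernel_weight f(2) z]
      tker_bound[OF kernel_avgk kernel_avgk f(4) z]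
    unfolding sobolev_rep_def distrib_left by linarith
qed

text \<open>The two terms whose first kernel is \<open>weight\<close> do not depend on x and cancel,
  so neither f nor fy enters the bound. In this way the oscillation of a derivative just below
  \<open>\<gamma>\<close> is controlled by derivatives above \<open>\<gamma>\<close>.\<close>

lemma sobolev_rep_osc_fst:
  assumes f: "integrable SM f" "integrable SM fx" "integrable SM fy" "integrable SM fxy"
    and z: "(x, y) \<in> Lam" "(x', y) \<in> Lam"
  shows "\<bar>sobolev_rep f fx fy fxy (x, y) - sobolev_rep f fx fy fxy (x', y)\<bar> \<le> 2 * wmax * (norm1 fx + norm1 fxy)"
proof -
  have "tker (\<lambda>x. weight) q g (x, y) = tker (\<lambda>x. weight) q g (x', y)" for q g by (simp add: tker_def)
  moreover have "norm1 fxy \<le> wmax * norm1 fxy"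
    using mult_right_mono[OF wmax_ge norm1_nonneg] by simp
  ultimately show ?thesis
    using tker_osc_fst[OF kernel_avgk kernel_weight f(2) z] tker_osc_fst[OF kernel_avgk kernel_avgk f(4) z]
    unfolding sobolev_rep_def distrib_left by simp
qed

lemma sobolev_rep_osc_snd:
  assumes f: "integrable SM f" "integrable SM fx" "integrable SM fy" "integrable SM fxy"
    and z: "(x, y) \<in> Lam" "(x, y') \<in> Lam"
  shows "\<bar>sobolev_rep f fx fy fxy (x, y) - sobolev_rep f fx fy fxy (x, y')\<bar> \<le> 2 * wmax * (norm1 fy + norm1 fxy)"
proof -
  have "tker p (\<lambda>x. weight) g (x, y) = tker p (\<lambda>x. weight) g (x, y')" for p g by (simp add: tker_def)
  moreover have "norm1 fxy \<le> wmax * norm1 fxy"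
    using mult_right_mono[OF wmax_ge norm1_nonneg] by simp
  ultimately show ?thesis
    using tker_osc_snd[OF kernel_weight kernel_avgk f(3) z] tker_osc_snd[OF kernel_avgk kernel_avgk f(4) z]
    unfolding sobolev_rep_def distrib_left by simp
qed

text \<open>The x-representation, with its averaged part expanded in y, shows that f differs from a
  constant c by terms in fx and fy. The square has area 4, so 4 c differs from the integral of f by
  at most the norm of f - c; replacing c by the mean thus doubles the constants.\<close>

lemma poincare_L1:
  assumes f: "integrable SM f" "integrable SM fx" "integrable SM fy" "wdx f fx" "wdy f fy"
  shows "norm1 f \<le> \<bar>LINT z|SM. f z\<bar> + 8 * wmax * (norm1 fx + norm1 fy)"
proof -
  have 1: "AE z in SM. xker (\<lambda>x. weight) f z = tker (\<lambda>x. weight) (\<lambda>x. weight) f z + tker (\<lambda>x. weight) avgk fy z"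
    by (rule xker_subst[OF _ kernel_weight kernel_weight kernel_avgk f(1,3) wdy_representation[OF f(1,3,5)]]) (use f in auto)
  \<comment> \<open>Both kernels ignore the evaluation point, so the value at (0, 0) stands for all
    z.\<close>
  define c where "c = tker (\<lambda>x. weight) (\<lambda>x. weight) f (0, 0)"
  have c: "tker (\<lambda>x. weight) (\<lambda>x. weight) f z = c" for z by (simp add: c_def tker_def)
  have P: "integrable SM (xker avgk fx)" "norm1 (xker avgk fx) \<le> 2 * 1 * norm1 fx"
    using xker_bound[OF avgk_SM avgk_bound f(2)] by auto
  have "AE z in SM. \<bar>f z - c\<bar> \<le> \<bar>xker avgk fx z\<bar> + wmax * norm1 fy"
    using 1 wdx_representation[OF f(1,2,4)] AE_space[of SM]
  proof eventually_elim
    case (elim z)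
    have "\<bar>tker (\<lambda>x. weight) avgk fy z\<bar> \<le> wmax * 1 * norm1 fy"
      using elim by (intro tker_bound kernel_weight kernel_avgk f) (simp add: space_SM)
    then show ?case using elim c[of z] by simp
  qed
  then have "(LINT z|SM. \<bar>f z - c\<bar>) \<le> (LINT z|SM. \<bar>xker avgk fx z\<bar> + wmax * norm1 fy)"
    using f P by (intro integral_mono_AE) auto
  also have "\<dots> = norm1 (xker avgk fx) + 4 * (wmax * norm1 fy)"
    using P measure_SM by (simp add: Bochner_Integration.integral_add)
  finally have 2: "(LINT z|SM. \<bar>f z - c\<bar>) \<le> 2 * norm1 fx + 4 * (wmax * norm1 fy)"
    using P(2) by simp
  have "(LINT z|SM. f z - c) = (LINT z|SM. f z) - 4 * c"
    using f measure_SM by (simp add: Bochner_Integration.integral_diff)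
  moreover have "\<bar>LINT z|SM. f z - c\<bar> \<le> (LINT z|SM. \<bar>f z - c\<bar>)" by (rule integral_abs_bound)
  moreover have "norm1 f \<le> (LINT z|SM. \<bar>f z - c\<bar> + \<bar>c\<bar>)"
    using f by (intro integral_mono) auto
  moreover have "(LINT z|SM. \<bar>f z - c\<bar> + \<bar>c\<bar>) = (LINT z|SM. \<bar>f z - c\<bar>) + 4 * \<bar>c\<bar>"
    using f measure_SM by (simp add: Bochner_Integration.integral_add)
  moreover have "norm1 fx \<le> wmax * norm1 fx"
    using mult_right_mono[OF wmax_ge norm1_nonneg] by simp
  ultimately show ?thesis using 2 norm1_nonneg[of fx] unfolding distrib_left by linarith
qed

section \<open>Classical derivatives on the square\<close>

lemma Lam_iff: "(x, y) \<in> Lam \<longleftrightarrow> x \<in> {-1..1} \<and> y \<in> {-1..1}" by (simp add: Lam_def)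

lemma compact_Lam: "compact Lam" unfolding Lam_def by (intro compact_Times) auto

lemma continuous_on_Lam_swap:
  "continuous_on Lam f \<Longrightarrow> continuous_on Lam (\<lambda>z. f (prod.swap z))"
  by (rule continuous_on_compose2[of Lam f]) (auto simp: Lam_def intro!: continuous_on_swap)

lemma continuous_Lam_measurable:
  fixes f :: "real \<times> real \<Rightarrow> real"
  assumes "continuous_on Lam f" shows "f \<in> borel_measurable SM"
  using borel_measurable_continuous_on_restrict[OF assms] unfolding SM_eq
  by (simp cong: measurable_cong_sets restrict_space_sets_cong)

lemma continuous_Lam_bounded:
  fixes f :: "real \<times> real \<Rightarrow> real"
  assumes "continuous_on Lam f"
  obtains B where "B > 0" "\<And>z. z \<in> Lam \<Longrightarrow> \<bar>f z\<bar> \<le> B"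
proof -
  have "bounded (f ` Lam)"
    using compact_continuous_image[OF assms compact_Lam] compact_imp_bounded by blast
  then obtain B where B: "B > 0" "\<forall>w\<in>f ` Lam. norm w \<le> B" using bounded_pos by blast
  show ?thesis by (rule that[of B]) (use B in auto)
qed

lemma continuous_Lam_integrable:
  fixes f :: "real \<times> real \<Rightarrow> real"
  assumes "continuous_on Lam f" shows "integrable SM f"
  using continuous_Lam_bounded[OF assms] bounded_integrable_SM[OF continuous_Lam_measurable[OF assms]] by metis

lemma continuous_Lam_section:
  assumes "continuous_on Lam f" "y \<in> {-1..1}"
  shows "continuous_on {-1..1} (\<lambda>x. f (x, y))" "continuous_on {-1..1} (\<lambda>x. f (y, x))"
  by (rule continuous_on_compose2[OF assms(1)];
      use assms in \<open>auto simp: Lam_def intro!: continuous_intros\<close>)+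

text \<open>Inside the square the points of disagreement form an open set of measure zero, hence
  there are none; continuity then reaches the boundary, as \<open>Lam\<close> is the closure of its
  interior.\<close>

lemma continuous_AE_eq:
  fixes f g :: "real \<times> real \<Rightarrow> real"
  assumes f: "continuous_on Lam f" and g: "continuous_on Lam g"
    and ae: "AE z in SM. f z = g z" and z: "z \<in> Lam"
  shows "f z = g z"
proof -
  have ae': "AE z in lborel. z \<in> Lam \<longrightarrow> f z = g z"
    using ae Lam_sets unfolding SM_eq by (subst (asm) AE_restrict_space_iff) auto
  have IL: "interior Lam = {-1<..<1} \<times> {-1<..<1}" unfolding Lam_def by (simp add: interior_Times)
  have int: "f w = g w" if w: "w \<in> interior Lam" for w
  proof (rule ccontr)
    assume ne: "f w \<noteq> g w"
    have "continuous_on (interior Lam) (\<lambda>z. f z - g z)"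
      using f g by (intro continuous_intros) (auto intro: continuous_on_subset[OF _ interior_subset])
    then have "open (interior Lam \<inter> (\<lambda>z. f z - g z) -` (- {0}))"
      by (rule continuous_open_preimage) (auto intro: open_Compl)
    define U where "U = interior Lam \<inter> (\<lambda>z. f z - g z) -` (- {0})"
    have "open U" unfolding U_def by fact
    moreover have "w \<in> U" using ne w by (simp add: U_def)
    moreover have "AE z in lborel. z \<notin> U"
      using ae' by eventually_elim (use interior_subset in \<open>auto simp: U_def\<close>)
    then have "U \<in> null_sets lborel"
      using \<open>open U\<close> by (subst (asm) AE_iff_null_sets[symmetric]) auto
    then have "negligible U" by (simp add: negligible_iff_null_sets null_sets_completionI)
    ultimately show False using open_not_negligible by blast
  qed
  have cl: "closure (interior Lam) = Lam"
    unfolding IL by (simp add: closure_Times Lam_def)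
  have "f z - g z = 0"
    by (rule continuous_constant_on_closure[of "interior Lam"])
       (use f g int z cl in \<open>auto intro: continuous_intros\<close>)
  then show ?thesis by simp
qed

lemma xker_continuous:
  assumes k: "kernel B k" and g: "continuous_on Lam g"
  shows "continuous_on Lam (xker k g)"
  unfolding continuous_on_sequentially
proof (intro allI ballI impI, elim conjE)
  fix X z assume z: "z \<in> Lam" and X: "\<forall>n. X n \<in> Lam" "X \<longlonglongrightarrow> z"
  obtain C where C: "C > 0" "\<And>z. z \<in> Lam \<Longrightarrow> \<bar>g z\<bar> \<le> C" using continuous_Lam_bounded[OF g] by blast
  have m: "(\<lambda>s. k (fst w) s * g (s, snd w)) \<in> borel_measurable IM" if "w \<in> Lam" for w
    using that kernelD(5)[OF k, of "fst w"]
      measurable_compose[OF measurable_Pair2'[of "snd w" IM IM] continuous_Lam_measurable[OF g]]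
    by (intro borel_measurable_times) (auto simp: Lam_def)
  have F: "fst w \<in> {-1..1}" "snd w \<in> {-1..1}" if "w \<in> Lam" for w using that by (auto simp: Lam_def)
  show "(xker k g \<circ> X) \<longlonglongrightarrow> xker k g z"
    unfolding xker_def o_def
  proof (rule integral_dominated_convergence[where w = "\<lambda>w. B * C"])
    show "integrable IM (\<lambda>w. B * C)" by simp
    show "(\<lambda>s. k (fst z) s * g (s, snd z)) \<in> borel_measurable IM" by (rule m[OF z])
    show "(\<lambda>s. k (fst (X n)) s * g (s, snd (X n))) \<in> borel_measurable IM" for n using m X by blast
    show "AE s in IM. norm (k (fst (X n)) s * g (s, snd (X n))) \<le> B * C" for n
    proof (rule AE_I2)
      fix s assume "s \<in> space IM"
      then have "(s, snd (X n)) \<in> Lam" using X F(2)[of "X n"] by (auto simp: Lam_iff)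
      then show "norm (k (fst (X n)) s * g (s, snd (X n))) \<le> B * C"
        using kernelD(2,4)[OF k] C by (auto simp: abs_mult intro!: mult_mono)
    qed
    show "AE s in IM. (\<lambda>n. k (fst (X n)) s * g (s, snd (X n))) \<longlonglongrightarrow> k (fst z) s * g (s, snd z)"
      using AE_IM_neq[of "fst z"] AE_space
    proof eventually_elim
      case (elim s)
      have "(\<lambda>n. k (fst (X n)) s) \<longlonglongrightarrow> k (fst z) s"
        using isCont_tendsto_compose[OF kernelD(3)[OF k] tendsto_fst[OF X(2)]] elim by auto
      moreover have "(\<lambda>n. g (s, snd (X n))) \<longlonglongrightarrow> g (s, snd z)"
      proof (rule continuous_on_tendsto_compose[OF g])
        show "(\<lambda>n. (s, snd (X n))) \<longlonglongrightarrow> (s, snd z)" by (intro tendsto_intros X)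
        show "(s, snd z) \<in> Lam" using elim F[OF z] by (simp add: Lam_iff)
        have "(s, snd (X n)) \<in> Lam" for n using X F(2)[of "X n"] elim by (auto simp: Lam_iff)
        then show "\<forall>\<^sub>F n in sequentially. (s, snd (X n)) \<in> Lam" by simp
      qed
      ultimately show ?case by (intro tendsto_intros)
    qed
  qed
qed

lemma tail_integral:
  fixes g :: "real \<Rightarrow> real"
  assumes g: "continuous_on {-1..1} g" and x: "x \<in> {-1..1}"
  shows "(LINT s|IM. of_bool (x < s) * g s) = (LINT s|IM. g s) - integral {-1..x} g"
    and "integrable IM (\<lambda>s. of_bool (x < s) * g s)" "integrable IM g"
proof -
  have gi: "set_integrable lborel {-1..1} g" by (rule borel_integrable_atLeastAtMost'[OF g])
  then show gI: "integrable IM g"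
    unfolding IM_def set_integrable_def by (simp add: integrable_restrict_space)
  have "integrable IM (\<lambda>s. g s * of_bool (x < s))"
    by (rule integrable_bounded_mult[OF gI, of _ 1]) auto
  then show i2: "integrable IM (\<lambda>s. of_bool (x < s) * g s)" by (simp add: mult.commute)
  have "(LINT s|IM. g s) - (LINT s|IM. of_bool (x < s) * g s) = (LINT s|IM. g s - of_bool (x < s) * g s)"
    using gI i2 by (intro Bochner_Integration.integral_diff[symmetric])
  also have "\<dots> = (LINT s:{-1..x}|lborel. g s)"
    unfolding IM_def set_lebesgue_integral_def
    by (subst integral_restrict_space) (use x in \<open>auto intro!: Bochner_Integration.integral_cong simp: indicator_def\<close>)
  also have "\<dots> = integral {-1..x} g"
    using x by (intro set_borel_integral_eq_integral borel_integrable_atLeastAtMost' continuous_on_subset[OF g]) auto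
  finally show "(LINT s|IM. of_bool (x < s) * g s) = (LINT s|IM. g s) - integral {-1..x} g" by simp
qed

text \<open>For continuous f and h the representation holds everywhere. Along a line of constant y
  it exhibits f as a constant plus the indefinite integral of h, whose derivative at the endpoints
  is the one-sided one.\<close>

lemma wdx_classical:
  assumes f: "continuous_on Lam f" and h: "continuous_on Lam h" and w: "wdx f h"
    and xy: "x \<in> {-1..1}" "y \<in> {-1..1}"
  shows "((\<lambda>t. f (t, y)) has_vector_derivative h (x, y)) (at x within {-1..1})"
proof -
  have "continuous_on Lam (\<lambda>z. xker (\<lambda>x. weight) f z + xker avgk h z)"
    by (intro continuous_on_add xker_continuous[OF kernel_weight f] xker_continuous[OF kernel_avgk h])
  then have eq: "f z = xker (\<lambda>x. weight) f z + xker avgk h z" if "z \<in> Lam" for z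
    using wdx_representation[OF continuous_Lam_integrable[OF f] continuous_Lam_integrable[OF h] w] that
    by (intro continuous_AE_eq[OF f])
  let ?g = "\<lambda>s. h (s, y)"
  have g: "continuous_on {-1..1} ?g" by (rule continuous_Lam_section(1)[OF h xy(2)])
  \<comment> \<open>The 0 is a placeholder, as the kernel \<open>weight\<close> does not depend on
    the first coordinate. The other terms come from splitting \<open>avgk\<close> and writing the
    tail integral from t as the total minus the initial part.\<close>
  let ?c = "xker (\<lambda>x. weight) f (0, y) + (LINT s|IM. weight_prim s * ?g s) - (LINT s|IM. ?g s)"
  have eq2: "f (t, y) = ?c + integral {-1..t} ?g" if t: "t \<in> {-1..1}" for t
  proof -
    have "integrable IM (\<lambda>s. ?g s * weight_prim s)"
      using weight_prim_bounds by (intro integrable_bounded_mult[where B = 1] tail_integral(3)[OF g t]) auto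
    then have i1: "integrable IM (\<lambda>s. weight_prim s * ?g s)" by (simp add: mult.commute)
    have "xker avgk h (t, y) = (LINT s|IM. weight_prim s * ?g s - of_bool (t < s) * ?g s)"
      unfolding xker_def avgk_def by (simp add: left_diff_distrib)
    also have "\<dots> = (LINT s|IM. weight_prim s * ?g s) - (LINT s|IM. of_bool (t < s) * ?g s)"
      by (intro Bochner_Integration.integral_diff i1 tail_integral(2)[OF g t])
    finally show ?thesis using eq[of "(t, y)"] t xy tail_integral(1)[OF g t]
      by (simp add: Lam_iff) (simp add: xker_def)
  qed
  have "((\<lambda>t. integral {-1..t} ?g) has_vector_derivative ?g x) (at x within {-1..1})"
    by (rule integral_has_vector_derivative[OF g xy(1)])
  then have "((\<lambda>t. ?c + integral {-1..t} ?g) has_vector_derivative ?g x) (at x within {-1..1})"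
    by (auto intro!: derivative_eq_intros)
  then show ?thesis
    by (rule has_vector_derivative_transform[rotated 2]) (use xy eq2 in auto)
qed

lemma wdy_classical:
  assumes f: "continuous_on Lam f" and h: "continuous_on Lam h" and w: "wdy f h"
    and xy: "x \<in> {-1..1}" "y \<in> {-1..1}"
  shows "((\<lambda>t. f (x, t)) has_vector_derivative h (x, y)) (at y within {-1..1})"
  using wdx_classical[OF continuous_on_Lam_swap[OF f] continuous_on_Lam_swap[OF h]
      wdx_swap[OF continuous_Lam_measurable[OF f] continuous_Lam_measurable[OF h] w] xy(2,1)] by simp

section \<open>Derivatives relative to the closed interval\<close>

lemma vector_derivative_I:
  assumes "(f has_vector_derivative d) (at x within {-1..1::real})" "x \<in> {-1..1}"
  shows "vector_derivative f (at x within {-1..1}) = d"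
  using assms by (intro vector_derivative_within_cbox[where a="-1" and b=1, simplified]) auto

lemma Dx_eqI: "((\<lambda>t. f (t, y)) has_vector_derivative d) (at x within {-1..1}) \<Longrightarrow> x \<in> {-1..1} \<Longrightarrow> Dx f (x, y) = d"
  unfolding Dx_def by (simp add: vector_derivative_I)

lemma Dy_eqI: "((\<lambda>t. f (x, t)) has_vector_derivative d) (at y within {-1..1}) \<Longrightarrow> y \<in> {-1..1} \<Longrightarrow> Dy f (x, y) = d"
  unfolding Dy_def by (simp add: vector_derivative_I)

lemma vector_derivative_cong_I:
  assumes "\<And>t. t \<in> {-1..1} \<Longrightarrow> f t = g t" "x \<in> {-1..1::real}"
  shows "vector_derivative f (at x within {-1..1}) = vector_derivative g (at x within {-1..1})"
proof -
  have "(f has_vector_derivative d) (at x within {-1..1}) \<longleftrightarrow> (g has_vector_derivative d) (at x within {-1..1})" for d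
    using assms by (intro iffI; elim has_vector_derivative_transform[rotated 2]) auto
  then show ?thesis unfolding vector_derivative_def by simp
qed

lemma Dx_cong: "(\<And>z. z \<in> Lam \<Longrightarrow> f z = g z) \<Longrightarrow> z \<in> Lam \<Longrightarrow> Dx f z = Dx g z"
  unfolding Dx_def by (cases z) (auto simp: Lam_iff intro!: vector_derivative_cong_I)

lemma Dy_cong: "(\<And>z. z \<in> Lam \<Longrightarrow> f z = g z) \<Longrightarrow> z \<in> Lam \<Longrightarrow> Dy f z = Dy g z"
  unfolding Dy_def by (cases z) (auto simp: Lam_iff intro!: vector_derivative_cong_I)

lemma C_Lam_cong: "f \<in> C_Lam k \<Longrightarrow> (\<And>z. z \<in> Lam \<Longrightarrow> f z = g z) \<Longrightarrow> g \<in> C_Lam k"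
proof (induction k arbitrary: f g)
  case 0
  then have "continuous_on Lam g" by (simp cong: continuous_on_cong)
  then show ?case by simp
next
  case (Suc k)
  have c: "continuous_on Lam g" using Suc.prems by (simp cong: continuous_on_cong)
  have "Dx g \<in> C_Lam k" "Dy g \<in> C_Lam k"
    using Suc.IH[of "Dx f" "Dx g"] Suc.IH[of "Dy f" "Dy g"] Suc.prems Dx_cong[of f g] Dy_cong[of f g] by auto
  moreover have "(\<lambda>t. g (t, y)) differentiable (at x within {-1..1})" "(\<lambda>t. g (x, t)) differentiable (at y within {-1..1})"
    if xy: "x \<in> {-1..1}" "y \<in> {-1..1}" for x y
  proof -
    obtain D E where D: "((\<lambda>t. f (t, y)) has_derivative D) (at x within {-1..1})"
      and E: "((\<lambda>t. f (x, t)) has_derivative E) (at y within {-1..1})"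
    proof -
      have "(\<lambda>t. f (t, y)) differentiable (at x within {-1..1})" "(\<lambda>t. f (x, t)) differentiable (at y within {-1..1})"
        using Suc.prems(1) xy by auto
      then show ?thesis using that unfolding differentiable_def by blast
    qed
    have "((\<lambda>t. g (t, y)) has_derivative D) (at x within {-1..1})"
      by (rule has_derivative_transform[OF _ _ D]) (use xy Suc.prems(2) in \<open>auto simp: Lam_iff\<close>)
    then show "(\<lambda>t. g (t, y)) differentiable (at x within {-1..1})" by (auto simp: differentiable_def)
    have "((\<lambda>t. g (x, t)) has_derivative E) (at y within {-1..1})"
      by (rule has_derivative_transform[OF _ _ E]) (use xy Suc.prems(2) in \<open>auto simp: Lam_iff\<close>)
    then show "(\<lambda>t. g (x, t)) differentiable (at y within {-1..1})" by (auto simp: differentiable_def)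
  qed
  ultimately show ?case using c by simp
qed

text \<open>A function stored together with all its derivatives up to order n. Both ways of reaching
  (k+1, l+1) lead to the same entry, so mixed derivatives commute by construction.\<close>

definition deriv_array :: "nat \<Rightarrow> (nat \<Rightarrow> nat \<Rightarrow> real \<times> real \<Rightarrow> real) \<Rightarrow> bool" where
  "deriv_array n V \<longleftrightarrow> (\<forall>k l. k + l \<le> n \<longrightarrow> continuous_on Lam (V k l))
    \<and> (\<forall>k l. k + l < n \<longrightarrow> (\<forall>x\<in>{-1..1}. \<forall>y\<in>{-1..1}.
        ((\<lambda>t. V k l (t, y)) has_vector_derivative V (Suc k) l (x, y)) (at x within {-1..1})
      \<and> ((\<lambda>t. V k l (x, t)) has_vector_derivative V k (Suc l) (x, y)) (at y within {-1..1})))"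

lemma deriv_array_Dx: assumes "deriv_array n V" "k + l < n" "z \<in> Lam"
  shows "Dx (V k l) z = V (Suc k) l z" "Dy (V k l) z = V k (Suc l) z"
  using assms by (cases z; auto simp: deriv_array_def Lam_iff intro!: Dx_eqI Dy_eqI)+

lemma deriv_array_C_Lam: "deriv_array n V \<Longrightarrow> k + l + m \<le> n \<Longrightarrow> V k l \<in> C_Lam m"
proof (induction m arbitrary: k l)
  case 0 then show ?case by (simp add: deriv_array_def)
next
  case (Suc m)
  have "continuous_on Lam (V k l)" using Suc.prems by (simp add: deriv_array_def)
  moreover have "Dx (V k l) \<in> C_Lam m"
    by (rule C_Lam_cong[OF Suc.IH[of "Suc k" l]]) (use Suc.prems deriv_array_Dx[of n V k l] in auto)
  moreover have "Dy (V k l) \<in> C_Lam m"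
    by (rule C_Lam_cong[OF Suc.IH[of k "Suc l"]]) (use Suc.prems deriv_array_Dx[of n V k l] in auto)
  moreover have "(\<lambda>t. V k l (t, y)) differentiable (at x within {-1..1}) \<and> (\<lambda>t. V k l (x, t)) differentiable (at y within {-1..1})"
    if "x \<in> {-1..1}" "y \<in> {-1..1}" for x y
  proof -
    have "k + l < n" using Suc.prems by simp
    then have "((\<lambda>t. V k l (t, y)) has_vector_derivative V (Suc k) l (x, y)) (at x within {-1..1})"
      "((\<lambda>t. V k l (x, t)) has_vector_derivative V k (Suc l) (x, y)) (at y within {-1..1})"
      using Suc.prems(1) that unfolding deriv_array_def by blast+
    then show ?thesis by (blast intro: differentiableI_vector)
  qed
  ultimately show ?case by simp
qed

lemma deriv_array_D_classical: assumes V: "deriv_array n V" and kl: "k + l \<le> n" and z: "z \<in> Lam"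
  shows "D_classical (k, l) (V 0 0) z = V k l z"
proof -
  have 1: "l \<le> n \<Longrightarrow> z \<in> Lam \<Longrightarrow> (Dy ^^ l) (V 0 0) z = V 0 l z" for l z
  proof (induction l arbitrary: z)
    case (Suc l)
    then have "Dy ((Dy ^^ l) (V 0 0)) z = Dy (V 0 l) z" by (intro Dy_cong) auto
    then show ?case using deriv_array_Dx(2)[OF V, of 0 l z] Suc.prems by simp
  qed simp
  have "k + l \<le> n \<Longrightarrow> z \<in> Lam \<Longrightarrow> (Dx ^^ k) ((Dy ^^ l) (V 0 0)) z = V k l z" for z
  proof (induction k arbitrary: z)
    case 0 then show ?case using 1 by simp
  next
    case (Suc k)
    then have "Dx ((Dx ^^ k) ((Dy ^^ l) (V 0 0))) z = Dx (V k l) z" by (intro Dx_cong) auto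
    then show ?case using deriv_array_Dx(1)[OF V, of k l z] Suc.prems by simp
  qed
  then show ?thesis using kl z by (simp add: D_classical_def)
qed

lemma C_Lam_vd:
  assumes "f \<in> C_Lam (Suc k)" "x \<in> {-1..1}" "y \<in> {-1..1}"
  shows "((\<lambda>t. f (t, y)) has_vector_derivative Dx f (x, y)) (at x within {-1..1})"
    "((\<lambda>t. f (x, t)) has_vector_derivative Dy f (x, y)) (at y within {-1..1})"
  using assms by (auto simp: Dx_def Dy_def vector_derivative_works[symmetric])

text \<open>\<open>C_Lam\<close> does not ask that mixed derivatives commute. Write f(x, t) as f(x,
  -1) plus the integral of its y-derivative, differentiate under the integral in x, and then
  differentiate the resulting integral in t.\<close>

lemma schwarz:
  assumes f: "f \<in> C_Lam 2" and z: "z \<in> Lam"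
  shows "Dy (Dx f) z = Dx (Dy f) z"
proof -
  have f2: "f \<in> C_Lam (Suc (Suc 0))" using f by (simp add: numeral_2_eq_2)
  then have Dyf: "Dy f \<in> C_Lam (Suc 0)" and cont: "continuous_on Lam (Dx (Dy f))" "continuous_on Lam (Dy f)"
    by auto
  obtain x y where xy: "z = (x, y)" "x \<in> {-1..1}" "y \<in> {-1..1}" using z by (cases z) (auto simp: Lam_iff)
  have eq: "f (x, t) = f (x, -1) + integral {-1..t} (\<lambda>s. Dy f (x, s))" if "x \<in> {-1..1}" "t \<in> {-1..1}" for x t
  proof -
    have "((\<lambda>s. Dy f (x, s)) has_integral f (x, t) - f (x, -1)) {-1..t}"
    proof (rule fundamental_theorem_of_calculus)
      show "-1 \<le> t" using that by simp
      show "((\<lambda>t. f (x, t)) has_vector_derivative Dy f (x, s)) (at s within {-1..t})" if "s \<in> {-1..t}" for s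
        using C_Lam_vd(2)[OF f2] that \<open>x \<in> {-1..1}\<close> \<open>t \<in> {-1..1}\<close>
        by (intro has_vector_derivative_within_subset[where S = "{-1..1}" and T = "{-1..t}"]) auto
    qed
    from integral_unique[OF this] show ?thesis by simp
  qed
  have Dxeq: "Dx f (x, t) = Dx f (x, -1) + integral {-1..t} (\<lambda>s. Dx (Dy f) (x, s))" if "t \<in> {-1..1}" for t
  proof -
    have "((\<lambda>x. integral (cbox (-1) t) (\<lambda>s. Dy f (x, s))) has_vector_derivative
        integral (cbox (-1) t) (\<lambda>s. Dx (Dy f) (x, s))) (at x within {-1..1})"
    proof (rule leibniz_rule_vector_derivative)
      show "((\<lambda>x. Dy f (x, s)) has_vector_derivative Dx (Dy f) (x, s)) (at x within {-1..1})"
        if "x \<in> {-1..1}" "s \<in> cbox (-1) t" for x s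
        using C_Lam_vd(1)[OF Dyf] that \<open>t \<in> {-1..1}\<close> by auto
      show "(\<lambda>s. Dy f (x, s)) integrable_on cbox (-1) t" if "x \<in> {-1..1}" for x
        using continuous_Lam_section(2)[OF cont(2) that] \<open>t \<in> {-1..1}\<close>
        by (auto simp: cbox_interval intro!: integrable_continuous_real intro: continuous_on_subset)
      show "continuous_on ({-1..1} \<times> cbox (-1) t) (\<lambda>(x, s). Dx (Dy f) (x, s))"
        using \<open>t \<in> {-1..1}\<close> by (auto simp: case_prod_beta' Lam_def intro: continuous_on_subset[OF cont(1)])
      show "x \<in> {-1..1}" by fact
    qed auto
    then have "((\<lambda>x. f (x, -1) + integral {-1..t} (\<lambda>s. Dy f (x, s))) has_vector_derivative
        Dx f (x, -1) + integral {-1..t} (\<lambda>s. Dx (Dy f) (x, s))) (at x within {-1..1})"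
      using C_Lam_vd(1)[OF f2 xy(2), of "-1"] by (intro has_vector_derivative_add) (auto simp: cbox_interval)
    then have "((\<lambda>x. f (x, t)) has_vector_derivative
        Dx f (x, -1) + integral {-1..t} (\<lambda>s. Dx (Dy f) (x, s))) (at x within {-1..1})"
      by (rule has_vector_derivative_transform[OF xy(2), rotated]) (rule eq[OF _ that])
    then show ?thesis using xy by (intro Dx_eqI)
  qed
  have "((\<lambda>t. integral {-1..t} (\<lambda>s. Dx (Dy f) (x, s))) has_vector_derivative Dx (Dy f) (x, y)) (at y within {-1..1})"
    by (rule integral_has_vector_derivative[OF continuous_Lam_section(2)[OF cont(1) xy(2)] xy(3)])
  then have "((\<lambda>t. Dx f (x, -1) + integral {-1..t} (\<lambda>s. Dx (Dy f) (x, s))) has_vector_derivative Dx (Dy f) (x, y)) (at y within {-1..1})"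
    using has_vector_derivative_add[OF has_vector_derivative_const] by force
  then have "((\<lambda>t. Dx f (x, t)) has_vector_derivative Dx (Dy f) (x, y)) (at y within {-1..1})"
    by (rule has_vector_derivative_transform[OF xy(3), rotated]) (rule Dxeq)
  then show ?thesis using xy by (simp add: Dy_eqI)
qed

definition smooth_Lam :: "(real \<times> real \<Rightarrow> real) \<Rightarrow> bool" where "smooth_Lam f \<longleftrightarrow> (\<forall>k. f \<in> C_Lam k)"

lemma smooth_Lam_D: assumes "smooth_Lam f" shows "smooth_Lam (Dx f)" "smooth_Lam (Dy f)"
proof -
  have "f \<in> C_Lam (Suc k)" for k using assms unfolding smooth_Lam_def by blast
  then show "smooth_Lam (Dx f)" "smooth_Lam (Dy f)" by (simp_all add: smooth_Lam_def)
qed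

lemma smooth_Lam_pow: "smooth_Lam f \<Longrightarrow> smooth_Lam ((Dx ^^ k) f)" "smooth_Lam f \<Longrightarrow> smooth_Lam ((Dy ^^ k) f)"
  by (induction k) (auto intro: smooth_Lam_D)

lemma smooth_Lam_commute:
  assumes "smooth_Lam f" "z \<in> Lam" shows "Dy ((Dx ^^ k) f) z = (Dx ^^ k) (Dy f) z"
  using assms(2)
proof (induction k arbitrary: z)
  case (Suc k)
  have "Dy (Dx ((Dx ^^ k) f)) z = Dx (Dy ((Dx ^^ k) f)) z"
    using smooth_Lam_pow(1)[OF assms(1)] Suc.prems by (intro schwarz) (auto simp: smooth_Lam_def)
  also have "\<dots> = Dx ((Dx ^^ k) (Dy f)) z" using Suc by (intro Dx_cong)
  finally show ?case by simp
qed simp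

text \<open>\<open>D_classical\<close> takes the y-derivatives first, so raising k is immediate,
  while raising l has to move a y-derivative past k derivatives in x.\<close>

lemma smooth_Lam_deriv_array: assumes "smooth_Lam f" shows "deriv_array n (\<lambda>k l. D_classical (k, l) f)"
  unfolding deriv_array_def
proof (intro conjI allI impI ballI)
  have C: "smooth_Lam (D_classical (k, l) f)" for k l using assms by (simp add: D_classical_def smooth_Lam_pow)
  then have C': "D_classical (k, l) f \<in> C_Lam m" for k l m by (simp add: smooth_Lam_def)
  fix k l
  show "continuous_on Lam (D_classical (k, l) f)" using C'[of k l 0] by simp
  fix x y :: real assume xy: "x \<in> {-1..1}" "y \<in> {-1..1}"
  show "((\<lambda>t. D_classical (k, l) f (t, y)) has_vector_derivative D_classical (Suc k, l) f (x, y)) (at x within {-1..1})"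
    using C_Lam_vd(1)[OF C'[of k l "Suc 0"] xy] by (simp add: D_classical_def)
  have "Dy (D_classical (k, l) f) (x, y) = D_classical (k, Suc l) f (x, y)"
    unfolding D_classical_def using xy
    by (simp add: smooth_Lam_commute[OF smooth_Lam_pow(2)[OF assms]] Lam_iff)
  then show "((\<lambda>t. D_classical (k, l) f (x, t)) has_vector_derivative D_classical (k, Suc l) f (x, y)) (at y within {-1..1})"
    using C_Lam_vd(2)[OF C'[of k l "Suc 0"] xy] by simp
qed

lemma deriv_array_shift: assumes "\<And>n. deriv_array n V" shows "deriv_array n (\<lambda>k l. V (k + a) (l + b))"
  using assms[of "n + a + b"] unfolding deriv_array_def by simp

lemma D_classical_add:
  assumes "smooth_Lam f" "z \<in> Lam"
  shows "D_classical (k, l) (D_classical (a, b) f) z = D_classical (k + a, l + b) f z"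
  using deriv_array_D_classical[OF deriv_array_shift[OF smooth_Lam_deriv_array[OF assms(1)], of "k + l" a b] order_refl assms(2)] by simp

section \<open>Weak derivatives and continuous representatives\<close>

lemma bump_deriv_array:
  assumes a: "bump a" and b: "bump b"
  shows "deriv_array n (\<lambda>k l z. tens ((deriv ^^ k) a) ((deriv ^^ l) b) z)"
proof -
  have d: "((deriv ^^ k) c has_vector_derivative (deriv ^^ Suc k) c x) (at x within S)" if "bump c" for k c x S
    using bump_DERIV[OF bump_funpow_deriv[OF that, of k], of x]
    by (simp add: has_real_derivative_iff_has_vector_derivative has_vector_derivative_at_within)
  have cont: "continuous_on S ((deriv ^^ k) c)" if "bump c" for k c S
    using bump_continuous[OF bump_funpow_deriv[OF that]] continuous_on_subset by blast
  show ?thesis unfolding deriv_array_def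
  proof (intro conjI allI impI ballI)
    show "continuous_on Lam (\<lambda>z. tens ((deriv ^^ k) a) ((deriv ^^ l) b) z)" for k l
      by (intro continuous_intros continuous_on_compose2[OF cont[OF a, of UNIV]] continuous_on_compose2[OF cont[OF b, of UNIV]]) auto
  next
    fix k l and x y :: real
    show "((\<lambda>t. (deriv ^^ k) a (fst (t, y)) * (deriv ^^ l) b (snd (t, y))) has_vector_derivative
        (deriv ^^ Suc k) a (fst (x, y)) * (deriv ^^ l) b (snd (x, y))) (at x within {-1..1})"
      unfolding fst_conv snd_conv by (rule has_vector_derivative_mult_left[OF d[OF a]])
    show "((\<lambda>t. (deriv ^^ k) a (fst (x, t)) * (deriv ^^ l) b (snd (x, t))) has_vector_derivative
        (deriv ^^ k) a (fst (x, y)) * (deriv ^^ Suc l) b (snd (x, y))) (at y within {-1..1})"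
      unfolding fst_conv snd_conv by (rule has_vector_derivative_mult_right[OF d[OF b]])
  qed
qed

section \<open>Test functions and their derivatives\<close>

lemma test_fun_smooth_Lam: "test_fun \<phi> \<Longrightarrow> smooth_Lam \<phi>"
  by (simp add: test_fun_def smooth_Lam_def)

lemma interior_Lam: "interior Lam = {-1<..<1} \<times> {-1<..<1}"
  unfolding Lam_def by (simp add: interior_Times)

text \<open>Connects the two notions of testing: what is known for every \<open>test_fun\<close>
  holds for products of bumps, and these are all that the fundamental lemma uses.\<close>

lemma bump_tensor_test:
  assumes a: "bump a" and b: "bump b"
  shows "test_fun (tens a b)" (is ?T)
    and "z \<in> Lam \<Longrightarrow> D_classical (k, l) (tens a b) z = tens ((deriv ^^ k) a) ((deriv ^^ l) b) z"
proof -
  obtain c where c: "c < 1" "\<And>x. \<bar>x\<bar> > c \<Longrightarrow> a x = 0" using a by (auto simp: bump_def)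
  obtain d where d: "d < 1" "\<And>x. \<bar>x\<bar> > d \<Longrightarrow> b x = 0" using b by (auto simp: bump_def)
  define e where "e = max c d"
  have "compact ({-e..e} \<times> {-e..e})" by (intro compact_Times) auto
  moreover have "{-e..e} \<times> {-e..e} \<subseteq> interior Lam" using c d by (auto simp: e_def interior_Lam)
  moreover have "a (fst z) * b (snd z) = 0" if "z \<notin> {-e..e} \<times> {-e..e}" for z
  proof -
    have "\<bar>fst z\<bar> > e \<or> \<bar>snd z\<bar> > e" using that by (cases z) auto
    then show ?thesis using c d by (auto simp: e_def)
  qed
  moreover have "(tens a b) \<in> C_Lam m" for m
    using deriv_array_C_Lam[OF bump_deriv_array[OF a b], of 0 0 m m] by simp
  ultimately show ?T unfolding test_fun_def by blast
  show "z \<in> Lam \<Longrightarrow> D_classical (k, l) (tens a b) z = tens ((deriv ^^ k) a) ((deriv ^^ l) b) z"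
    using deriv_array_D_classical[OF bump_deriv_array[OF a b, of "k + l"], of k l z] by simp
qed

text \<open>A point of \<open>Lam - K\<close> has a neighbourhood free of the closed set K, and
  there the function is 0 along both coordinate directions. So the same K serves for all
  derivatives.\<close>

lemma zero_outside_D:
  assumes K: "closed K" and z0: "\<forall>z\<in>Lam - K. \<phi> z = 0"
  shows "\<forall>z\<in>Lam - K. Dx \<phi> z = 0" "\<forall>z\<in>Lam - K. Dy \<phi> z = 0"
proof -
  have "Dx \<phi> (x, y) = 0 \<and> Dy \<phi> (x, y) = 0" if xy: "(x, y) \<in> Lam - K" for x y
  proof -
    have "open (- K)" "(x, y) \<in> - K" using K xy by auto
    then obtain e where e: "e > 0" "ball (x, y) e \<subseteq> - K" by (meson openE)
    have I: "x \<in> {-1..1}" "y \<in> {-1..1}" using xy by (auto simp: Lam_iff)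
    have "((\<lambda>t. \<phi> (t, y)) has_vector_derivative 0) (at x within {-1..1})"
    proof (rule has_vector_derivative_transform_within[OF _ e(1) I(1)])
      show "((\<lambda>t. 0) has_vector_derivative 0) (at x within {-1..1})" by simp
      show "0 = \<phi> (t, y)" if "t \<in> {-1..1}" "dist t x < e" for t
      proof -
        have "(t, y) \<in> ball (x, y) e" using that by (simp add: dist_Pair_Pair dist_commute)
        then have "(t, y) \<in> Lam - K" using e(2) that I by (auto simp: Lam_iff)
        then show ?thesis using z0 by simp
      qed
    qed
    moreover have "((\<lambda>t. \<phi> (x, t)) has_vector_derivative 0) (at y within {-1..1})"
    proof (rule has_vector_derivative_transform_within[OF _ e(1) I(2)])
      show "((\<lambda>t. 0) has_vector_derivative 0) (at y within {-1..1})" by simp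
      show "0 = \<phi> (x, t)" if "t \<in> {-1..1}" "dist t y < e" for t
      proof -
        have "(x, t) \<in> ball (x, y) e" using that by (simp add: dist_Pair_Pair dist_commute)
        then have "(x, t) \<in> Lam - K" using e(2) that I by (auto simp: Lam_iff)
        then show ?thesis using z0 by simp
      qed
    qed
    ultimately show ?thesis using I by (simp add: Dx_eqI Dy_eqI)
  qed
  then show "\<forall>z\<in>Lam - K. Dx \<phi> z = 0" "\<forall>z\<in>Lam - K. Dy \<phi> z = 0" by auto
qed

lemma test_fun_D: assumes "test_fun \<phi>" shows "test_fun (Dx \<phi>)" "test_fun (Dy \<phi>)"
proof -
  obtain K where K: "compact K" "K \<subseteq> interior Lam" "\<forall>z\<in>Lam - K. \<phi> z = 0"
    using assms by (auto simp: test_fun_def)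
  note Z = zero_outside_D[OF compact_imp_closed[OF K(1)] K(3)]
  show "test_fun (Dx \<phi>)" "test_fun (Dy \<phi>)"
    using smooth_Lam_D[OF test_fun_smooth_Lam[OF assms]] K Z unfolding test_fun_def smooth_Lam_def by blast+
qed

lemma test_fun_D_classical: assumes "test_fun \<phi>" shows "test_fun (D_classical \<alpha> \<phi>)"
proof -
  have 1: "test_fun ((Dy ^^ l) \<phi>)" for l using assms by (induction l) (auto intro: test_fun_D)
  have "test_fun ((Dx ^^ k) ((Dy ^^ l) \<phi>))" for k l using 1 by (induction k) (auto intro: test_fun_D)
  then show ?thesis by (simp add: D_classical_def)
qed

lemma test_fun_continuous: "test_fun \<phi> \<Longrightarrow> continuous_on Lam \<phi>"
  unfolding test_fun_def using C_Lam.simps(1) by blast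

lemma test_fun_boundary:
  assumes "test_fun \<phi>" "(x, y) \<in> Lam" "\<bar>x\<bar> = 1 \<or> \<bar>y\<bar> = 1" shows "\<phi> (x, y) = 0"
proof -
  obtain K where K: "K \<subseteq> interior Lam" "\<forall>z\<in>Lam - K. \<phi> z = 0"
    using assms(1) by (auto simp: test_fun_def)
  have "(x, y) \<notin> interior Lam" using assms(3) by (auto simp: interior_Lam)
  then show ?thesis using K assms(2) by blast
qed

section \<open>Borel versions and uniqueness of weak derivatives\<close>

lemma L2_version:
  assumes "w \<in> L2_Lam"
  obtains g where "g \<in> borel_measurable SM" "AE z in SM. w z = g z" "integrable SM g"
    "integrable SM (\<lambda>z. (g z)\<^sup>2)" "L2_norm_Lam w = sqrt (LINT z|SM. (g z)\<^sup>2)"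
proof -
  have w: "w \<in> borel_measurable (lebesgue_on Lam)" "integrable (lebesgue_on Lam) (\<lambda>z. (w z)\<^sup>2)"
    using assms by (auto simp: L2_Lam_def)
  obtain g where g[measurable]: "g \<in> borel_measurable SM" and ae: "AE z in SM. w z = g z"
    by (rule ex_SM_measurable[OF w(1)])
  have w2: "(\<lambda>z. (w z)\<^sup>2) \<in> borel_measurable (lebesgue_on Lam)" using w(2) by auto
  have g2: "(\<lambda>z. (g z)\<^sup>2) \<in> borel_measurable SM" by measurable
  have ae2: "AE z in SM. (w z)\<^sup>2 = (g z)\<^sup>2" using ae by eventually_elim simp
  note T = integral_lebesgue_SM_AE[OF w2 g2 ae2]
  have gi2: "integrable SM (\<lambda>z. (g z)\<^sup>2)" using T(2) w(2) by simp
  have "integrable SM g"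
  proof (rule Bochner_Integration.integrable_bound)
    show "integrable SM (\<lambda>z. 1 + (g z)\<^sup>2)" using gi2 by auto
    show "AE z in SM. norm (g z) \<le> norm (1 + (g z)\<^sup>2)"
    proof (rule AE_I2)
      fix z show "norm (g z) \<le> norm (1 + (g z)\<^sup>2)"
      proof -
        have "2 * \<bar>g z\<bar> \<le> 1 + (g z)\<^sup>2" using sum_squares_bound[of 1 "\<bar>g z\<bar>"] by simp
        then have "\<bar>g z\<bar> \<le> 1 + (g z)\<^sup>2" using abs_ge_zero[of "g z"] by linarith
        then show ?thesis by simp
      qed
    qed
  qed (rule g)
  moreover have "L2_norm_Lam w = sqrt (LINT z|SM. (g z)\<^sup>2)" using T(1) by (simp add: L2_norm_Lam_def)
  ultimately show ?thesis using that g ae gi2 by blast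
qed

lemma weak_integral:
  fixes w g \<phi> :: "real \<times> real \<Rightarrow> real"
  assumes "w \<in> borel_measurable (lebesgue_on Lam)" "g \<in> borel_measurable SM" "AE z in SM. w z = g z" "continuous_on Lam \<phi>"
  shows "(LINT z|lebesgue_on Lam. w z * \<phi> z) = (LINT z|SM. g z * \<phi> z)"
proof (rule integral_lebesgue_SM_AE(1))
  have "\<phi> \<in> borel_measurable SM" by (rule continuous_Lam_measurable[OF assms(4)])
  then show "(\<lambda>z. w z * \<phi> z) \<in> borel_measurable (lebesgue_on Lam)" "(\<lambda>z. g z * \<phi> z) \<in> borel_measurable SM"
    by (intro borel_measurable_times assms(1,2) SM_measurable_lebesgue; assumption)+
  show "AE z in SM. w z * \<phi> z = g z * \<phi> z" using assms(3) by eventually_elim simp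
qed

lemma L2_measurable: "w \<in> L2_Lam \<Longrightarrow> w \<in> borel_measurable (lebesgue_on Lam)"
  by (simp add: L2_Lam_def)

lemma weak_deriv_unique:
  assumes w: "w \<in> L2_Lam" "w' \<in> L2_Lam" and d: "has_weak_deriv \<alpha> u w" "has_weak_deriv \<alpha> u w'"
  shows "AE z in SM. w z = w' z"
proof -
  obtain g where g: "g \<in> borel_measurable SM" "AE z in SM. w z = g z" "integrable SM g" using L2_version[OF w(1)] by metis
  obtain g' where g': "g' \<in> borel_measurable SM" "AE z in SM. w' z = g' z" "integrable SM g'" using L2_version[OF w(2)] by metis
  have "AE z in SM. g z - g' z = 0"
  proof (rule fundamental_lemma)
    show "integrable SM (\<lambda>z. g z - g' z)" using g g' by auto
    fix a b assume a: "bump a" and b: "bump b"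
    let ?p = "\<lambda>z. tens a b z"
    note t = bump_tensor_test(1)[OF a b]
    have "(-1) ^ mi_order \<alpha> * (LINT z|lebesgue_on Lam. w z * ?p z) = (-1) ^ mi_order \<alpha> * (LINT z|lebesgue_on Lam. w' z * ?p z)"
      using d(1)[unfolded has_weak_deriv_def, rule_format, OF t] d(2)[unfolded has_weak_deriv_def, rule_format, OF t]
      by (rule trans[OF sym])
    then have "(LINT z|lebesgue_on Lam. w z * ?p z) = (LINT z|lebesgue_on Lam. w' z * ?p z)" by simp
    then have "(LINT z|SM. g z * ?p z) = (LINT z|SM. g' z * ?p z)"
      using weak_integral[OF L2_measurable[OF w(1)] g(1,2) test_fun_continuous[OF t]]
        weak_integral[OF L2_measurable[OF w(2)] g'(1,2) test_fun_continuous[OF t]] by simp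
    then show "(LINT z|SM. (g z - g' z) * tens a b z) = 0"
      using integrable_bump_tensor[OF g(3) a b] integrable_bump_tensor[OF g'(3) a b]
      by (simp add: left_diff_distrib Bochner_Integration.integral_diff)
  qed
  with g(2) g'(2) show ?thesis by eventually_elim simp
qed

lemma D_weak_I:
  assumes "w \<in> L2_Lam" "has_weak_deriv \<alpha> u w"
  shows "D_weak \<alpha> u \<in> L2_Lam" "has_weak_deriv \<alpha> u (D_weak \<alpha> u)" "AE z in SM. D_weak \<alpha> u z = w z"
proof -
  have "\<exists>w. w \<in> L2_Lam \<and> has_weak_deriv \<alpha> u w" using assms by blast
  from someI_ex[OF this] show *: "D_weak \<alpha> u \<in> L2_Lam" "has_weak_deriv \<alpha> u (D_weak \<alpha> u)"
    unfolding D_weak_def by auto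
  show "AE z in SM. D_weak \<alpha> u z = w z" by (rule weak_deriv_unique[OF *(1) assms(1) *(2) assms(2)])
qed

lemma D_weak_H:
  assumes "u \<in> H_Lam n" "mi_order \<alpha> \<le> n"
  shows "D_weak \<alpha> u \<in> L2_Lam" "has_weak_deriv \<alpha> u (D_weak \<alpha> u)"
proof -
  obtain w where "w \<in> L2_Lam" "has_weak_deriv \<alpha> u w" using assms unfolding H_Lam_def by blast
  then show "D_weak \<alpha> u \<in> L2_Lam" "has_weak_deriv \<alpha> u (D_weak \<alpha> u)" using D_weak_I by blast+
qed

text \<open>The right-hand side of the estimate differentiates a chosen representative of a weak
  derivative once more. Testing with \<open>D_classical (k, l) \<phi>\<close>, again a test
  function, shifts the index, and the signs multiply to (-1)^(k+l).\<close>

lemma D_weak_compose: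
  assumes u: "u \<in> H_Lam n" and n: "k + l + a + b \<le> n"
  shows "D_weak (k, l) (D_weak (a, b) u) \<in> L2_Lam"
    "AE z in SM. D_weak (k, l) (D_weak (a, b) u) z = D_weak (k + a, l + b) u z"
proof -
  note wd = D_weak_H[OF u, of "(a, b)"] D_weak_H[OF u, of "(k + a, l + b)"]
  have "has_weak_deriv (k, l) (D_weak (a, b) u) (D_weak (k + a, l + b) u)"
    unfolding has_weak_deriv_def
  proof (intro allI impI)
    fix \<phi> assume t: "test_fun \<phi>"
    have "(LINT z|lebesgue_on Lam. u z * D_classical (a, b) (D_classical (k, l) \<phi>) z)
        = (LINT z|lebesgue_on Lam. u z * D_classical (k + a, l + b) \<phi> z)"
      using D_classical_add[OF test_fun_smooth_Lam[OF t], of _ a b k l]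
      by (intro Bochner_Integration.integral_cong) (auto simp: add.commute)
    then have "(-1) ^ (a + b) * (LINT z|lebesgue_on Lam. D_weak (a, b) u z * D_classical (k, l) \<phi> z)
       = (-1) ^ (k + a + (l + b)) * (LINT z|lebesgue_on Lam. D_weak (k + a, l + b) u z * \<phi> z)"
      using wd n t test_fun_D_classical[OF t, of "(k, l)"]
      by (simp add: has_weak_deriv_def mi_order_def)
    then have "(-1) ^ (a + b) * ((-1) ^ (a + b) * (LINT z|lebesgue_on Lam. D_weak (a, b) u z * D_classical (k, l) \<phi> z))
       = (-1) ^ (a + b) * ((-1) ^ (k + a + (l + b)) * (LINT z|lebesgue_on Lam. D_weak (k + a, l + b) u z * \<phi> z))"
      by simp
    moreover have "(-1) ^ (a + b) * ((-1) ^ (k + a + (l + b)) * X) = (-1) ^ (k + l) * X" for X :: real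
      by (cases "even a"; cases "even b"; cases "even k"; cases "even l") (simp_all add: minus_one_power_iff)
    moreover have "(-1) ^ (a + b) * ((-1) ^ (a + b) * X) = X" for X :: real
      by (simp add: minus_one_power_iff)
    ultimately show "(LINT z|lebesgue_on Lam. D_weak (a, b) u z * D_classical (k, l) \<phi> z)
      = (-1) ^ mi_order (k, l) * (LINT z|lebesgue_on Lam. D_weak (k + a, l + b) u z * \<phi> z)"
      by (simp add: mi_order_def)
  qed
  from D_weak_I[OF _ this] wd n show "D_weak (k, l) (D_weak (a, b) u) \<in> L2_Lam"
    "AE z in SM. D_weak (k, l) (D_weak (a, b) u) z = D_weak (k + a, l + b) u z"
    by (auto simp: mi_order_def)
qed

lemma weak_deriv_0:
  assumes "u \<in> L2_Lam" shows "has_weak_deriv (0, 0) u u"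
  by (simp add: has_weak_deriv_def D_classical_def mi_order_def)

text \<open>Borel versions of the weak derivatives of u, tied to each other only by first-order
  relations, the form in which the integral representations consume them.\<close>

definition weak_array_of :: "(real \<times> real \<Rightarrow> real) \<Rightarrow> (nat \<Rightarrow> nat \<Rightarrow> real \<times> real \<Rightarrow> real) \<Rightarrow> bool" where
  "weak_array_of u g \<longleftrightarrow> (\<forall>k l. k + l \<le> 4 \<longrightarrow> integrable SM (g k l) \<and> integrable SM (\<lambda>z. (g k l z)\<^sup>2)
      \<and> (AE z in SM. D_weak (k, l) u z = g k l z))
    \<and> (AE z in SM. u z = g 0 0 z)
    \<and> (\<forall>k l. k + l < 4 \<longrightarrow> wdx (g k l) (g (Suc k) l) \<and> wdy (g k l) (g k (Suc l)))"

lemma H4_weak_array_of: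
  assumes u: "u \<in> H_Lam 4" obtains g where "weak_array_of u g"
proof -
  let ?P = "\<lambda>k l g. g \<in> borel_measurable SM \<and> (AE z in SM. D_weak (k, l) u z = g z) \<and> integrable SM g
      \<and> integrable SM (\<lambda>z. (g z)\<^sup>2)"
  have ex: "\<exists>g. ?P k l g" if "k + l \<le> 4" for k l
  proof -
    have "D_weak (k, l) u \<in> L2_Lam" using that by (intro D_weak_H(1)[OF u]) (simp add: mi_order_def)
    from L2_version[OF this] show ?thesis by blast
  qed
  define g where "g k l = (SOME g. ?P k l g)" for k l
  have P: "?P k l (g k l)" if "k + l \<le> 4" for k l
    unfolding g_def by (rule someI_ex[OF ex[OF that]])
  have g: "\<And>k l. k + l \<le> 4 \<Longrightarrow> g k l \<in> borel_measurable SM"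
      "\<And>k l. k + l \<le> 4 \<Longrightarrow> AE z in SM. D_weak (k, l) u z = g k l z"
      "\<And>k l. k + l \<le> 4 \<Longrightarrow> integrable SM (g k l)"
      "\<And>k l. k + l \<le> 4 \<Longrightarrow> integrable SM (\<lambda>z. (g k l z)\<^sup>2)"
    using P by blast+
  have uL: "u \<in> L2_Lam" using u by (simp add: H_Lam_def)
  \<comment> \<open>Both sides of each first-order relation reduce to \<open>u\<close> tested with
    the same derivatives of bumps; passing from a factor to its derivative raises its index by one
    and accounts for the sign.\<close>
  have eq: "tint (g k l) a b
      = (-1) ^ (k + l) * (LINT z|lebesgue_on Lam. u z * tens ((deriv ^^ k) a) ((deriv ^^ l) b) z)"
    if kl: "k + l \<le> 4" and a: "bump a" and b: "bump b" for k l a b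
  proof -
    note t = bump_tensor_test[OF a b]
    have "tint (g k l) a b = (LINT z|lebesgue_on Lam. D_weak (k, l) u z * tens a b z)"
      using kl D_weak_H(1)[OF u, of "(k, l)"]
      by (intro weak_integral[symmetric] L2_measurable g test_fun_continuous[OF t(1)]) (auto simp: mi_order_def)
    moreover have "(LINT z|lebesgue_on Lam. u z * D_classical (k, l) (tens a b) z)
       = (-1) ^ (k + l) * (LINT z|lebesgue_on Lam. D_weak (k, l) u z * tens a b z)"
      using D_weak_H(2)[OF u, of "(k, l)"] kl t(1) by (simp add: has_weak_deriv_def mi_order_def)
    moreover have "(LINT z|lebesgue_on Lam. u z * D_classical (k, l) (tens a b) z)
       = (LINT z|lebesgue_on Lam. u z * tens ((deriv ^^ k) a) ((deriv ^^ l) b) z)"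
      using t(2) by (intro Bochner_Integration.integral_cong) auto
    moreover have "(-1) ^ (k + l) * ((-1) ^ (k + l) * X) = X" for X :: real
      by (simp add: minus_one_power_iff)
    ultimately show ?thesis by simp
  qed
  have "wdx (g k l) (g (Suc k) l)" if "k + l < 4" for k l
    unfolding wdx_def using that eq bump_deriv by (auto simp: funpow_Suc_right simp del: funpow.simps)
  moreover have "wdy (g k l) (g k (Suc l))" if "k + l < 4" for k l
    unfolding wdy_def using that eq bump_deriv by (auto simp: funpow_Suc_right simp del: funpow.simps)
  moreover have "AE z in SM. u z = g 0 0 z"
    using D_weak_I(3)[OF uL weak_deriv_0[OF uL]] g(2)[of 0 0] by auto
  ultimately have "weak_array_of u g" unfolding weak_array_of_def using g by auto
  then show ?thesis using that by blast
qed

text \<open>Takes one derivative more in each variable, so an array up to order 4 supports the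
  entries with k + l \<le> 2. The integrals define a value at every point, in particular at the
  nodes.\<close>

definition cont_rep :: "(nat \<Rightarrow> nat \<Rightarrow> real \<times> real \<Rightarrow> real) \<Rightarrow> nat \<Rightarrow> nat \<Rightarrow> real \<times> real \<Rightarrow> real" where
  "cont_rep g k l = sobolev_rep (g k l) (g (Suc k) l) (g k (Suc l)) (g (Suc k) (Suc l))"

text \<open>Makes no reference to u, so that the array obtained by subtracting a polynomial
  qualifies as well.\<close>

definition weak_array :: "(nat \<Rightarrow> nat \<Rightarrow> real \<times> real \<Rightarrow> real) \<Rightarrow> bool" where
  "weak_array g \<longleftrightarrow> (\<forall>k l. k + l \<le> 4 \<longrightarrow> integrable SM (g k l))
    \<and> (\<forall>k l. k + l < 4 \<longrightarrow> wdx (g k l) (g (Suc k) l) \<and> wdy (g k l) (g k (Suc l)))"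

lemma cont_rep_AE: "weak_array g \<Longrightarrow> k + l \<le> 2 \<Longrightarrow> AE z in SM. g k l z = cont_rep g k l z"
  unfolding cont_rep_def by (rule sobolev_rep_representation) (auto simp: weak_array_def)

lemma cont_rep_continuous: "weak_array g \<Longrightarrow> k + l \<le> 2 \<Longrightarrow> continuous_on Lam (cont_rep g k l)"
  unfolding cont_rep_def by (rule sobolev_rep_continuous) (auto simp: weak_array_def)

lemma integral_tensor_AE_cong:
  fixes f g :: "real \<times> real \<Rightarrow> real"
  assumes "f \<in> borel_measurable SM" "g \<in> borel_measurable SM" "AE z in SM. f z = g z"
    "a \<in> borel_measurable IM" "b \<in> borel_measurable IM"
  shows "tint f a b = tint g a b"
proof (rule integral_cong_AE)
  note t = tensor_measurable[OF assms(4,5)]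
  show "(\<lambda>z. f z * tens a b z) \<in> borel_measurable SM" "(\<lambda>z. g z * tens a b z) \<in> borel_measurable SM"
    by (intro borel_measurable_times assms t)+
  show "AE z in SM. f z * tens a b z = g z * tens a b z"
    using assms(3) by eventually_elim simp
qed

text \<open>Tests with bumps do not distinguish a function from its continuous version, so the weak
  relations carry over and become classical by \<open>wdx_classical\<close> and
  \<open>wdy_classical\<close>.\<close>

lemma cont_rep_deriv_array: assumes g: "weak_array g" shows "deriv_array 2 (cont_rep g)"
  unfolding deriv_array_def
proof (intro conjI allI impI ballI)
  have gm: "g k l \<in> borel_measurable SM" if "k + l \<le> 4" for k l using g that by (auto simp: weak_array_def)
  have ig: "tint (cont_rep g k l) a b = tint (g k l) a b"
    if "k + l \<le> 2" "bump a" "bump b" for k l a b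
    using that cont_rep_AE[OF g that(1)] gm[of k l] continuous_Lam_measurable[OF cont_rep_continuous[OF g that(1)]]
    by (intro integral_tensor_AE_cong bump_IM) auto
  fix k l :: nat
  show "continuous_on Lam (cont_rep g k l)" if "k + l \<le> 2" by (rule cont_rep_continuous[OF g that])
  fix x y :: real assume kl: "k + l < 2" and xy: "x \<in> {-1..1}" "y \<in> {-1..1}"
  have wx: "wdx (g k l) (g (Suc k) l)" and wy: "wdy (g k l) (g k (Suc l))" using g kl by (auto simp: weak_array_def)
  have "wdx (cont_rep g k l) (cont_rep g (Suc k) l)"
    unfolding wdx_def using wx kl by (auto simp: ig bump_deriv wdx_def)
  then show "((\<lambda>t. cont_rep g k l (t, y)) has_vector_derivative cont_rep g (Suc k) l (x, y)) (at x within {-1..1})"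
    using kl by (intro wdx_classical cont_rep_continuous g xy) auto
  have "wdy (cont_rep g k l) (cont_rep g k (Suc l))"
    unfolding wdy_def using wy kl by (auto simp: ig bump_deriv wdy_def)
  then show "((\<lambda>t. cont_rep g k l (x, t)) has_vector_derivative cont_rep g k (Suc l) (x, y)) (at y within {-1..1})"
    using kl by (intro wdy_classical cont_rep_continuous g xy) auto
qed

text \<open>Continuous functions that are equal almost everywhere agree on \<open>Lam\<close>, so
  the choice made by \<open>C2_rep\<close> has no freedom there. Its derivatives agree too, as
  \<open>Dx\<close> and \<open>Dy\<close> depend only on values on \<open>Lam\<close>.\<close>

lemma C2_rep_eq:
  assumes g: "weak_array g" and u: "AE z in SM. u z = g 0 0 z" and z: "z \<in> Lam"
  shows "C2_rep u z = cont_rep g 0 0 z" "Dx (C2_rep u) z = cont_rep g 1 0 z" "Dy (C2_rep u) z = cont_rep g 0 1 z"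
    "Dy (Dx (C2_rep u)) z = cont_rep g 1 1 z"
proof -
  have V: "cont_rep g 0 0 \<in> C_Lam 2" using deriv_array_C_Lam[OF cont_rep_deriv_array[OF g], of 0 0 2] by simp
  have "AE z in SM. cont_rep g 0 0 z = u z" using u cont_rep_AE[OF g, of 0 0] by auto
  then have "cont_rep g 0 0 \<in> C_Lam 2 \<and> (AE z in lebesgue_on Lam. cont_rep g 0 0 z = u z)"
    using V by (simp add: AE_lebesgue_on_Lam)
  then have "\<exists>v. v \<in> C_Lam 2 \<and> (AE z in lebesgue_on Lam. v z = u z)" by blast
  from someI_ex[OF this] have "C2_rep u \<in> C_Lam 2 \<and> (AE z in lebesgue_on Lam. C2_rep u z = u z)"
    unfolding C2_rep_def .
  then have c: "continuous_on Lam (C2_rep u)" and ae: "AE z in SM. C2_rep u z = u z"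
    by (auto simp: AE_lebesgue_on_Lam numeral_2_eq_2)
  have eq: "C2_rep u z = cont_rep g 0 0 z" if "z \<in> Lam" for z
    using ae u cont_rep_AE[OF g, of 0 0] that by (intro continuous_AE_eq[OF c cont_rep_continuous[OF g]]) auto
  show "C2_rep u z = cont_rep g 0 0 z" by (rule eq[OF z])
  have dx: "Dx (C2_rep u) z = cont_rep g 1 0 z" if "z \<in> Lam" for z
    using Dx_cong[of "C2_rep u" "cont_rep g 0 0", OF eq that] deriv_array_Dx(1)[OF cont_rep_deriv_array[OF g], of 0 0 z] that by simp
  show "Dx (C2_rep u) z = cont_rep g 1 0 z" by (rule dx[OF z])
  show "Dy (C2_rep u) z = cont_rep g 0 1 z"
    using Dy_cong[of "C2_rep u" "cont_rep g 0 0", OF eq z] deriv_array_Dx(2)[OF cont_rep_deriv_array[OF g], of 0 0 z] z by simp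
  show "Dy (Dx (C2_rep u)) z = cont_rep g 1 1 z"
    using Dy_cong[of "Dx (C2_rep u)" "cont_rep g 1 0", OF dx z] deriv_array_Dx(2)[OF cont_rep_deriv_array[OF g], of 1 0 z] z by simp
qed

section \<open>Coefficients of the interpolant\<close>

text \<open>The index k counts derivatives and r numbers the basis functions. At k = 2 the truncated
  square has the step 2 [x > 0], its second derivative off 0 and in the weak sense.\<close>

definition sbasis :: "nat \<Rightarrow> nat \<Rightarrow> real \<Rightarrow> real" where
  "sbasis k r x =
    (if k = 0 then (if r = 0 then 1 else if r = 1 then x + 1 else if r = 2 then (x + 1)\<^sup>2 else (max 0 x)\<^sup>2)
     else if k = 1 then (if r = 0 then 0 else if r = 1 then 1 else if r = 2 then 2 * (x + 1) else 2 * max 0 x)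
     else (if r \<le> 1 then 0 else if r = 2 then 2 else 2 * of_bool (x > 0)))"

text \<open>Coordinates, in the basis \<open>sbasis 0 0, \<dots>, sbasis 0 3\<close>, of the \<open>C\<^sup>1\<close> quadratic spline with values \<open>a, b\<close>
  and derivatives \<open>c, d\<close> at \<open>-1, 1\<close>.\<close>

definition scoeff :: "nat \<Rightarrow> real \<Rightarrow> real \<Rightarrow> real \<Rightarrow> real \<Rightarrow> real" where
  "scoeff r a b c d = (let A = ((d - c) / 2 + (b - a - d - c)) / 2 in
     if r = 0 then a else if r = 1 then c else if r = 2 then A else (d - c) / 2 - 2 * A)"

lemma sum_less_4: "(\<Sum>r<(4::nat). f r) = f 0 + f 1 + f 2 + (f 3 :: real)"
  by (simp add: eval_nat_numeral)

lemma max_square_DERIV: "((\<lambda>x::real. (max 0 x)\<^sup>2) has_real_derivative 2 * max 0 x) (at x)"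
proof -
  consider "x < 0" | "x = 0" | "x > 0" by linarith
  then show ?thesis
  proof cases
    case 1
    have "((\<lambda>x::real. 0) has_real_derivative 0) (at x)" by simp
    then have "((\<lambda>x::real. (max 0 x)\<^sup>2) has_real_derivative 0) (at x)"
      by (rule has_field_derivative_transform_within_open[where S = "{..<0}"]) (use 1 in auto)
    then show ?thesis using 1 by simp
  next
    case 2
    have "((\<lambda>h::real. (max 0 h)\<^sup>2 / h) \<longlongrightarrow> 0) (at 0)"
    proof (rule Lim_null_comparison)
      show "\<forall>\<^sub>F h in at 0. norm ((max 0 h)\<^sup>2 / h) \<le> \<bar>h::real\<bar>"
        by (rule always_eventually) (auto simp: max_def power2_eq_square)
      show "((\<lambda>h::real. \<bar>h\<bar>) \<longlongrightarrow> 0) (at 0)"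
        by (rule tendsto_eq_intros | simp)+
    qed
    then show ?thesis using 2 by (simp add: DERIV_def)
  next
    case 3
    have "((\<lambda>x::real. x\<^sup>2) has_real_derivative 2 * x) (at x)"
      by (auto intro!: derivative_eq_intros)
    then have "((\<lambda>x::real. (max 0 x)\<^sup>2) has_real_derivative 2 * x) (at x)"
      by (rule has_field_derivative_transform_within_open[where S = "{0<..}"]) (use 3 in auto)
    then show ?thesis using 3 by simp
  qed
qed

lemma sbasis_DERIV_0: "(sbasis 0 r has_real_derivative sbasis 1 r x) (at x)"
proof -
  have "((\<lambda>x. (x + 1)\<^sup>2) has_real_derivative 2 * (x + 1)) (at x)" by (auto intro!: derivative_eq_intros)
  then show ?thesis using max_square_DERIV[of x]
    by (auto simp: sbasis_def[abs_def] intro!: derivative_eq_intros)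
qed

lemma sbasis_DERIV_1: assumes "x \<noteq> 0" shows "(sbasis 1 r has_real_derivative sbasis 2 r x) (at x)"
proof -
  have "((\<lambda>x. 2 * max 0 x) has_real_derivative 2 * of_bool (x > 0)) (at x)"
  proof (cases "x > 0")
    case True
    have "((\<lambda>x::real. 2 * x) has_real_derivative 2) (at x)" by (auto intro!: derivative_eq_intros)
    then have "((\<lambda>x. 2 * max 0 x) has_real_derivative 2) (at x)"
      by (rule has_field_derivative_transform_within_open[where S = "{0<..}"]) (use True in auto)
    then show ?thesis using True by simp
  next
    case False
    have "((\<lambda>x::real. 0) has_real_derivative 0) (at x)" by simp
    then have "((\<lambda>x::real. 2 * max 0 x) has_real_derivative 0) (at x)"
      by (rule has_field_derivative_transform_within_open[where S = "{..<0}"]) (use assms False in auto)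
    then show ?thesis using False by simp
  qed
  then show ?thesis
    by (cases "r = 0"; cases "r = 1"; cases "r = 2") (auto simp: sbasis_def[abs_def] intro!: derivative_eq_intros)
qed

lemma sbasis_continuous: "k \<le> 1 \<Longrightarrow> continuous_on S (sbasis k r)"
  by (cases "k = 0"; cases "r = 0"; cases "r = 1"; cases "r = 2")
     (auto simp: sbasis_def[abs_def] intro!: continuous_intros)

lemma sbasis_measurable: "sbasis k r \<in> borel_measurable IM"
proof -
  have [measurable]: "(\<lambda>x. of_bool (0 < x) :: real) \<in> borel_measurable IM" by measurable
  show ?thesis unfolding sbasis_def[abs_def] by measurable
qed

lemma sbasis_bound: assumes "x \<in> {-1..1}" shows "\<bar>sbasis k r x\<bar> \<le> 4"
proof -
  have "(x + 1)\<^sup>2 \<le> 4" "(max 0 x)\<^sup>2 \<le> 1"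
    using assms power_mono[of "x + 1" 2 2] power_mono[of "max 0 x" 1 2] by auto
  then show ?thesis using assms by (auto simp: sbasis_def max_def)
qed

lemma sbasis_zero: "r < k \<Longrightarrow> k \<le> 2 \<Longrightarrow> sbasis k r x = 0"
  by (auto simp: sbasis_def)

definition hermite :: "real \<Rightarrow> real \<Rightarrow> real \<Rightarrow> real \<Rightarrow> nat \<Rightarrow> real \<Rightarrow> real" where
  "hermite a b c d k x = (\<Sum>r<4. scoeff r a b c d * sbasis k r x)"

lemma hermite_DERIV: "(hermite a b c d 0 has_real_derivative hermite a b c d 1 x) (at x)"
  unfolding hermite_def[abs_def] by (intro DERIV_sum DERIV_cmult sbasis_DERIV_0)

lemma hermite_vector_derivative:
  "x \<in> {-1..1} \<Longrightarrow> vector_derivative (hermite a b c d 0) (at x within {-1..1}) = hermite a b c d 1 x"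
  using hermite_DERIV[of a b c d x]
  by (intro vector_derivative_I) (auto simp: has_real_derivative_iff_has_vector_derivative has_vector_derivative_at_within)

lemma hermite_values: "hermite a b c d 0 (-1) = a" "hermite a b c d 0 1 = b" "hermite a b c d 1 (-1) = c" "hermite a b c d 1 1 = d"
  by (simp_all add: hermite_def sum_less_4 scoeff_def sbasis_def Let_def field_simps)

lemma C1_quad_spline_hermite: "C1_quad_spline (hermite a b c d 0)"
  unfolding C1_quad_spline_def
proof (intro conjI)
  show "\<forall>x\<in>{-1..1}. hermite a b c d 0 differentiable (at x within {-1..1})"
    using hermite_DERIV real_differentiable_def differentiable_at_withinI by blast
  have "continuous_on {-1..1} (hermite a b c d 1)" unfolding hermite_def[abs_def]
    by (intro continuous_intros sbasis_continuous) auto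
  then show "continuous_on {-1..1} (\<lambda>x. vector_derivative (hermite a b c d 0) (at x within {-1..1}))"
    by (rule continuous_on_eq) (simp add: hermite_vector_derivative)
  let ?l = "\<lambda>r. scoeff r a b c d"
  show "\<exists>p. degree p \<le> 2 \<and> (\<forall>x\<in>{-1..0}. hermite a b c d 0 x = poly p x)"
    by (intro exI[of _ "[:?l 0 + ?l 1 + ?l 2, ?l 1 + 2 * ?l 2, ?l 2:]"])
       (auto simp: hermite_def sum_less_4 sbasis_def algebra_simps power2_eq_square)
  show "\<exists>p. degree p \<le> 2 \<and> (\<forall>x\<in>{0..1}. hermite a b c d 0 x = poly p x)"
    by (intro exI[of _ "[:?l 0 + ?l 1 + ?l 2, ?l 1 + 2 * ?l 2, ?l 2 + ?l 3:]"])
       (auto simp: hermite_def sum_less_4 sbasis_def algebra_simps power2_eq_square)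
qed

text \<open>The nodal basis is given by choice; uniqueness of the spline with prescribed end values
  and slopes replaces it by explicit formulas with unit data.\<close>

lemma hat_eq:
  assumes x: "x \<in> {-1..1}"
  shows "phi_hat (-1) x = hermite 1 0 0 0 0 x" "phi_hat 1 x = hermite 0 1 0 0 0 x"
    "psi_hat (-1) x = hermite 0 0 1 0 0 x" "psi_hat 1 x = hermite 0 0 0 1 0 x"
proof -
  note u = C1_quad_spline_unique[OF _ C1_quad_spline_hermite _ _ _ _ x]
  show "phi_hat (-1) x = hermite 1 0 0 0 0 x" "phi_hat 1 x = hermite 0 1 0 0 0 x"
    by (rule u; use phi_hat_spec[of "-1"] phi_hat_spec[of 1] in \<open>simp add: hermite_values hermite_vector_derivative del: One_nat_def\<close>)+
  show "psi_hat (-1) x = hermite 0 0 1 0 0 x" "psi_hat 1 x = hermite 0 0 0 1 0 x"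
    by (rule u; use psi_hat_spec[of "-1"] psi_hat_spec[of 1] in \<open>simp add: hermite_values hermite_vector_derivative del: One_nat_def\<close>)+
qed

lemma hermite_linear:
  "a * hermite 1 0 0 0 k x + b * hermite 0 1 0 0 k x + c * hermite 0 0 1 0 k x + d * hermite 0 0 0 1 k x = hermite a b c d k x"
  by (simp add: hermite_def sum_less_4 scoeff_def Let_def field_simps)

section \<open>Tensor-product form of the interpolant\<close>

definition ycoeff :: "(nat \<Rightarrow> nat \<Rightarrow> real \<times> real \<Rightarrow> real) \<Rightarrow> nat \<Rightarrow> nat \<Rightarrow> real \<Rightarrow> real" where
  "ycoeff V s k x = scoeff s (V k 0 (x, -1)) (V k 0 (x, 1)) (V k 1 (x, -1)) (V k 1 (x, 1))"

text \<open>Interpolation in y along a line of constant x gives the four numbers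
  \<open>ycoeff V s 0 x\<close>. As functions of x they are interpolated again; their x-derivatives
  at the ends come from the row k = 1 of V.\<close>

definition tcoeff :: "(nat \<Rightarrow> nat \<Rightarrow> real \<times> real \<Rightarrow> real) \<Rightarrow> nat \<Rightarrow> nat \<Rightarrow> real" where
  "tcoeff V r s = scoeff r (ycoeff V s 0 (-1)) (ycoeff V s 0 1) (ycoeff V s 1 (-1)) (ycoeff V s 1 1)"

definition interpolant :: "(nat \<Rightarrow> nat \<Rightarrow> real \<times> real \<Rightarrow> real) \<Rightarrow> nat \<Rightarrow> nat \<Rightarrow> real \<times> real \<Rightarrow> real" where
  "interpolant V k l z = (\<Sum>r<4. \<Sum>s<4. tcoeff V r s * tens (sbasis k r) (sbasis l s) z)"

lemma scoeff_sum:
  "scoeff r (\<Sum>s\<in>S. a s * w s) (\<Sum>s\<in>S. b s * w s) (\<Sum>s\<in>S. c s * w s) (\<Sum>s\<in>S. d s * w s)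
    = (\<Sum>s\<in>S. scoeff r (a s) (b s) (c s) (d s) * w s)"
proof -
  have lin: "scoeff r a b c d = scoeff r 1 0 0 0 * a + scoeff r 0 1 0 0 * b + scoeff r 0 0 1 0 * c + scoeff r 0 0 0 1 * d" for a b c d
    by (simp add: scoeff_def Let_def field_simps)
  show ?thesis
    unfolding lin[of "sum _ _"] lin[of "a _"] by (simp add: sum.distrib sum_distrib_left distrib_right mult.assoc)
qed

text \<open>Interpolation in y on both vertical sides followed by interpolation in x is, by
  linearity of \<open>scoeff\<close>, a double sum over the tensor basis. The nested form is the one
  that the nodal formula of \<open>interp_C2\<close> takes.\<close>

lemma hermite_nested:
  "hermite (hermite (V 0 0 (-1, -1)) (V 0 0 (-1, 1)) (V 0 1 (-1, -1)) (V 0 1 (-1, 1)) l y)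
       (hermite (V 0 0 (1, -1)) (V 0 0 (1, 1)) (V 0 1 (1, -1)) (V 0 1 (1, 1)) l y)
       (hermite (V 1 0 (-1, -1)) (V 1 0 (-1, 1)) (V 1 1 (-1, -1)) (V 1 1 (-1, 1)) l y)
       (hermite (V 1 0 (1, -1)) (V 1 0 (1, 1)) (V 1 1 (1, -1)) (V 1 1 (1, 1)) l y) k x = interpolant V k l (x, y)"
proof -
  have "hermite (\<Sum>s<4. ycoeff V s 0 (-1) * sbasis l s y) (\<Sum>s<4. ycoeff V s 0 1 * sbasis l s y)
     (\<Sum>s<4. ycoeff V s 1 (-1) * sbasis l s y) (\<Sum>s<4. ycoeff V s 1 1 * sbasis l s y) k x
     = (\<Sum>r<4. (\<Sum>s<4. tcoeff V r s * sbasis l s y) * sbasis k r x)"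
    unfolding hermite_def scoeff_sum tcoeff_def ..
  moreover have "(\<Sum>r<4. (\<Sum>s<4. tcoeff V r s * sbasis l s y) * sbasis k r x) = interpolant V k l (x, y)"
    by (simp add: interpolant_def sum_distrib_left mult_ac)
  moreover have "hermite (V i 0 (t, -1)) (V i 0 (t, 1)) (V i 1 (t, -1)) (V i 1 (t, 1)) l y = (\<Sum>s<4. ycoeff V s i t * sbasis l s y)" for i t
    by (simp only: hermite_def ycoeff_def)
  ultimately show ?thesis by simp
qed

lemma interp_C2_eq:
  assumes V: "\<And>z. z \<in> Lam \<Longrightarrow> v z = V 0 0 z" "\<And>z. z \<in> Lam \<Longrightarrow> Dx v z = V 1 0 z"
    "\<And>z. z \<in> Lam \<Longrightarrow> Dy v z = V 0 1 z" "\<And>z. z \<in> Lam \<Longrightarrow> Dy (Dx v) z = V 1 1 z"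
    and z: "z \<in> Lam"
  shows "interp_C2 v z = interpolant V 0 0 z"
proof -
  obtain x y where xy: "z = (x, y)" "x \<in> {-1..1}" "y \<in> {-1..1}" using z by (cases z) (auto simp: Lam_iff)
  have c: "(-1, -1) \<in> Lam" "(-1, 1) \<in> Lam" "(1, -1) \<in> Lam" "(1, 1) \<in> Lam" by (auto simp: Lam_iff)
  note VV = V(1)[OF c(1)] V(1)[OF c(2)] V(1)[OF c(3)] V(1)[OF c(4)]
    V(2)[OF c(1)] V(2)[OF c(2)] V(2)[OF c(3)] V(2)[OF c(4)]
    V(3)[OF c(1)] V(3)[OF c(2)] V(3)[OF c(3)] V(3)[OF c(4)]
    V(4)[OF c(1)] V(4)[OF c(2)] V(4)[OF c(3)] V(4)[OF c(4)]
  define X0 X1 X2 X3 where X: "X0 = hermite 1 0 0 0 0 x" "X1 = hermite 0 1 0 0 0 x" "X2 = hermite 0 0 1 0 0 x" "X3 = hermite 0 0 0 1 0 x"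
  define Y0 Y1 Y2 Y3 where Y: "Y0 = hermite 1 0 0 0 0 y" "Y1 = hermite 0 1 0 0 0 y" "Y2 = hermite 0 0 1 0 0 y" "Y3 = hermite 0 0 0 1 0 y"
  have sx: "hermite a b c d 0 x = a * X0 + b * X1 + c * X2 + d * X3" for a b c d
    unfolding X by (rule hermite_linear[symmetric])
  have sy: "hermite a b c d 0 y = a * Y0 + b * Y1 + c * Y2 + d * Y3" for a b c d
    unfolding Y by (rule hermite_linear[symmetric])
  show ?thesis
    unfolding xy(1) hermite_nested[symmetric] sx sy
    by (simp add: interp_C2_def VV hat_eq[OF xy(2)] hat_eq[OF xy(3)] X[symmetric] Y[symmetric] algebra_simps)
qed

lemma interp_eq:
  assumes "weak_array g" "AE z in SM. u z = g 0 0 z" "z \<in> Lam"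
  shows "interp u z = interpolant (cont_rep g) 0 0 z"
  unfolding interp_def using C2_rep_eq[OF assms(1,2)] assms(3) by (intro interp_C2_eq)

text \<open>Here \<beta> may have a kink at 0: the fundamental theorem tolerates a finite
  exceptional set as long as the product is continuous. The boundary terms vanish with h.\<close>

lemma by_parts_1D:
  fixes \<beta> \<beta>' h h' :: "real \<Rightarrow> real"
  assumes b: "continuous_on {-1..1} \<beta>" "\<And>x. x \<in> {-1<..<1} \<Longrightarrow> x \<noteq> 0 \<Longrightarrow> (\<beta> has_vector_derivative \<beta>' x) (at x)"
    and bm: "\<beta>' \<in> borel_measurable IM" "\<And>x. x \<in> {-1..1} \<Longrightarrow> \<bar>\<beta>' x\<bar> \<le> B"
    and h: "\<And>x. x \<in> {-1..1} \<Longrightarrow> (h has_vector_derivative h' x) (at x within {-1..1})" "continuous_on {-1..1} h'"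
    and z: "h (-1) = 0" "h 1 = 0"
  shows "(LINT x|IM. \<beta> x * h' x) = - (LINT x|IM. \<beta>' x * h x)"
proof -
  have hc: "continuous_on {-1..1} h"
    unfolding continuous_on_eq_continuous_within by (intro ballI has_vector_derivative_continuous[OF h(1)])
  have i1: "integrable IM (\<lambda>x. \<beta> x * h' x)"
    by (rule tail_integral(3)[of _ 0]) (auto intro!: continuous_intros b h)
  have "integrable IM (\<lambda>x. h x * \<beta>' x)"
    using bm by (intro integrable_bounded_mult[where B = B] tail_integral(3)[OF hc, of 0]) auto
  then have i2: "integrable IM (\<lambda>x. \<beta>' x * h x)" by (simp add: mult.commute)
  have "((\<lambda>x. \<beta> x * h' x + \<beta>' x * h x) has_integral \<beta> 1 * h 1 - \<beta> (-1) * h (-1)) {-1..1}"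
  proof (rule fundamental_theorem_of_calculus_interior_strong[of "{0}"])
    show "continuous_on {-1..1} (\<lambda>x. \<beta> x * h x)" by (intro continuous_intros b hc)
    fix x :: real assume x: "x \<in> {-1<..<1} - {0}"
    have "(h has_vector_derivative h' x) (at x within {-1<..<1})"
      by (rule has_vector_derivative_within_subset[OF h(1)]) (use x in auto)
    then have "(h has_vector_derivative h' x) (at x)" using x by (subst (asm) at_within_open) auto
    then show "((\<lambda>x. \<beta> x * h x) has_vector_derivative \<beta> x * h' x + \<beta>' x * h x) (at x)"
      using b(2) x by (intro has_vector_derivative_mult) auto
  qed auto
  then have "integral {-1..1} (\<lambda>x. \<beta> x * h' x + \<beta>' x * h x) = 0" using z by (simp add: integral_unique)
  then have "(LINT x|IM. \<beta> x * h' x + \<beta>' x * h x) = 0" using integral_IM_HK(1)[of "\<lambda>x. \<beta> x * h' x + \<beta>' x * h x"] i1 i2 by simp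
  then show ?thesis using i1 i2 by (simp add: Bochner_Integration.integral_add)
qed

lemma integral_x_cong:
  fixes F G :: "real \<times> real \<Rightarrow> real"
  assumes "integrable SM F" "integrable SM G"
    "\<And>y. y \<in> {-1..1} \<Longrightarrow> (LINT x|IM. F (x, y)) = - (LINT x|IM. G (x, y))"
  shows "(LINT z|SM. F z) = - (LINT z|SM. G z)"
proof -
  have "(LINT z|SM. F z) = (LINT y|IM. LINT x|IM. F (x, y))"
    using SM.integral_snd[of "\<lambda>x y. F (x, y)"] assms by simp
  also have "\<dots> = (LINT y|IM. - (LINT x|IM. G (x, y)))"
    using assms(3) by (intro Bochner_Integration.integral_cong) auto
  also have "\<dots> = - (LINT z|SM. G z)"
    using SM.integral_snd[of "\<lambda>x y. G (x, y)"] assms by simp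
  finally show ?thesis .
qed

lemma integral_y_cong:
  fixes F G :: "real \<times> real \<Rightarrow> real"
  assumes "integrable SM F" "integrable SM G"
    "\<And>x. x \<in> {-1..1} \<Longrightarrow> (LINT y|IM. F (x, y)) = - (LINT y|IM. G (x, y))"
  shows "(LINT z|SM. F z) = - (LINT z|SM. G z)"
proof -
  have "(LINT z|SM. F z) = (LINT x|IM. LINT y|IM. F (x, y))"
    using SM.integral_fst[of "\<lambda>x y. F (x, y)"] assms by simp
  also have "\<dots> = (LINT x|IM. - (LINT y|IM. G (x, y)))"
    using assms(3) by (intro Bochner_Integration.integral_cong) auto
  also have "\<dots> = - (LINT z|SM. G z)"
    using SM.integral_fst[of "\<lambda>x y. G (x, y)"] assms by simp
  finally show ?thesis .
qed

lemma wdx_of_classical: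
  assumes f: "continuous_on Lam f" and h: "continuous_on Lam h"
    and d: "\<And>x y. x \<in> {-1..1} \<Longrightarrow> y \<in> {-1..1} \<Longrightarrow> ((\<lambda>t. f (t, y)) has_vector_derivative h (x, y)) (at x within {-1..1})"
  shows "wdx f h"
  unfolding wdx_def
proof (intro allI impI)
  fix a b assume a: "bump a" and b: "bump b"
  show "tint f (deriv a) b = - tint h a b"
  proof (rule integral_x_cong)
    show "integrable SM (\<lambda>z. f z * tens (deriv a) b z)" "integrable SM (\<lambda>z. h z * tens a b z)"
      by (intro integrable_bump_tensor continuous_Lam_integrable f h bump_deriv a b)+
    fix y :: real assume y: "y \<in> {-1..1}"
    obtain B where B: "\<And>z. z \<in> Lam \<Longrightarrow> \<bar>h z\<bar> \<le> B" using continuous_Lam_bounded[OF h] by blast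
    have "(LINT x|IM. f (x, y) * deriv a x) = - (LINT x|IM. h (x, y) * a x)"
    \<comment> \<open>The bump is the factor that vanishes at both ends; \<open>f\<close> plays the
      role of \<beta>.\<close>
    proof (rule by_parts_1D[where B = B])
      show "continuous_on {-1..1} (\<lambda>x. f (x, y))" by (rule continuous_Lam_section(1)[OF f y])
      show "((\<lambda>x. f (x, y)) has_vector_derivative h (x, y)) (at x)" if "x \<in> {-1<..<1}" for x
      proof -
        have "((\<lambda>x. f (x, y)) has_vector_derivative h (x, y)) (at x within {-1<..<1})"
          by (rule has_vector_derivative_within_subset[OF d[OF _ y]]) (use that in auto)
        then show ?thesis using that by (subst (asm) at_within_open) auto
      qed
      show "(\<lambda>x. h (x, y)) \<in> borel_measurable IM"
        using measurable_compose[OF measurable_Pair2'[of y IM IM] continuous_Lam_measurable[OF h]] y by simp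
      show "\<bar>h (x, y)\<bar> \<le> B" if "x \<in> {-1..1}" for x using B that y by (simp add: Lam_iff)
      show "(a has_vector_derivative deriv a x) (at x within {-1..1})" for x
        using bump_DERIV[OF a, of x] by (simp add: has_real_derivative_iff_has_vector_derivative has_vector_derivative_at_within)
      show "continuous_on {-1..1} (deriv a)" using bump_continuous[OF bump_deriv[OF a]] continuous_on_subset by blast
    qed (use bump_zero[OF a] in auto)
    then have "(LINT x|IM. f (x, y) * deriv a x) * b y = - (LINT x|IM. h (x, y) * a x) * b y" by simp
    then show "(LINT x|IM. f (x, y) * (deriv a (fst (x, y)) * b (snd (x, y)))) = - (LINT x|IM. h (x, y) * (a (fst (x, y)) * b (snd (x, y))))"
      by (simp add: mult.assoc flip: integral_mult_left_zero)
  qed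
qed

lemma wdy_of_classical:
  assumes f: "continuous_on Lam f" and h: "continuous_on Lam h"
    and d: "\<And>x y. x \<in> {-1..1} \<Longrightarrow> y \<in> {-1..1} \<Longrightarrow> ((\<lambda>t. f (x, t)) has_vector_derivative h (x, y)) (at y within {-1..1})"
  shows "wdy f h"
  unfolding wdy_def
proof (intro allI impI)
  fix a b assume a: "bump a" and b: "bump b"
  let ?f = "\<lambda>z. f (prod.swap z)" and ?h = "\<lambda>z. h (prod.swap z)"
  have w: "wdx ?f ?h"
    by (rule wdx_of_classical) (use d continuous_on_Lam_swap[OF f] continuous_on_Lam_swap[OF h] in auto)
  have m: "(\<lambda>z. k z * tens p q z) \<in> borel_measurable SM" if "continuous_on Lam k" "bump p" "bump q" for k p q
    using that by (intro borel_measurable_times tensor_measurable continuous_Lam_measurable bump_IM)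
  have "tint f a (deriv b) = tint ?f (deriv b) a"
    using integral_swap[OF m[OF f a bump_deriv[OF b]]] by (simp add: mult_ac)
  also have "\<dots> = - tint ?h b a" using w a b by (simp add: wdx_def)
  also have "tint ?h b a = tint h a b"
    using integral_swap[OF m[OF h a b]] by (simp add: mult_ac)
  finally show "tint f a (deriv b) = - tint h a b" .
qed

section \<open>Weak derivatives of the interpolant\<close>

lemma sbasis_tensor_integrable:
  assumes "continuous_on Lam F"
  shows "integrable SM (\<lambda>z. tens (sbasis k r) (sbasis l s) z * F z)"
proof -
  have "integrable SM (\<lambda>z. F z * tens (sbasis k r) (sbasis l s) z)"
    by (rule integrable_tensor[where A = 4 and B = 4])
       (use sbasis_measurable sbasis_bound continuous_Lam_integrable[OF assms] in auto)
  then show ?thesis by (simp add: mult.commute)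
qed

lemma sbasis_DERIV:
  assumes "k < 2" "x \<noteq> 0" shows "(sbasis k r has_vector_derivative sbasis (Suc k) r x) (at x)"
proof -
  have "k = 0 \<or> k = 1" using assms by auto
  then show ?thesis using sbasis_DERIV_0[of r x] sbasis_DERIV_1[of x r] assms
    by (auto simp: has_real_derivative_iff_has_vector_derivative numeral_2_eq_2)
qed

text \<open>Two successive steps are possible because \<open>sbasis 0\<close> and
  \<open>sbasis 1\<close> are continuous; at a third one the jump of \<open>sbasis 2\<close> would
  contribute an integral along an axis, hence k < 2.\<close>

lemma sbasis_by_parts:
  assumes F: "test_fun F" and k: "k < 2"
  shows "(LINT z|SM. tens (sbasis k r) (sbasis l s) z * Dx F z) = - (LINT z|SM. tens (sbasis (Suc k) r) (sbasis l s) z * F z)"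
    "(LINT z|SM. tens (sbasis l r) (sbasis k s) z * Dy F z) = - (LINT z|SM. tens (sbasis l r) (sbasis (Suc k) s) z * F z)"
proof -
  have F1: "F \<in> C_Lam (Suc 0)" using F unfolding test_fun_def by blast
  note Fc = test_fun_continuous[OF F] and FD = test_fun_continuous[OF test_fun_D(1)[OF F]] test_fun_continuous[OF test_fun_D(2)[OF F]]
  show "(LINT z|SM. tens (sbasis k r) (sbasis l s) z * Dx F z) = - (LINT z|SM. tens (sbasis (Suc k) r) (sbasis l s) z * F z)"
  proof (rule integral_x_cong)
    show "integrable SM (\<lambda>z. tens (sbasis k r) (sbasis l s) z * Dx F z)"
      "integrable SM (\<lambda>z. tens (sbasis (Suc k) r) (sbasis l s) z * F z)" by (intro sbasis_tensor_integrable Fc FD)+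
    fix y :: real assume y: "y \<in> {-1..1}"
    have "(LINT x|IM. sbasis k r x * Dx F (x, y)) = - (LINT x|IM. sbasis (Suc k) r x * F (x, y))"
      by (rule by_parts_1D[where B = 4])
         (use k y sbasis_DERIV sbasis_measurable sbasis_bound C_Lam_vd(1)[OF F1] continuous_Lam_section(1)[OF FD(1) y]
           test_fun_boundary[OF F] in \<open>auto intro!: sbasis_continuous simp: Lam_iff\<close>)
    then have "sbasis l s y * (LINT x|IM. sbasis k r x * Dx F (x, y)) = sbasis l s y * - (LINT x|IM. sbasis (Suc k) r x * F (x, y))" by simp
    then show "(LINT x|IM. sbasis k r (fst (x, y)) * sbasis l s (snd (x, y)) * Dx F (x, y)) = - (LINT x|IM. sbasis (Suc k) r (fst (x, y)) * sbasis l s (snd (x, y)) * F (x, y))"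
      by (simp add: mult_ac flip: integral_mult_right_zero)
  qed
  show "(LINT z|SM. tens (sbasis l r) (sbasis k s) z * Dy F z) = - (LINT z|SM. tens (sbasis l r) (sbasis (Suc k) s) z * F z)"
  proof (rule integral_y_cong)
    show "integrable SM (\<lambda>z. tens (sbasis l r) (sbasis k s) z * Dy F z)"
      "integrable SM (\<lambda>z. tens (sbasis l r) (sbasis (Suc k) s) z * F z)" by (intro sbasis_tensor_integrable Fc FD)+
    fix x :: real assume x: "x \<in> {-1..1}"
    have "(LINT y|IM. sbasis k s y * Dy F (x, y)) = - (LINT y|IM. sbasis (Suc k) s y * F (x, y))"
      by (rule by_parts_1D[where B = 4])
         (use k x sbasis_DERIV sbasis_measurable sbasis_bound C_Lam_vd(2)[OF F1] continuous_Lam_section(2)[OF FD(2) x]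
           test_fun_boundary[OF F] in \<open>auto intro!: sbasis_continuous simp: Lam_iff\<close>)
    then have "sbasis l r x * (LINT y|IM. sbasis k s y * Dy F (x, y)) = sbasis l r x * - (LINT y|IM. sbasis (Suc k) s y * F (x, y))" by simp
    then show "(LINT y|IM. sbasis l r (fst (x, y)) * sbasis k s (snd (x, y)) * Dy F (x, y)) = - (LINT y|IM. sbasis l r (fst (x, y)) * sbasis (Suc k) s (snd (x, y)) * F (x, y))"
      by (simp add: mult_ac flip: integral_mult_right_zero)
  qed
qed

text \<open>The x-derivatives, which \<open>D_classical\<close> applies last, are moved first, then
  the y-derivatives. Each move is an integration by parts against a function that is again a test
  function.\<close>

lemma sbasis_weak:
  assumes t: "test_fun \<phi>" and kl: "k \<le> 2" "l \<le> 2"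
  shows "(LINT z|SM. tens (sbasis 0 r) (sbasis 0 s) z * D_classical (k, l) \<phi> z)
    = (-1) ^ (k + l) * (LINT z|SM. tens (sbasis k r) (sbasis l s) z * \<phi> z)"
proof -
  have Y: "test_fun \<psi> \<Longrightarrow> l \<le> 2 \<Longrightarrow> (LINT z|SM. tens (sbasis k r) (sbasis 0 s) z * (Dy ^^ l) \<psi> z)
      = (-1) ^ l * (LINT z|SM. tens (sbasis k r) (sbasis l s) z * \<psi> z)" for k l \<psi>
  proof (induction l arbitrary: \<psi>)
    case (Suc l)
    have "(LINT z|SM. tens (sbasis k r) (sbasis 0 s) z * (Dy ^^ Suc l) \<psi> z)
       = (LINT z|SM. tens (sbasis k r) (sbasis 0 s) z * (Dy ^^ l) (Dy \<psi>) z)"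
      by (simp add: funpow_Suc_right del: funpow.simps)
    also have "\<dots> = (-1) ^ l * (LINT z|SM. tens (sbasis k r) (sbasis l s) z * Dy \<psi> z)"
      using Suc.prems test_fun_D(2) by (intro Suc.IH) auto
    finally show ?case using sbasis_by_parts(2)[OF Suc.prems(1), of l k r s] Suc.prems(2) by simp
  qed simp
  have X: "test_fun \<psi> \<Longrightarrow> k \<le> 2 \<Longrightarrow> (LINT z|SM. tens (sbasis 0 r) (sbasis 0 s) z * (Dx ^^ k) \<psi> z)
      = (-1) ^ k * (LINT z|SM. tens (sbasis k r) (sbasis 0 s) z * \<psi> z)" for k \<psi>
  proof (induction k arbitrary: \<psi>)
    case (Suc k)
    have "(LINT z|SM. tens (sbasis 0 r) (sbasis 0 s) z * (Dx ^^ Suc k) \<psi> z)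
       = (LINT z|SM. tens (sbasis 0 r) (sbasis 0 s) z * (Dx ^^ k) (Dx \<psi>) z)"
      by (simp add: funpow_Suc_right del: funpow.simps)
    also have "\<dots> = (-1) ^ k * (LINT z|SM. tens (sbasis k r) (sbasis 0 s) z * Dx \<psi> z)"
      using Suc.prems test_fun_D(1) by (intro Suc.IH) auto
    finally show ?case using sbasis_by_parts(1)[OF Suc.prems(1), of k r 0 s] Suc.prems(2) by simp
  qed simp
  have "test_fun ((Dy ^^ l) \<phi>)" using test_fun_D_classical[OF t, of "(0, l)"] by (simp add: D_classical_def)
  from X[OF this kl(1)] Y[OF t kl(2), of k] show ?thesis
    by (simp add: D_classical_def power_add)
qed

lemma interpolant_weak:
  assumes t: "test_fun \<phi>" and kl: "k \<le> 2" "l \<le> 2"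
  shows "(LINT z|SM. interpolant V 0 0 z * D_classical (k, l) \<phi> z) = (-1) ^ (k + l) * (LINT z|SM. interpolant V k l z * \<phi> z)"
proof -
  have *: "(LINT z|SM. interpolant V k l z * F z) = (\<Sum>r<4. \<Sum>s<4. tcoeff V r s * (LINT z|SM. tens (sbasis k r) (sbasis l s) z * F z))"
    if "continuous_on Lam F" for k l F
  proof -
    have "(LINT z|SM. interpolant V k l z * F z) = (LINT z|SM. (\<Sum>r<4. \<Sum>s<4. tcoeff V r s * (tens (sbasis k r) (sbasis l s) z * F z)))"
      by (simp add: interpolant_def sum_distrib_right mult.assoc)
    also have "\<dots> = (\<Sum>r<4. \<Sum>s<4. LINT z|SM. tcoeff V r s * (tens (sbasis k r) (sbasis l s) z * F z))"
      using sbasis_tensor_integrable[OF that] by (simp add: Bochner_Integration.integral_sum)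
    finally show ?thesis by simp
  qed
  show ?thesis
    unfolding *[OF test_fun_continuous[OF t]] *[OF test_fun_continuous[OF test_fun_D_classical[OF t]]]
    unfolding sbasis_weak[OF t kl] sum_distrib_left by (simp only: mult.left_commute)
qed

section \<open>The error estimate\<close>

text \<open>The coefficients \<open>scoeff r\<close> with \<open>r \<ge> 1\<close> depend on the derivative only, those with \<open>r \<ge> 2\<close> only on
  its oscillation; \<open>data_bound k\<close> bounds what the coefficients with \<open>r \<ge> k\<close> depend on.\<close>

definition data_bound :: "nat \<Rightarrow> real \<Rightarrow> (real \<Rightarrow> real) \<Rightarrow> (real \<Rightarrow> real) \<Rightarrow> bool" where
  "data_bound k N f f' \<longleftrightarrow> (k = 0 \<longrightarrow> (\<forall>x\<in>{-1..1}. \<bar>f x\<bar> \<le> N)) \<and> (k \<le> 1 \<longrightarrow> (\<forall>x\<in>{-1..1}. \<bar>f' x\<bar> \<le> N))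
    \<and> (k = 2 \<longrightarrow> (\<forall>x\<in>{-1..1}. \<forall>x'\<in>{-1..1}. \<bar>f' x - f' x'\<bar> \<le> N))"

text \<open>The mean value theorem turns b - a into 2 f'(\<xi>). Then the coefficient r = 2 is ((d -
  c)/2 + (2 f'(\<xi>) - d - c))/2 and the last one is c + d - 2 f'(\<xi>); both vanish for constant
  f', so its oscillation controls them. Every coefficient considered is at most 4 N, and 10 is a
  convenient majorant.\<close>

lemma scoeff_bound:
  assumes d: "\<And>x. x \<in> {-1..1} \<Longrightarrow> (f has_vector_derivative f' x) (at x within {-1..1})"
    and data_bound: "data_bound k N f f'" and k: "k \<le> r" "k \<le> 2"
  shows "\<bar>scoeff r (f (-1)) (f 1) (f' (-1)) (f' 1)\<bar> \<le> 10 * N"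
proof -
  have "\<exists>x\<in>{-1..1}. f 1 - f (-1) = (1 - (-1)) *\<^sub>R f' x"
    by (rule mvt_very_simple[where f' = "\<lambda>x h. h *\<^sub>R f' x"]) (use d in \<open>auto simp: has_vector_derivative_def\<close>)
  then obtain \<xi> where xi: "\<xi> \<in> {-1..1}" "f 1 - f (-1) = 2 * f' \<xi>" by auto
  consider "k = 0" | "k = 1" | "k = 2" using k by linarith
  then show ?thesis
  proof cases
    case 1
    then have "\<bar>f (-1)\<bar> \<le> N" "\<bar>f 1\<bar> \<le> N" "\<bar>f' (-1)\<bar> \<le> N" "\<bar>f' 1\<bar> \<le> N" using data_bound by (auto simp: data_bound_def)
    then show ?thesis by (simp add: scoeff_def Let_def field_simps abs_le_iff)
  next
    case 2
    then have "\<bar>f' \<xi>\<bar> \<le> N" "\<bar>f' (-1)\<bar> \<le> N" "\<bar>f' 1\<bar> \<le> N" using data_bound xi by (auto simp: data_bound_def)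
    then show ?thesis using xi(2) k 2 by (simp add: scoeff_def Let_def field_simps abs_le_iff)
  next
    case 3
    then have "\<bar>f' \<xi> - f' (-1)\<bar> \<le> N" "\<bar>f' 1 - f' (-1)\<bar> \<le> N" using data_bound xi by (auto simp: data_bound_def)
    then show ?thesis using xi(2) k 3 by (simp add: scoeff_def Let_def field_simps abs_le_iff)
  qed
qed

lemma scoeff_lincomb:
  "scoeff r (p * a + q * a') (p * b + q * b') (p * c + q * c') (p * d + q * d') = p * scoeff r a b c d + q * scoeff r a' b' c' d'"
  by (simp add: scoeff_def Let_def field_simps)

lemma scoeff_eq: "scoeff r a b c d = scoeff r 1 0 0 0 * a + scoeff r 0 1 0 0 * b + scoeff r 0 0 1 0 * c + scoeff r 0 0 0 1 * d"
  by (simp add: scoeff_def Let_def field_simps)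

lemma deriv_array_vd:
  assumes "deriv_array n V" "k + l < n" "x \<in> {-1..1}" "y \<in> {-1..1}"
  shows "((\<lambda>t. V k l (t, y)) has_vector_derivative V (Suc k) l (x, y)) (at x within {-1..1})"
    "((\<lambda>t. V k l (x, t)) has_vector_derivative V k (Suc l) (x, y)) (at y within {-1..1})"
  using assms unfolding deriv_array_def by blast+

text \<open>The bound in one variable is used twice, in y with order l on lines of constant x, then
  in x with order k on \<open>ycoeff V s 0\<close>, whose derivative is \<open>ycoeff V s 1\<close>;
  this gives 10 * 10. If k = 2 then l = 0, and the oscillation in x of a coefficient is the
  coefficient of the difference of two lines.\<close>

lemma tcoeff_bound:
  assumes V: "deriv_array 2 V" and kl: "k + l \<le> 2" "k \<le> r" "l \<le> s"
    and h0: "\<And>x. k = 0 \<Longrightarrow> x \<in> {-1..1} \<Longrightarrow> data_bound l N (\<lambda>y. V 0 0 (x, y)) (\<lambda>y. V 0 1 (x, y))"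
    and h1: "\<And>x. k \<le> 1 \<Longrightarrow> x \<in> {-1..1} \<Longrightarrow> data_bound l N (\<lambda>y. V 1 0 (x, y)) (\<lambda>y. V 1 1 (x, y))"
    and h2: "\<And>x x'. k = 2 \<Longrightarrow> x \<in> {-1..1} \<Longrightarrow> x' \<in> {-1..1} \<Longrightarrow>
       data_bound 0 N (\<lambda>y. V 1 0 (x, y) - V 1 0 (x', y)) (\<lambda>y. V 1 1 (x, y) - V 1 1 (x', y))"
  shows "\<bar>tcoeff V r s\<bar> \<le> 100 * N"
proof -
  have vy: "((\<lambda>t. V i 0 (x, t)) has_vector_derivative V i 1 (x, y)) (at y within {-1..1})"
    if "x \<in> {-1..1}" "y \<in> {-1..1}" "i \<le> 1" for i x y
    using deriv_array_vd(2)[OF V, of i 0 x y] that by simp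
  have vx: "((\<lambda>t. V 0 j (t, y)) has_vector_derivative V 1 j (x, y)) (at x within {-1..1})"
    if "x \<in> {-1..1}" "y \<in> {-1..1}" "j \<le> 1" for j x y
    using deriv_array_vd(1)[OF V, of 0 j x y] that by simp
  have Y0: "\<bar>ycoeff V s 0 x\<bar> \<le> 10 * N" if "k = 0" "x \<in> {-1..1}" for x
    unfolding ycoeff_def by (rule scoeff_bound[OF _ h0[OF that]]) (use vy that kl in auto)
  have Y1: "\<bar>ycoeff V s 1 x\<bar> \<le> 10 * N" if "k \<le> 1" "x \<in> {-1..1}" for x
    unfolding ycoeff_def by (rule scoeff_bound[OF _ h1[OF that]]) (use vy that kl in auto)
  have Y2: "\<bar>ycoeff V s 1 x - ycoeff V s 1 x'\<bar> \<le> 10 * N" if "k = 2" "x \<in> {-1..1}" "x' \<in> {-1..1}" for x x'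
  proof -
    have "\<bar>scoeff s (V 1 0 (x, -1) - V 1 0 (x', -1)) (V 1 0 (x, 1) - V 1 0 (x', 1))
        (V 1 1 (x, -1) - V 1 1 (x', -1)) (V 1 1 (x, 1) - V 1 1 (x', 1))\<bar> \<le> 10 * N"
      by (rule scoeff_bound[OF _ h2[OF that]])
         (use vy[of x _ 1] vy[of x' _ 1] that kl in \<open>auto intro!: has_vector_derivative_diff\<close>)
    then show ?thesis
      using scoeff_lincomb[of s 1 "V 1 0 (x, -1)" "-1" "V 1 0 (x', -1)" "V 1 0 (x, 1)" "V 1 0 (x', 1)"
        "V 1 1 (x, -1)" "V 1 1 (x', -1)" "V 1 1 (x, 1)" "V 1 1 (x', 1)"]
      by (simp add: ycoeff_def)
  qed
  have dY: "(ycoeff V s 0 has_vector_derivative ycoeff V s 1 x) (at x within {-1..1})" if "x \<in> {-1..1}" for x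
    unfolding ycoeff_def scoeff_eq[of s "V _ _ _"]
    by (intro has_vector_derivative_add has_vector_derivative_mult_right vx that) auto
  have "data_bound k (10 * N) (ycoeff V s 0) (ycoeff V s 1)"
    unfolding data_bound_def using Y0 Y1 Y2 by auto
  from scoeff_bound[OF dY this kl(2)] kl(1) show ?thesis by (simp add: tcoeff_def)
qed

text \<open>The k-th derivative of x^i / i!. With this normalization differentiation only shifts k,
  and the top derivatives of a polynomial are its coefficients.\<close>

definition dmonom :: "nat \<Rightarrow> nat \<Rightarrow> real \<Rightarrow> real" where
  "dmonom k i x = (if k \<le> i then x ^ (i - k) / fact (i - k) else 0)"

lemma dmonom_DERIV: "(dmonom k i has_real_derivative dmonom (Suc k) i x) (at x)"
proof (cases "k < i")
  case True
  then obtain m where m: "i - k = Suc m" by (metis Suc_diff_Suc)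
  then have "i - Suc k = m" by simp
  with m have e: "dmonom k i = (\<lambda>x. x ^ Suc m / fact (Suc m))" "dmonom (Suc k) i = (\<lambda>x. x ^ m / fact m)"
    using True by (auto simp: dmonom_def[abs_def])
  have "((\<lambda>x. x ^ Suc m / fact (Suc m)) has_real_derivative (real (Suc m) * x ^ m) / fact (Suc m)) (at x)"
    by (rule derivative_eq_intros | simp)+
  then show ?thesis unfolding e by (simp add: fact_Suc divide_simps)
next
  case False
  then have "dmonom k i = (\<lambda>x. dmonom k i 0)" "dmonom (Suc k) i x = 0"
    by (auto simp: dmonom_def[abs_def])
  then show ?thesis by (metis DERIV_const)
qed

lemma dmonom_continuous: "continuous_on S (dmonom k i)"
  using dmonom_DERIV by (meson DERIV_isCont continuous_at_imp_continuous_on)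

text \<open>All derivatives of the polynomial \<open>\<Sum> c i j x\<^sup>i y\<^sup>j / (i! j!)\<close>.\<close>

definition polys :: "(nat \<Rightarrow> nat \<Rightarrow> real) \<Rightarrow> nat \<Rightarrow> nat \<Rightarrow> real \<times> real \<Rightarrow> real" where
  "polys c k l z = (\<Sum>i<3. \<Sum>j<3. c i j * tens (dmonom k i) (dmonom l j) z)"

lemma polys_continuous: "continuous_on Lam (polys c k l)"
  unfolding polys_def[abs_def]
  by (intro continuous_intros continuous_on_compose2[OF dmonom_continuous[of UNIV]]) auto

lemma polys_weak_array: "weak_array (polys c)"
proof -
  have d: "(dmonom k i has_vector_derivative dmonom (Suc k) i x) (at x within S)" for k i x S
    using dmonom_DERIV[of k i x] by (simp add: has_real_derivative_iff_has_vector_derivative has_vector_derivative_at_within)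
  have "wdx (polys c k l) (polys c (Suc k) l)" for k l
    by (rule wdx_of_classical[OF polys_continuous polys_continuous])
       (auto simp: polys_def intro!: has_vector_derivative_sum has_vector_derivative_mult_right has_vector_derivative_mult_left d)
  moreover have "wdy (polys c k l) (polys c k (Suc l))" for k l
    by (rule wdy_of_classical[OF polys_continuous polys_continuous])
       (auto simp: polys_def intro!: has_vector_derivative_sum has_vector_derivative_mult_right d)
  ultimately show ?thesis by (simp add: weak_array_def continuous_Lam_integrable polys_continuous)
qed

definition mcoeff :: "nat \<Rightarrow> nat \<Rightarrow> real" where
  "mcoeff i r = scoeff r (dmonom 0 i (-1)) (dmonom 0 i 1) (dmonom 1 i (-1)) (dmonom 1 i 1)"

lemma mcoeff_reproduces:
  assumes "i < 3" "k \<le> 2" shows "(\<Sum>r<4. mcoeff i r * sbasis k r x) = dmonom k i x"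
proof -
  have "i = 0 \<or> i = 1 \<or> i = 2" "k = 0 \<or> k = 1 \<or> k = 2" using assms by auto
  then show ?thesis
    by (auto simp: sum_less_4 mcoeff_def scoeff_def dmonom_def sbasis_def Let_def field_simps power2_eq_square)
qed

lemma tcoeff_polys: "tcoeff (polys c) r s = (\<Sum>i<3. \<Sum>j<3. c i j * (mcoeff i r * mcoeff j s))"
proof -
  have p: "polys c k l (x, y) = (\<Sum>j<3. dmonom l j y * (\<Sum>i<3. c i j * dmonom k i x))" for k l x y
    unfolding polys_def fst_conv snd_conv by (subst sum.swap) (simp add: sum_distrib_left mult_ac)
  have "ycoeff (polys c) s k x = (\<Sum>j<3. mcoeff j s * (\<Sum>i<3. c i j * dmonom k i x))" for k x
    unfolding ycoeff_def p scoeff_sum mcoeff_def ..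
  also have "(\<Sum>j<3. mcoeff j s * (\<Sum>i<3. c i j * dmonom k i x)) = (\<Sum>i<3. dmonom k i x * (\<Sum>j<3. c i j * mcoeff j s))" for k x
    unfolding sum_distrib_left by (subst sum.swap) (simp add: mult_ac)
  finally have Y: "ycoeff (polys c) s k x = (\<Sum>i<3. dmonom k i x * (\<Sum>j<3. c i j * mcoeff j s))" for k x .
  have "tcoeff (polys c) r s = (\<Sum>i<3. mcoeff i r * (\<Sum>j<3. c i j * mcoeff j s))"
    unfolding tcoeff_def Y scoeff_sum mcoeff_def ..
  then show ?thesis by (simp add: sum_distrib_left mult_ac)
qed

lemma interpolant_polys:
  assumes "k \<le> 2" "l \<le> 2" shows "interpolant (polys c) k l z = polys c k l z"
proof -
  have "interpolant (polys c) k l z = (\<Sum>r<4. \<Sum>s<4. \<Sum>i<3. \<Sum>j<3. c i j * ((mcoeff i r * sbasis k r (fst z)) * (mcoeff j s * sbasis l s (snd z))))"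
    unfolding interpolant_def tcoeff_polys by (simp add: sum_distrib_right sum_distrib_left mult_ac)
  also have "\<dots> = (\<Sum>i<3. \<Sum>j<3. \<Sum>r<4. \<Sum>s<4. c i j * ((mcoeff i r * sbasis k r (fst z)) * (mcoeff j s * sbasis l s (snd z))))"
  proof -
    have "(\<Sum>r<4. \<Sum>s<4. \<Sum>i<3. \<Sum>j<3. F i j r s) = (\<Sum>i<3. \<Sum>j<3. \<Sum>r<4. \<Sum>s<4. F i j r s)"
      for F :: "nat \<Rightarrow> nat \<Rightarrow> nat \<Rightarrow> nat \<Rightarrow> real"
    proof -
      have "(\<Sum>r<4. \<Sum>s<4. \<Sum>i<3. \<Sum>j<3. F i j r s) = (\<Sum>r<4. \<Sum>i<3. \<Sum>s<4. \<Sum>j<3. F i j r s)"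
        by (intro sum.cong refl sum.swap)
      also have "\<dots> = (\<Sum>i<3. \<Sum>r<4. \<Sum>j<3. \<Sum>s<4. F i j r s)"
        by (subst sum.swap) (intro sum.cong refl sum.swap)
      also have "\<dots> = (\<Sum>i<3. \<Sum>j<3. \<Sum>r<4. \<Sum>s<4. F i j r s)"
        by (intro sum.cong refl sum.swap)
      finally show ?thesis .
    qed
    then show ?thesis .
  qed
  also have "\<dots> = (\<Sum>i<3. \<Sum>j<3. c i j * ((\<Sum>r<4. mcoeff i r * sbasis k r (fst z)) * (\<Sum>s<4. mcoeff j s * sbasis l s (snd z))))"
    by (intro sum.cong refl) (subst sum_product, simp only: sum_distrib_left)
  also have "\<dots> = polys c k l z"
    unfolding polys_def using mcoeff_reproduces assms by (intro sum.cong) auto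
  finally show ?thesis .
qed

text \<open>\<open>tcoeff\<close> reads only entries of order at most 1 in each variable, at the
  corners; so an identity for these determines the interpolant together with all its
  derivatives.\<close>

lemma interpolant_add:
  assumes "\<And>k l z. k \<le> 1 \<Longrightarrow> l \<le> 1 \<Longrightarrow> z \<in> Lam \<Longrightarrow> V k l z = V1 k l z + V2 k l z"
  shows "interpolant V k l z = interpolant V1 k l z + interpolant V2 k l z"
proof -
  have l1: "scoeff r (a + a') (b + b') (c + c') (d + d') = scoeff r a b c d + scoeff r a' b' c' d'" for r a b c d a' b' c' d'
    using scoeff_lincomb[of r 1 a 1] by simp
  have "ycoeff V s i x = ycoeff V1 s i x + ycoeff V2 s i x" if "i \<le> 1" "x \<in> {-1..1}" for s i x
    unfolding ycoeff_def l1[symmetric] using assms that by (simp add: Lam_iff)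
  then have "tcoeff V r s = tcoeff V1 r s + tcoeff V2 r s" for r s
    unfolding tcoeff_def l1[symmetric] by simp
  then show ?thesis by (simp add: interpolant_def distrib_right sum.distrib)
qed

lemma interpolant_abs_le:
  "\<bar>interpolant V k l z\<bar> \<le> (\<Sum>r<4. \<Sum>s<4. \<bar>tcoeff V r s * tens (sbasis k r) (sbasis l s) z\<bar>)"
  unfolding interpolant_def by (rule order_trans[OF sum_abs]) (intro sum_mono sum_abs)

text \<open>Terms with r < k or s < l vanish through a basis factor. There are 16 terms in all, each
  with basis factors bounded by 4 * 4.\<close>

lemma interpolant_bound:
  assumes C: "\<And>r s. k \<le> r \<Longrightarrow> l \<le> s \<Longrightarrow> \<bar>tcoeff V r s\<bar> \<le> N" and kl: "k \<le> 2" "l \<le> 2" and z: "z \<in> Lam"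
    and N: "N \<ge> 0"
  shows "\<bar>interpolant V k l z\<bar> \<le> 256 * N"
proof -
  have t: "\<bar>tcoeff V r s * tens (sbasis k r) (sbasis l s) z\<bar> \<le> N * (4 * 4)" for r s
  proof (cases "k \<le> r \<and> l \<le> s")
    case True
    have "\<bar>sbasis k r (fst z)\<bar> \<le> 4" "\<bar>sbasis l s (snd z)\<bar> \<le> 4" using z by (auto simp: Lam_def intro!: sbasis_bound)
    then show ?thesis unfolding abs_mult using C[of r s] True N by (intro mult_mono) auto
  next
    case False
    then show ?thesis using sbasis_zero[of r k "fst z"] sbasis_zero[of s l "snd z"] kl N by (auto simp: not_le)
  qed
  have "\<bar>interpolant V k l z\<bar> \<le> (\<Sum>r<4. \<Sum>s<4. \<bar>tcoeff V r s * tens (sbasis k r) (sbasis l s) z\<bar>)"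
    by (rule interpolant_abs_le)
  also have "\<dots> \<le> (\<Sum>r<(4::nat). \<Sum>s<(4::nat). N * (4 * 4))" by (intro sum_mono t)
  finally show ?thesis by simp
qed

lemma interpolant_measurable: "interpolant V k l \<in> borel_measurable SM"
  unfolding interpolant_def[abs_def]
  by (intro borel_measurable_sum borel_measurable_times borel_measurable_const tensor_measurable sbasis_measurable)

lemma interpolant_bounded: obtains B where "\<And>z. z \<in> Lam \<Longrightarrow> \<bar>interpolant V k l z\<bar> \<le> B"
proof -
  have "\<bar>interpolant V k l z\<bar> \<le> (\<Sum>r<4. \<Sum>s<4. \<bar>tcoeff V r s\<bar> * (4 * 4))" if "z \<in> Lam" for z
  proof -
    have "\<bar>interpolant V k l z\<bar> \<le> (\<Sum>r<4. \<Sum>s<4. \<bar>tcoeff V r s * tens (sbasis k r) (sbasis l s) z\<bar>)"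
      by (rule interpolant_abs_le)
    also have "\<dots> \<le> (\<Sum>r<4. \<Sum>s<4. \<bar>tcoeff V r s\<bar> * (4 * 4))"
      unfolding abs_mult using that by (intro sum_mono mult_left_mono mult_mono sbasis_bound) (auto simp: Lam_def)
    finally show ?thesis .
  qed
  then show ?thesis using that by blast
qed

lemma dmonom_integrals:
  "(LINT x|IM. dmonom k k x) = 2" "(LINT x|IM. dmonom 0 (Suc 0) x) = 0" "(LINT x|IM. dmonom (Suc 0) 2 x) = 0"
  "(LINT x|IM. dmonom 0 2 x) = 1 / 3" "k > i \<Longrightarrow> (LINT x|IM. dmonom k i x) = 0"
proof -
  have F: "(LINT x|IM. dmonom (Suc k) i x) = dmonom k i 1 - dmonom k i (-1)" for k i
  proof -
    have "(LINT x|IM. dmonom (Suc k) i x) = integral {-1..1} (dmonom (Suc k) i)"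
      by (intro integral_IM_HK(1) tail_integral(3)[of _ 0] dmonom_continuous) auto
    also have "\<dots> = dmonom k i 1 - dmonom k i (-1)"
      using dmonom_DERIV by (intro integral_unique fundamental_theorem_of_calculus)
        (auto simp: has_real_derivative_iff_has_vector_derivative has_vector_derivative_at_within)
    finally show ?thesis .
  qed
  show "(LINT x|IM. dmonom k k x) = 2" using measure_IM by (simp add: dmonom_def)
  have "dmonom 0 (Suc 0) = dmonom (Suc 0) 2" by (auto simp: dmonom_def)
  then show "(LINT x|IM. dmonom 0 (Suc 0) x) = 0" "(LINT x|IM. dmonom (Suc 0) 2 x) = 0"
    using F[of 0 2] by (auto simp: dmonom_def)
  have "dmonom 0 2 = dmonom (Suc 0) 3" by (auto simp: dmonom_def)
  then show "(LINT x|IM. dmonom 0 2 x) = 1 / 3" using F[of 0 3] by (simp add: dmonom_def fact_numeral)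
  show "k > i \<Longrightarrow> (LINT x|IM. dmonom k i x) = 0" by (simp add: dmonom_def)
qed

lemma polys_integral:
  "(LINT z|SM. polys c k l z) = (\<Sum>i<3. \<Sum>j<3. c i j * ((LINT x|IM. dmonom k i x) * (LINT y|IM. dmonom l j y)))"
proof -
  have i: "integrable SM (tens (dmonom k i) (dmonom l j))" for i j
    by (intro continuous_Lam_integrable continuous_intros continuous_on_compose2[OF dmonom_continuous[of UNIV]]) auto
  have "(LINT z|SM. tens (dmonom k i) (dmonom l j) z) = (LINT x|IM. dmonom k i x) * (LINT y|IM. dmonom l j y)" for i j
    using SM.integral_fst[of "\<lambda>x y. dmonom k i x * dmonom l j y"] i[of i j] by (simp add: case_prod_beta')
  then show ?thesis using i by (simp add: polys_def Bochner_Integration.integral_sum)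
qed

lemma polys_mean:
  obtains c where "\<And>k l. k + l \<le> 2 \<Longrightarrow> (LINT z|SM. polys c k l z) = I k l" "\<And>k l z. k + l > 2 \<Longrightarrow> polys c k l z = 0"
proof -
  \<comment> \<open>The integral of x vanishes and that of x^2/2 over the square is 2/3. So for
    orders 1 and 2 the coefficient is the mean, the integral divided by the area 4, and only the
    constant term needs a correction: 2/3 times \<open>I 2 0 / 4\<close> is
    \<open>I 2 0 / 6\<close>, and likewise for y.\<close>
  define c where "c i j = (if i + j > 2 then 0 else if i = 0 \<and> j = 0 then (I 0 0 - I 2 0 / 6 - I 0 2 / 6) / 4 else I i j / 4)" for i j
  have s3: "(\<Sum>i<(3::nat). f i) = f 0 + f 1 + (f 2 :: real)" for f by (simp add: eval_nat_numeral)
  have "(LINT z|SM. polys c k l z) = I k l" if kl: "k + l \<le> 2" for k l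
  proof -
    have "(k = 0 \<and> l = 0) \<or> (k = 1 \<and> l = 0) \<or> (k = 0 \<and> l = 1) \<or> (k = 2 \<and> l = 0) \<or> (k = 1 \<and> l = 1) \<or> (k = 0 \<and> l = 2)"
      using kl by presburger
    then show ?thesis
      by (elim disjE conjE) (simp_all add: polys_integral s3 dmonom_integrals c_def, simp_all add: field_simps)
  qed
  moreover have "polys c k l z = 0" if "k + l > 2" for k l z
    unfolding polys_def using that by (intro sum.neutral ballI) (auto simp: c_def dmonom_def)
  ultimately show ?thesis using that by blast
qed

text \<open>Cauchy-Schwarz on a square of area 4, by integrating 2 |g| \<le> g^2/s + s and choosing
  s as half the square root of the integral of g^2. If that integral is 0, arbitrarily small s are
  used.\<close>

lemma norm1_L2:
  assumes "integrable SM g" "integrable SM (\<lambda>z. (g z)\<^sup>2)"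
  shows "norm1 g \<le> 2 * sqrt (LINT z|SM. (g z)\<^sup>2)"
proof -
  define S where "S = (LINT z|SM. (g z)\<^sup>2)"
  have S0: "S \<ge> 0" unfolding S_def by (intro integral_nonneg_AE) auto
  have key: "2 * norm1 g \<le> S / s + 4 * s" if s: "s > 0" for s
  proof -
    have "(LINT z|SM. 2 * \<bar>g z\<bar>) \<le> (LINT z|SM. (g z)\<^sup>2 / s + s)"
    proof (rule integral_mono)
      show "integrable SM (\<lambda>z. 2 * \<bar>g z\<bar>)" "integrable SM (\<lambda>z. (g z)\<^sup>2 / s + s)" using assms by auto
      fix z
      have "2 * \<bar>g z\<bar> * s \<le> (g z)\<^sup>2 + s * s"
        using sum_squares_bound[of "\<bar>g z\<bar>" s] by (simp add: power2_eq_square[of s])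
      then show "2 * \<bar>g z\<bar> \<le> (g z)\<^sup>2 / s + s" using s by (simp add: field_simps)
    qed
    then show ?thesis using assms measure_SM by (simp add: S_def Bochner_Integration.integral_add)
  qed
  show ?thesis
  proof (cases "S = 0")
    case True
    have "norm1 g \<le> 0"
    proof (rule field_le_epsilon)
      fix e :: real assume "e > 0"
      then show "norm1 g \<le> 0 + e" using key[of "e / 2"] True by simp
    qed
    then show ?thesis using True by (simp add: S_def)
  next
    case False
    then have s: "sqrt S > 0" using S0 by simp
    have "S / (sqrt S / 2) = 2 * sqrt S" using s S0 by (simp add: field_simps flip: real_sqrt_mult)
    then show ?thesis using key[of "sqrt S / 2"] s by (simp add: S_def)
  qed
qed

lemma L2_norm_AE:
  assumes "w \<in> L2_Lam" "h \<in> borel_measurable SM" "AE z in SM. w z = h z"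
  shows "L2_norm_Lam w = sqrt (LINT z|SM. (h z)\<^sup>2)"
proof -
  have "(LINT z|lebesgue_on Lam. (w z)\<^sup>2) = (LINT z|SM. (h z)\<^sup>2)"
  proof (rule integral_lebesgue_SM_AE(1))
    show "(\<lambda>z. (w z)\<^sup>2) \<in> borel_measurable (lebesgue_on Lam)" using assms(1) by (auto simp: L2_Lam_def)
    show "(\<lambda>z. (h z)\<^sup>2) \<in> borel_measurable SM" using assms(2) by measurable
    show "AE z in SM. (w z)\<^sup>2 = (h z)\<^sup>2" using assms(3) by eventually_elim simp
  qed
  then show ?thesis by (simp add: L2_norm_Lam_def)
qed

lemma weak_array_of_weak_array: "weak_array_of u g \<Longrightarrow> weak_array g"
  by (simp add: weak_array_of_def weak_array_def)

text \<open>\<open>interpolant_weak\<close> supplies the weak derivative of the interpolant,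
  \<open>D_weak\<close> that of u. A weak derivative is determined almost everywhere, so the
  representative chosen for the error must be the difference of the two.\<close>

lemma D_weak_error:
  assumes u: "u \<in> H_Lam 4" and g: "weak_array_of u g" and kl: "k + l \<le> 2"
  shows "D_weak (k, l) (\<lambda>z. u z - interp u z) \<in> L2_Lam"
    "AE z in SM. D_weak (k, l) (\<lambda>z. u z - interp u z) z = g k l z - interpolant (cont_rep g) k l z"
proof -
  let ?V = "cont_rep g"
  let ?h = "\<lambda>z. g k l z - interpolant ?V k l z"
  have gi: "integrable SM (g i j)" "integrable SM (\<lambda>z. (g i j z)\<^sup>2)" "AE z in SM. D_weak (i, j) u z = g i j z"
    if "i + j \<le> 4" for i j using g that by (auto simp: weak_array_of_def)
  have ug: "AE z in SM. u z = g 0 0 z" using g by (simp add: weak_array_of_def)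
  have uL: "u \<in> L2_Lam" using u by (simp add: H_Lam_def)
  have Im: "interpolant ?V i j \<in> borel_measurable SM" for i j by (rule interpolant_measurable)
  have I_int: "integrable SM (interpolant ?V i j)" for i j
    using interpolant_bounded[of ?V i j] bounded_integrable_SM[OF Im] by metis
  have mult_int: "integrable SM (\<lambda>z. f z * \<phi> z)" if "integrable SM f" "continuous_on Lam \<phi>" for f \<phi> :: "real \<times> real \<Rightarrow> real"
    using continuous_Lam_bounded[OF that(2)] integrable_bounded_mult[OF that(1) continuous_Lam_measurable[OF that(2)]]
    by (metis space_SM)
  have W: "has_weak_deriv (k, l) (\<lambda>z. u z - interp u z) ?h"
    unfolding has_weak_deriv_def
  proof (intro allI impI)
    fix \<phi> assume t: "test_fun \<phi>"
    note tD = test_fun_D_classical[OF t, of "(k, l)"]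
    note c = test_fun_continuous[OF t] and cD = test_fun_continuous[OF tD]
    have "(LINT z|lebesgue_on Lam. (u z - interp u z) * D_classical (k, l) \<phi> z)
      = (LINT z|lebesgue_on Lam. (u z - interpolant ?V 0 0 z) * D_classical (k, l) \<phi> z)"
      using interp_eq[OF weak_array_of_weak_array[OF g] ug] by (intro Bochner_Integration.integral_cong) auto
    also have "\<dots> = (LINT z|SM. (g 0 0 z - interpolant ?V 0 0 z) * D_classical (k, l) \<phi> z)"
    proof (rule weak_integral[OF _ _ _ cD])
      show "(\<lambda>z. u z - interpolant ?V 0 0 z) \<in> borel_measurable (lebesgue_on Lam)"
        by (intro borel_measurable_diff L2_measurable[OF uL] SM_measurable_lebesgue Im)
      show "(\<lambda>z. g 0 0 z - interpolant ?V 0 0 z) \<in> borel_measurable SM" using gi(1)[of 0 0] Im by auto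
      show "AE z in SM. u z - interpolant ?V 0 0 z = g 0 0 z - interpolant ?V 0 0 z" using ug by eventually_elim simp
    qed
    also have "\<dots> = (LINT z|SM. g 0 0 z * D_classical (k, l) \<phi> z) - (LINT z|SM. interpolant ?V 0 0 z * D_classical (k, l) \<phi> z)"
      unfolding left_diff_distrib using gi(1)[of 0 0]
      by (intro Bochner_Integration.integral_diff mult_int I_int cD) auto
    also have "(LINT z|SM. g 0 0 z * D_classical (k, l) \<phi> z) = (LINT z|lebesgue_on Lam. u z * D_classical (k, l) \<phi> z)"
      using gi(1)[of 0 0] by (intro weak_integral[symmetric] L2_measurable[OF uL] ug cD) auto
    also have "\<dots> = (-1) ^ (k + l) * (LINT z|lebesgue_on Lam. D_weak (k, l) u z * \<phi> z)"
      using D_weak_H(2)[OF u, of "(k, l)"] kl t by (simp add: has_weak_deriv_def mi_order_def)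
    also have "(LINT z|lebesgue_on Lam. D_weak (k, l) u z * \<phi> z) = (LINT z|SM. g k l z * \<phi> z)"
      using D_weak_H(1)[OF u, of "(k, l)"] kl gi(1)[of k l] gi(3)[of k l]
      by (intro weak_integral L2_measurable c) (auto simp: mi_order_def)
    also have "(LINT z|SM. interpolant ?V 0 0 z * D_classical (k, l) \<phi> z) = (-1) ^ (k + l) * (LINT z|SM. interpolant ?V k l z * \<phi> z)"
      using kl by (intro interpolant_weak t) auto
    also have "(-1) ^ (k + l) * (LINT z|SM. g k l z * \<phi> z) - (-1) ^ (k + l) * (LINT z|SM. interpolant ?V k l z * \<phi> z)
      = (-1) ^ (k + l) * (LINT z|SM. ?h z * \<phi> z)"
      using mult_int[OF gi(1)[of k l] c] mult_int[OF I_int[of k l] c] kl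
      by (simp add: left_diff_distrib right_diff_distrib Bochner_Integration.integral_diff)
    also have "(LINT z|SM. ?h z * \<phi> z) = (LINT z|lebesgue_on Lam. ?h z * \<phi> z)"
      using gi(1)[of k l] kl Im continuous_Lam_measurable[OF c]
      by (intro integral_lebesgue_SM(1)[symmetric]) auto
    finally show "(LINT z|lebesgue_on Lam. (u z - interp u z) * D_classical (k, l) \<phi> z)
      = (-1) ^ mi_order (k, l) * (LINT z|lebesgue_on Lam. ?h z * \<phi> z)" by (simp add: mi_order_def)
  qed
  have hm: "?h \<in> borel_measurable SM" using gi(1)[of k l] kl Im by auto
  have I2: "integrable SM (\<lambda>z. (interpolant ?V k l z)\<^sup>2)"
  proof -
    obtain B where B: "\<And>z. z \<in> Lam \<Longrightarrow> \<bar>interpolant ?V k l z\<bar> \<le> B" using interpolant_bounded by blast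
    have "integrable SM (\<lambda>z. interpolant ?V k l z * interpolant ?V k l z)"
      by (rule integrable_bounded_mult[where B = B, OF I_int Im]) (use B in \<open>auto simp: space_SM\<close>)
    then show ?thesis by (simp add: power2_eq_square)
  qed
  have h2: "integrable SM (\<lambda>z. (?h z)\<^sup>2)"
  proof (rule Bochner_Integration.integrable_bound)
    show "integrable SM (\<lambda>z. 2 * (g k l z)\<^sup>2 + 2 * (interpolant ?V k l z)\<^sup>2)" using gi(2)[of k l] kl I2 by auto
    show "(\<lambda>z. (?h z)\<^sup>2) \<in> borel_measurable SM" using hm by measurable
    show "AE z in SM. norm ((?h z)\<^sup>2) \<le> norm (2 * (g k l z)\<^sup>2 + 2 * (interpolant ?V k l z)\<^sup>2)"
    proof (rule AE_I2)
      fix z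
      have "0 \<le> (g k l z + interpolant ?V k l z)\<^sup>2" by simp
      then have "(?h z)\<^sup>2 \<le> 2 * (g k l z)\<^sup>2 + 2 * (interpolant ?V k l z)\<^sup>2"
        by (simp add: power2_eq_square algebra_simps)
      then show "norm ((?h z)\<^sup>2) \<le> norm (2 * (g k l z)\<^sup>2 + 2 * (interpolant ?V k l z)\<^sup>2)" by simp
    qed
  qed
  have "?h \<in> L2_Lam"
    using SM_measurable_lebesgue[OF hm] integral_lebesgue_SM(2)[of "\<lambda>z. (?h z)\<^sup>2"] h2 by (auto simp: L2_Lam_def)
  from D_weak_I(1,3)[OF this W]
  show "D_weak (k, l) (\<lambda>z. u z - interp u z) \<in> L2_Lam"
    "AE z in SM. D_weak (k, l) (\<lambda>z. u z - interp u z) z = g k l z - interpolant (cont_rep g) k l z" .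
qed

lemma finite_mi_order: "finite {\<alpha>. mi_order \<alpha> = n}"
  by (rule finite_subset[of _ "{..n} \<times> {..n}"]) (auto simp: mi_order_def)

lemma H_seminorm_ge:
  assumes "mi_order \<alpha> = n" shows "L2_norm_Lam (D_weak \<alpha> w) \<le> H_seminorm_Lam n w"
  unfolding H_seminorm_Lam_def
proof (rule real_le_rsqrt)
  show "(L2_norm_Lam (D_weak \<alpha> w))\<^sup>2 \<le> (\<Sum>\<alpha>\<in>{\<alpha>. mi_order \<alpha> = n}. (L2_norm_Lam (D_weak \<alpha> w))\<^sup>2)"
    by (rule member_le_sum) (use assms finite_mi_order in auto)
qed

lemma weak_array_diff:
  assumes f: "weak_array f" and g: "weak_array g" shows "weak_array (\<lambda>k l z. f k l z - g k l z)"
  unfolding weak_array_def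
proof (intro conjI allI impI)
  fix k l :: nat
  show "integrable SM (\<lambda>z. f k l z - g k l z)" if "k + l \<le> 4" using f g that by (auto simp: weak_array_def)
  assume kl: "k + l < 4"
  have i: "integrable SM (f i j)" "integrable SM (g i j)" if "i + j \<le> 4" for i j using f g that by (auto simp: weak_array_def)
  have d: "(LINT z|SM. (f i j z - g i j z) * tens a b z)
     = tint (f i j) a b - tint (g i j) a b"
    if "i + j \<le> 4" "bump a" "bump b" for i j a b
    unfolding left_diff_distrib using that by (intro Bochner_Integration.integral_diff integrable_bump_tensor i)
  have "wdx (f k l) (f (Suc k) l)" "wdx (g k l) (g (Suc k) l)" "wdy (f k l) (f k (Suc l))" "wdy (g k l) (g k (Suc l))"
    using f g kl by (auto simp: weak_array_def)
  then show "wdx (\<lambda>z. f k l z - g k l z) (\<lambda>z. f (Suc k) l z - g (Suc k) l z)"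
    "wdy (\<lambda>z. f k l z - g k l z) (\<lambda>z. f k (Suc l) z - g k (Suc l) z)"
    using kl by (auto simp: wdx_def wdy_def d bump_deriv)
qed

text \<open>Both sides are continuous and agree almost everywhere, so the polynomial can be split
  off at every point, in particular at the nodes.\<close>

lemma cont_rep_diff_polys:
  assumes g: "weak_array g" and kl: "k + l \<le> 2" and z: "z \<in> Lam"
  shows "cont_rep g k l z = cont_rep (\<lambda>k l z. g k l z - polys c k l z) k l z + polys c k l z"
proof (rule continuous_AE_eq[OF _ _ _ z])
  let ?e = "\<lambda>k l z. g k l z - polys c k l z"
  have e: "weak_array ?e" by (rule weak_array_diff[OF g polys_weak_array])
  show "continuous_on Lam (cont_rep g k l)" by (rule cont_rep_continuous[OF g kl])
  show "continuous_on Lam (\<lambda>z. cont_rep ?e k l z + polys c k l z)"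
    by (intro continuous_on_add cont_rep_continuous[OF e kl] polys_continuous)
  show "AE z in SM. cont_rep g k l z = cont_rep ?e k l z + polys c k l z"
    using cont_rep_AE[OF g kl] cont_rep_AE[OF e kl] by eventually_elim simp
qed

text \<open>Induction from order 4 downwards. Raising an index keeps (a, b) above (k, l), so the
  hypotheses on top orders and means are called only inside that cone.\<close>

lemma poincare_chain:
  assumes e: "weak_array e" and R: "R \<ge> 0"
    and top: "\<And>a b. k \<le> a \<Longrightarrow> l \<le> b \<Longrightarrow> a + b = 4 \<Longrightarrow> norm1 (e a b) \<le> 2 * R"
    and mean: "\<And>a b. k \<le> a \<Longrightarrow> l \<le> b \<Longrightarrow> a + b \<le> 3 \<Longrightarrow> \<bar>LINT z|SM. e a b z\<bar> \<le> R"
    and ab: "k \<le> a" "l \<le> b" "a + b \<le> 4"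
  shows "norm1 (e a b) \<le> 2 * (1 + 16 * wmax) ^ 4 * R"
proof -
  \<comment> \<open>With X = \<open>(1 + L) ^ n * R\<close>, a Poincare step turns the bound 2 X for
    both higher derivatives into R + 32 wmax X, where R \<le> 2 X; L = 16 wmax makes this at most 2
    (1 + L) X.\<close>
  define L where "L = 16 * wmax"
  have L: "L \<ge> 16" using wmax_ge by (simp add: L_def)
  have "k \<le> a \<Longrightarrow> l \<le> b \<Longrightarrow> a + b + n = 4 \<Longrightarrow> norm1 (e a b) \<le> 2 * (1 + L) ^ n * R" for n a b
  proof (induction n arbitrary: a b)
    case 0 then show ?case using top[of a b] by simp
  next
    case (Suc n)
    have i: "integrable SM (e a b)" "integrable SM (e (Suc a) b)" "integrable SM (e a (Suc b))"
      "wdx (e a b) (e (Suc a) b)" "wdy (e a b) (e a (Suc b))" using e Suc.prems by (auto simp: weak_array_def)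
    have "norm1 (e (Suc a) b) \<le> 2 * (1 + L) ^ n * R" "norm1 (e a (Suc b)) \<le> 2 * (1 + L) ^ n * R"
      using Suc.prems by (auto intro!: Suc.IH)
    then have "norm1 (e (Suc a) b) + norm1 (e a (Suc b)) \<le> 4 * ((1 + L) ^ n * R)" by simp
    then have "8 * wmax * (norm1 (e (Suc a) b) + norm1 (e a (Suc b))) \<le> 8 * wmax * (4 * ((1 + L) ^ n * R))"
      using wmax_ge by (intro mult_left_mono) auto
    moreover have "\<bar>LINT z|SM. e a b z\<bar> \<le> R" using Suc.prems by (intro mean) auto
    moreover have "R \<le> 2 * ((1 + L) ^ n * R)"
    proof -
      have "1 \<le> (1 + L) ^ n" using L by (intro one_le_power) simp
      then have "1 * R \<le> (1 + L) ^ n * R" using R by (intro mult_right_mono)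
      then show ?thesis using R by linarith
    qed
    ultimately have "norm1 (e a b) \<le> 2 * ((1 + L) ^ n * R) + 8 * wmax * (4 * ((1 + L) ^ n * R))"
      using poincare_L1[OF i] by linarith
    also have "\<dots> = 2 * (1 + L) ^ Suc n * R" by (simp add: L_def algebra_simps)
    finally show ?case .
  qed
  from this[of a b "4 - (a + b)"] have "norm1 (e a b) \<le> 2 * (1 + L) ^ (4 - (a + b)) * R" using ab by simp
  also have "\<dots> \<le> 2 * (1 + L) ^ 4 * R" using L R by (intro mult_right_mono mult_left_mono power_increasing) auto
  finally show ?thesis by (simp add: L_def)
qed

text \<open>The supremum bound collects four norms, one for each term of the representation. The
  factor 25600 is 256 from the sum over the tensor basis times 100 from the coefficients.\<close>

lemma interpolation_bound:
  assumes e: "weak_array e" and kl: "k + l \<le> 2" and z: "z \<in> Lam"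
    and M: "\<And>a b. k \<le> a \<Longrightarrow> l \<le> b \<Longrightarrow> a + b \<le> 4 \<Longrightarrow> norm1 (e a b) \<le> M"
  shows "\<bar>cont_rep e k l z\<bar> \<le> 4 * wmax * wmax * M" "\<bar>interpolant (cont_rep e) k l z\<bar> \<le> 25600 * (4 * wmax * wmax * M)"
proof -
  define N where "N = 4 * wmax * wmax * M"
  have M0: "M \<ge> 0" using M[of k l] kl norm1_nonneg[of "e k l"] by linarith
  then have N0: "N \<ge> 0" using wmax_ge by (simp add: N_def)
  have i: "integrable SM (e a b)" if "a + b \<le> 4" for a b using e that by (simp add: weak_array_def)
  have sup: "\<bar>cont_rep e a b z\<bar> \<le> N" if "k \<le> a" "l \<le> b" "a + b \<le> 2" "z \<in> Lam" for a b z
  proof -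
    have "\<bar>cont_rep e a b z\<bar> \<le> wmax * wmax * (norm1 (e a b) + norm1 (e (Suc a) b) + norm1 (e a (Suc b)) + norm1 (e (Suc a) (Suc b)))"
      unfolding cont_rep_def using that by (intro sobolev_rep_bound i) auto
    also have "\<dots> \<le> wmax * wmax * (M + M + M + M)"
      using that wmax_ge by (intro mult_left_mono add_mono M) auto
    finally show ?thesis by (simp add: N_def)
  qed
  have weight: "2 * wmax * (M + M) \<le> N"
    using mult_right_mono[OF wmax_sq(2) M0] by (simp add: N_def)
  \<comment> \<open>The condition is k \<le> a + 1 instead of k \<le> a, because an oscillation in x
    involves only entries with first index a + 1. This covers the data with first index 1 in the
    case k = 2.\<close>
  have oscx: "\<bar>cont_rep e a b (x, y) - cont_rep e a b (x', y)\<bar> \<le> N"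
    if "k \<le> Suc a" "l \<le> b" "a + b \<le> 2" "x \<in> {-1..1}" "x' \<in> {-1..1}" "y \<in> {-1..1}" for a b x x' y
  proof -
    have "\<bar>cont_rep e a b (x, y) - cont_rep e a b (x', y)\<bar> \<le> 2 * wmax * (norm1 (e (Suc a) b) + norm1 (e (Suc a) (Suc b)))"
      unfolding cont_rep_def using that by (intro sobolev_rep_osc_fst i) (auto simp: Lam_iff)
    also have "\<dots> \<le> 2 * wmax * (M + M)" using that wmax_ge by (intro mult_left_mono add_mono M) auto
    finally show ?thesis using weight by linarith
  qed
  have oscy: "\<bar>cont_rep e a b (x, y) - cont_rep e a b (x, y')\<bar> \<le> N"
    if "k \<le> a" "l \<le> Suc b" "a + b \<le> 2" "x \<in> {-1..1}" "y \<in> {-1..1}" "y' \<in> {-1..1}" for a b x y y'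
  proof -
    have "\<bar>cont_rep e a b (x, y) - cont_rep e a b (x, y')\<bar> \<le> 2 * wmax * (norm1 (e a (Suc b)) + norm1 (e (Suc a) (Suc b)))"
      unfolding cont_rep_def using that by (intro sobolev_rep_osc_snd i) (auto simp: Lam_iff)
    also have "\<dots> \<le> 2 * wmax * (M + M)" using that wmax_ge by (intro mult_left_mono add_mono M) auto
    finally show ?thesis using weight by linarith
  qed
  show "\<bar>cont_rep e k l z\<bar> \<le> 4 * wmax * wmax * M" using sup[of k l z] kl z by (simp add: N_def)
  have "\<bar>tcoeff (cont_rep e) r s\<bar> \<le> 100 * N" if rs: "k \<le> r" "l \<le> s" for r s
  proof (rule tcoeff_bound[OF cont_rep_deriv_array[OF e] kl rs])
    show "data_bound l N (\<lambda>y. cont_rep e 0 0 (x, y)) (\<lambda>y. cont_rep e 0 1 (x, y))" if "k = 0" "x \<in> {-1..1}" for x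
      unfolding data_bound_def using that by (auto intro!: sup oscy simp: Lam_iff)
    show "data_bound l N (\<lambda>y. cont_rep e 1 0 (x, y)) (\<lambda>y. cont_rep e 1 1 (x, y))" if "k \<le> 1" "x \<in> {-1..1}" for x
      unfolding data_bound_def using that kl by (auto intro!: sup oscy simp: Lam_iff)
    show "data_bound 0 N (\<lambda>y. cont_rep e 1 0 (x, y) - cont_rep e 1 0 (x', y)) (\<lambda>y. cont_rep e 1 1 (x, y) - cont_rep e 1 1 (x', y))"
      if "k = 2" "x \<in> {-1..1}" "x' \<in> {-1..1}" for x x'
      unfolding data_bound_def using that kl by (auto intro!: oscx)
  qed
  then have "\<bar>interpolant (cont_rep e) k l z\<bar> \<le> 256 * (100 * N)" using kl z N0 by (intro interpolant_bound) auto
  then show "\<bar>interpolant (cont_rep e) k l z\<bar> \<le> 25600 * (4 * wmax * wmax * M)" by (simp add: N_def)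
qed

theorem theorem7:
  fixes \<gamma> :: "nat \<times> nat"
  assumes "mi_order \<gamma> \<le> 2"
  shows "\<exists>C::real. \<forall>u\<in>H_Lam 4.
    L2_norm_Lam (D_weak \<gamma> (\<lambda>z. u z - interp u z))
      \<le> C * (H_seminorm_Lam (4 - mi_order \<gamma>) (D_weak \<gamma> u)
           + (\<Sum>\<alpha>\<in>{\<alpha>. mi_order \<alpha> = 3 - mi_order \<gamma>}.
                \<bar>LINT z|lebesgue_on Lam. D_weak \<alpha> (D_weak \<gamma> u) z\<bar>))"
proof -
  obtain k l where \<gamma>: "\<gamma> = (k, l)" by (cases \<gamma>)
  have kl: "k + l \<le> 2" using assms by (simp add: \<gamma> mi_order_def)
  define D where "D = 2 * (1 + 16 * wmax) ^ 4"
  \<comment> \<open>51202 = 2 * (25600 + 1): the interpolant and the function itself contribute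
    25600 and 1 times the supremum bound, and 2 is the square root of the area.\<close>
  define C where "C = 51202 * (4 * wmax * wmax * D)"
  have "L2_norm_Lam (D_weak \<gamma> (\<lambda>z. u z - interp u z))
      \<le> C * (H_seminorm_Lam (4 - mi_order \<gamma>) (D_weak \<gamma> u)
           + (\<Sum>\<alpha>\<in>{\<alpha>. mi_order \<alpha> = 3 - mi_order \<gamma>}.
                \<bar>LINT z|lebesgue_on Lam. D_weak \<alpha> (D_weak \<gamma> u) z\<bar>))" if u: "u \<in> H_Lam 4" for u
  proof -
    obtain g where g: "weak_array_of u g" by (rule H4_weak_array_of[OF u])
    note gs = weak_array_of_weak_array[OF g]
    define T where "T = (\<Sum>\<alpha>\<in>{\<alpha>. mi_order \<alpha> = 3 - (k + l)}. \<bar>LINT z|lebesgue_on Lam. D_weak \<alpha> (D_weak (k, l) u) z\<bar>)"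
    define H where "H = H_seminorm_Lam (4 - (k + l)) (D_weak (k, l) u)"
    define R where "R = H + T"
    have H0: "H \<ge> 0" unfolding H_def H_seminorm_Lam_def by (intro real_sqrt_ge_zero sum_nonneg) auto
    have T0: "T \<ge> 0" unfolding T_def by (intro sum_nonneg) auto
    have R0: "R \<ge> 0" using H0 T0 by (simp add: R_def)
    obtain c where c: "\<And>a b. a + b \<le> 2 \<Longrightarrow> (LINT z|SM. polys c a b z) = (LINT z|SM. g a b z)"
      "\<And>a b z. a + b > 2 \<Longrightarrow> polys c a b z = 0"
      using polys_mean[of "\<lambda>a b. LINT z|SM. g a b z"] by blast
    define e where "e = (\<lambda>a b z. g a b z - polys c a b z)"
    have e: "weak_array e" unfolding e_def by (rule weak_array_diff[OF gs polys_weak_array])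
    have gi: "integrable SM (g a b)" "integrable SM (\<lambda>z. (g a b z)\<^sup>2)" "AE z in SM. D_weak (a, b) u z = g a b z"
      if "a + b \<le> 4" for a b using g that by (auto simp: weak_array_of_def)
    have DD: "D_weak (a - k, b - l) (D_weak (k, l) u) \<in> L2_Lam"
        "AE z in SM. D_weak (a - k, b - l) (D_weak (k, l) u) z = g a b z"
      if "k \<le> a" "l \<le> b" "a + b \<le> 4" for a b
    proof -
      note * = D_weak_compose[OF u, of "a - k" "b - l" k l]
      show "D_weak (a - k, b - l) (D_weak (k, l) u) \<in> L2_Lam" using *(1) that by simp
      have "AE z in SM. D_weak (a - k, b - l) (D_weak (k, l) u) z = D_weak (a, b) u z" using *(2) that by simp
      with gi(3)[OF that(3)] show "AE z in SM. D_weak (a - k, b - l) (D_weak (k, l) u) z = g a b z"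
        by eventually_elim simp
    qed
    have M: "norm1 (e a b) \<le> D * R" if ab: "k \<le> a" "l \<le> b" "a + b \<le> 4" for a b
      unfolding D_def
    proof (rule poincare_chain[OF e R0 _ _ ab])
      fix a b assume ab: "k \<le> a" "l \<le> b" "a + b = (4::nat)"
      \<comment> \<open>Derivatives of the polynomial of order above 2 vanish, so the top order is
        unchanged by the subtraction.\<close>
      have "norm1 (e a b) = norm1 (g a b)" using c(2)[of a b] ab by (simp add: e_def)
      also have "\<dots> \<le> 2 * sqrt (LINT z|SM. (g a b z)\<^sup>2)" using ab by (intro norm1_L2 gi) auto
      also have "sqrt (LINT z|SM. (g a b z)\<^sup>2) = L2_norm_Lam (D_weak (a - k, b - l) (D_weak (k, l) u))"
        using ab gi(1)[of a b] by (intro L2_norm_AE[symmetric] DD) auto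
      also have "\<dots> \<le> H" unfolding H_def using ab kl by (intro H_seminorm_ge) (auto simp: mi_order_def)
      finally show "norm1 (e a b) \<le> 2 * R" using T0 by (simp add: R_def)
    next
      fix a b assume ab: "k \<le> a" "l \<le> b" "a + b \<le> (3::nat)"
      have ed: "(LINT z|SM. e a b z) = (LINT z|SM. g a b z) - (LINT z|SM. polys c a b z)"
        unfolding e_def using ab gi(1)[of a b]
        by (intro Bochner_Integration.integral_diff continuous_Lam_integrable[OF polys_continuous]) auto
      show "\<bar>LINT z|SM. e a b z\<bar> \<le> R"
      proof (cases "a + b \<le> 2")
        case True then show ?thesis using ed c(1) R0 by simp
      next
        case False
        then have ab3: "a + b = 3" using ab by simp
        let ?\<alpha> = "(a - k, b - l)"
        \<comment> \<open>At order 3 the subtraction changes nothing either, so this is a mean of a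
          derivative of u and one of the summands of T.\<close>
        have "(LINT z|SM. e a b z) = (LINT z|SM. g a b z)" using ed c(2)[of a b] ab3 by simp
        also have "\<dots> = (LINT z|lebesgue_on Lam. D_weak ?\<alpha> (D_weak (k, l) u) z)"
          using ab gi(1)[of a b] by (intro integral_lebesgue_SM_AE(1)[symmetric] L2_measurable DD) auto
        also have "\<bar>\<dots>\<bar> \<le> T"
          unfolding T_def
        proof (rule member_le_sum[where f = "\<lambda>\<alpha>. \<bar>LINT z|lebesgue_on Lam. D_weak \<alpha> (D_weak (k, l) u) z\<bar>"])
          show "?\<alpha> \<in> {\<alpha>. mi_order \<alpha> = 3 - (k + l)}" using ab ab3 by (auto simp: mi_order_def)
        qed (auto simp: finite_mi_order)
        finally show ?thesis using H0 by (simp add: R_def)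
      qed
    qed
    let ?h = "\<lambda>z. g k l z - interpolant (cont_rep g) k l z"
    define B where "B = 25601 * (4 * wmax * wmax * (D * R))"
    have "AE z in SM. (?h z)\<^sup>2 \<le> B\<^sup>2"
      using cont_rep_AE[OF gs kl] AE_space[of SM]
    proof eventually_elim
      case (elim z)
      then have z: "z \<in> Lam" by (simp add: space_SM)
      have "interpolant (cont_rep g) k l z = interpolant (cont_rep e) k l z + interpolant (polys c) k l z"
        unfolding e_def by (rule interpolant_add) (auto intro: cont_rep_diff_polys[OF gs])
      moreover have "interpolant (polys c) k l z = polys c k l z" using kl by (intro interpolant_polys) auto
      moreover have "g k l z = cont_rep e k l z + polys c k l z"
        using elim(1) cont_rep_diff_polys[OF gs kl z, of c] by (simp add: e_def)
      ultimately have "?h z = cont_rep e k l z - interpolant (cont_rep e) k l z" by simp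
      then have "\<bar>?h z\<bar> \<le> B" using interpolation_bound[OF e kl z M] by (simp add: B_def)
      from power_mono[OF this abs_ge_zero, of 2] show ?case by simp
    qed
    moreover have hm: "?h \<in> borel_measurable SM" using gi(1)[of k l] kl interpolant_measurable by auto
    moreover have B0: "B \<ge> 0" using wmax_ge R0 by (simp add: B_def D_def)
    ultimately have "(LINT z|SM. (?h z)\<^sup>2) \<le> (LINT z|SM. B\<^sup>2)"
      by (intro integral_mono_AE') auto
    also have "\<dots> = (2 * B)\<^sup>2" using measure_SM by (simp add: power2_eq_square)
    finally have "sqrt (LINT z|SM. (?h z)\<^sup>2) \<le> 2 * B" using B0 by (simp add: real_le_lsqrt)
    moreover have "L2_norm_Lam (D_weak (k, l) (\<lambda>z. u z - interp u z)) = sqrt (LINT z|SM. (?h z)\<^sup>2)"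
      by (rule L2_norm_AE[OF D_weak_error(1)[OF u g kl] hm D_weak_error(2)[OF u g kl]])
    moreover have "2 * B = C * R" by (simp add: B_def C_def)
    ultimately show ?thesis by (simp add: \<gamma> mi_order_def R_def H_def T_def)
  qed
  then show ?thesis by blast
qed

end
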